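(* Let $x(t;x_0)$ be a trajectory of the $C^{1+\epsilon}$ ($\epsilon>0$) flow $\dot x(t)=f(x)$ in $\mathbb{R}^d$ which falls into a normally contracting and invariant compact $C^1$ manifold $V\subset\mathbb{R}^d$ as $t\to\infty$. Assume that the flow on $V$ is differentiably conjugate to quasiperiodic flow on a torus. Then the $E(t)$ of $x(t;x_0)$ is linearly bounded, i.e. there is a constant $K>0$ such that $E(t)\le Kt$ for all $t\ge0$.
   Context: Norms are Euclidean and induced matrix norms. $C^{1+\epsilon}$ means that $f:\mathbb{R}^d\to\mathbb{R}^d$ is $C^1$ with locally $\epsilon$-Hölder continuous derivative. $\phi_t$ is the flow of $\dot x=f(x)$, so $x(t;x_0)=\phi_tx_0$ is the solution with $x(0)=x_0$. "Falls into $V$" means that the distance from $x(t;x_0)$ to $V$ tends to $0$ as $t\to\infty$. Quasiperiodic flow $\psi_t$ on the torus $T^n=(S^1)^n$ with angles $\theta_1,\dots,\theta_n$: $\theta_i(t)=(\theta_i(0)+\alpha_it)\bmod 2\pi$ for fixed real $\alpha_i$ (commensurable $\alpha_i$ are allowed). The flow on $V$ is differentiably conjugate to $\psi_t$ if there is a $C^1$ homeomorphism $h:V\to T^n$ with $C^1$ inverse such that $h(\phi_tx)=\psi_t(hx)$ for $x\in V$, $t\ge0$. $V$ is normally contracting if there are, for $x\in V$, direct sum decompositions $\mathbb{R}^d=T_x\oplus N_x$, where $T_x$ is the tangent space of $V$ at $x$ and $N_x$ varies continuously with $x$, and constants $c>0$, $\mu>0$ such that $\big\|\Pi_{N_y}\frac{\partial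 y}{\partial x}\big|_{N_x}\big\|<ce^{-\mu t}$ for all $x\in V$, $t\ge0$, $y=\phi_tx$, where $\frac{\partial y}{\partial x}$ is the derivative of $\phi_t$ at $x$ and $\Pi_{N_y}$ is the projection onto $N_y$ along $T_y$. Definition of $E$: let $\dot y=F(t,y)$ with $F(t,0)\equiv0$, $F$ continuous in $t$ and locally Lipschitz in $y$, and let $y(t;s,\eta)$ denote the solution with $y(s)=\eta$. Let $\alpha:[0,\infty)\to[0,\infty)$ be any continuous strictly increasing function with $\alpha(0)=0$. For $h>0$ the family $\tilde Y_\alpha(h)$ of approximations to the zero solution consists of all functions $\tilde y(\cdot;h)$ obtained from sequences $v_1,v_2,\dots\in\mathbb{R}^d$ with $\|v_n\|\le 1$ by $\tilde y(0;h)=0$, $\tilde y(nh;h)=y(nh;(n-1)h,\tilde y((n-1)h;h))+h\alpha(h)v_n$ for $n\ge1$, and $\tilde y(t;h)=y(t;(n-1)h,\tilde y((n-1)h;h))$ for $(n-1)h\le t<nh$. For every $T>0$ all these approximations exist on $[0,T]$ once $h$ is small enough. Define $e_\alpha(t;h)=\sup_{\tilde y\in\tilde Y_\alpha(h)}\|\tilde y(t;h)\|$ and $E(t)=E_\alpha(t)=\limsup_{h\to0^+} e_\alpha(t;h)/\alpha(h)$; this value does not depend on the choice of $\alpha$. The $E(t)$ of a trajectory $x(t;x_0)$ of $\dot x=f(x)$ is by definition the $E(t)$ of the zero solution of $\dot y=f(y+x(t;x_0))-f(x(t;x_0))$. *)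

theory Defs
  imports "HOL-Analysis.Analysis"
begin

definition ode_solution ::
  "(real \<Rightarrow> 'a::euclidean_space \<Rightarrow> 'a) \<Rightarrow> real set \<Rightarrow> (real \<Rightarrow> 'a) \<Rightarrow> bool" where
  "ode_solution F I u \<longleftrightarrow> (\<forall>t\<in>I. (u has_vector_derivative F t (u t)) (at t within I))"

text \<open>The value \<open>y(t; s, \<eta>)\<close> for \<open>s \<le> t\<close>. It is meaningful whenever the solution exists on
  \<open>[s, t]\<close> and is unique, as it is for right-hand sides that are continuous in time and
  locally Lipschitz in space; otherwise it is an unspecified value.\<close>

definition sol :: "(real \<Rightarrow> 'a::euclidean_space \<Rightarrow> 'a) \<Rightarrow> real \<Rightarrow> 'a \<Rightarrow> real \<Rightarrow> 'a" where
  "sol F s \<eta> t = (THE y. \<exists>u. ode_solution F {s..t} u \<and> u s = \<eta> \<and> u t = y)"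

definition flow :: "('a::euclidean_space \<Rightarrow> 'a) \<Rightarrow> real \<Rightarrow> 'a \<Rightarrow> 'a" where
  "flow f t x = sol (\<lambda>_. f) 0 x t"

definition admissible :: "(real \<Rightarrow> real) \<Rightarrow> bool" where
  "admissible \<alpha> \<longleftrightarrow> continuous_on {0..} \<alpha> \<and> strict_mono_on {0..} \<alpha> \<and> \<alpha> 0 = 0"

text \<open>Only the values at times \<open>t \<ge> 0\<close> matter. If a solution used in the construction blows up,
  the values from then on are unspecified; on a given interval \<open>[0, T]\<close> this does not happen
  once \<open>h\<close> is small, so the limit superior defining \<open>E\<close> is not affected.\<close>

definition approximations ::
  "(real \<Rightarrow> 'a::euclidean_space \<Rightarrow> 'a) \<Rightarrow> (real \<Rightarrow> real) \<Rightarrow> real \<Rightarrow> (real \<Rightarrow> 'a) set" where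
  "approximations F \<alpha> h = {y. \<exists>v::nat \<Rightarrow> 'a.
     (\<forall>n\<ge>1. norm (v n) \<le> 1) \<and>
     y 0 = 0 \<and>
     (\<forall>n\<ge>1. y (real n * h) =
        sol F ((real n - 1) * h) (y ((real n - 1) * h)) (real n * h) + (h * \<alpha> h) *\<^sub>R v n) \<and>
     (\<forall>n\<ge>1. \<forall>t. (real n - 1) * h \<le> t \<and> t < real n * h \<longrightarrow>
        y t = sol F ((real n - 1) * h) (y ((real n - 1) * h)) t)}"

definition e_sup ::
  "(real \<Rightarrow> 'a::euclidean_space \<Rightarrow> 'a) \<Rightarrow> (real \<Rightarrow> real) \<Rightarrow> real \<Rightarrow> real \<Rightarrow> ereal" where
  "e_sup F \<alpha> t h = (SUP y\<in>approximations F \<alpha> h. ereal (norm (y t)))"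

definition E_zero ::
  "(real \<Rightarrow> 'a::euclidean_space \<Rightarrow> 'a) \<Rightarrow> (real \<Rightarrow> real) \<Rightarrow> real \<Rightarrow> ereal" where
  "E_zero F \<alpha> t = Limsup (at_right 0) (\<lambda>h. e_sup F \<alpha> t h / ereal (\<alpha> h))"

definition E_traj ::
  "('a::euclidean_space \<Rightarrow> 'a) \<Rightarrow> (real \<Rightarrow> 'a) \<Rightarrow> (real \<Rightarrow> real) \<Rightarrow> real \<Rightarrow> ereal" where
  "E_traj f x \<alpha> t = E_zero (\<lambda>s y. f (y + x s) - f (x s)) \<alpha> t"

definition C1_on ::
  "'a::euclidean_space set \<Rightarrow> ('a \<Rightarrow> 'b::euclidean_space) \<Rightarrow> bool" where
  "C1_on U g \<longleftrightarrow> (\<exists>g' :: 'a \<Rightarrow> 'a \<Rightarrow>\<^sub>L 'b.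
     (\<forall>x\<in>U. (g has_derivative blinfun_apply (g' x)) (at x)) \<and> continuous_on U g')"

text \<open>The norm on \<open>'a \<Rightarrow>\<^sub>L 'a\<close> is the operator norm induced by the Euclidean norm.\<close>

definition C1_Holder :: "real \<Rightarrow> ('a::euclidean_space \<Rightarrow> 'a) \<Rightarrow> bool" where
  "C1_Holder \<epsilon> f \<longleftrightarrow> (\<exists>f' :: 'a \<Rightarrow> 'a \<Rightarrow>\<^sub>L 'a.
     (\<forall>x. (f has_derivative blinfun_apply (f' x)) (at x)) \<and> continuous_on UNIV f' \<and>
     (\<forall>x. \<exists>r>0. \<exists>C. \<forall>y\<in>ball x r. \<forall>z\<in>ball x r.
        norm (f' y - f' z) \<le> C * norm (y - z) powr \<epsilon>))"

text \<open>A map on an arbitrary subset (here: an embedded submanifold) is \<open>C\<^sup>1\<close> if it extends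
  locally to a \<open>C\<^sup>1\<close> map on an open subset of the ambient space.\<close>

definition C1_map_on ::
  "'a::euclidean_space set \<Rightarrow> ('a \<Rightarrow> 'b::euclidean_space) \<Rightarrow> bool" where
  "C1_map_on S g \<longleftrightarrow> (\<forall>p\<in>S. \<exists>U G. open U \<and> p \<in> U \<and> C1_on U G \<and> (\<forall>x\<in>U \<inter> S. G x = g x))"

definition C1_submanifold :: "nat \<Rightarrow> 'a::euclidean_space set \<Rightarrow> bool" where
  "C1_submanifold k V \<longleftrightarrow> (\<forall>p\<in>V. \<exists>U (W::'a set) g g' S.
     open U \<and> p \<in> U \<and> open W \<and> homeomorphism U W g g' \<and> C1_on U g \<and> C1_on W g' \<and>
     subspace S \<and> dim S = k \<and> g ` (U \<inter> V) = W \<inter> S)"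

definition tangent_space :: "'a::euclidean_space set \<Rightarrow> 'a \<Rightarrow> 'a set" where
  "tangent_space V x = {v. \<exists>\<gamma> e. e > 0 \<and> \<gamma> C1_differentiable_on {-e<..<e} \<and>
     \<gamma> ` {-e<..<e} \<subseteq> V \<and> \<gamma> 0 = x \<and> (\<gamma> has_vector_derivative v) (at 0)}"

definition direct_sum :: "'a::euclidean_space set \<Rightarrow> 'a set \<Rightarrow> bool" where
  "direct_sum T N \<longleftrightarrow> subspace T \<and> subspace N \<and> T \<inter> N = {0} \<and>
     (\<forall>v. \<exists>a\<in>T. \<exists>b\<in>N. v = a + b)"

definition proj_along :: "'a::euclidean_space set \<Rightarrow> 'a set \<Rightarrow> 'a \<Rightarrow> 'a" where
  "proj_along T N v = (THE b. b \<in> N \<and> v - b \<in> T)"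

text \<open>The subspaces \<open>N x\<close> vary continuously with \<open>x \<in> V\<close>: locally they have a continuous frame.\<close>

definition continuous_subspaces ::
  "'a::euclidean_space set \<Rightarrow> ('a \<Rightarrow> 'a set) \<Rightarrow> bool" where
  "continuous_subspaces V N \<longleftrightarrow> (\<forall>p\<in>V. \<exists>U (m::nat) (b :: nat \<Rightarrow> 'a \<Rightarrow> 'a). open U \<and> p \<in> U \<and>
     (\<forall>i<m. continuous_on (U \<inter> V) (b i)) \<and>
     (\<forall>x\<in>U \<inter> V. inj_on (\<lambda>i. b i x) {..<m} \<and> independent ((\<lambda>i. b i x) ` {..<m}) \<and>
        span ((\<lambda>i. b i x) ` {..<m}) = N x))"

text \<open>Operator norm of the restriction of the linear map \<open>A\<close> to the subspace \<open>S\<close>.\<close>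

definition onorm_on ::
  "'a::euclidean_space set \<Rightarrow> ('a \<Rightarrow> 'b::euclidean_space) \<Rightarrow> real" where
  "onorm_on S A = (SUP v\<in>{v\<in>S. norm v \<le> 1}. norm (A v))"

definition normally_contracting ::
  "('a::euclidean_space \<Rightarrow> 'a) \<Rightarrow> 'a set \<Rightarrow> bool" where
  "normally_contracting f V \<longleftrightarrow> (\<exists>N c \<mu>.
     (\<forall>x\<in>V. direct_sum (tangent_space V x) (N x)) \<and>
     continuous_subspaces V N \<and> c > 0 \<and> \<mu> > 0 \<and>
     (\<forall>x\<in>V. \<forall>t\<ge>0.
        onorm_on (N x)
          (proj_along (tangent_space V (flow f t x)) (N (flow f t x)) \<circ>
             frechet_derivative (flow f t) (at x))
        < c * exp (- \<mu> * t)))"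

text \<open>Forward invariance. Together with a conjugacy to a flow of bijections, as in
  \<open>conjugate_to_quasiperiodic\<close>, it gives \<open>flow f t ` V = V\<close>.\<close>

definition invariant :: "('a::euclidean_space \<Rightarrow> 'a) \<Rightarrow> 'a set \<Rightarrow> bool" where
  "invariant f V \<longleftrightarrow> (\<forall>p\<in>V. \<exists>u. ode_solution (\<lambda>_. f) {0..} u \<and> u 0 = p \<and> (\<forall>t\<ge>0. u t \<in> V))"

text \<open>The torus as a product of unit circles; the \<open>i\<close>-th angle of \<open>z\<close> is the argument of \<open>z $ i\<close>,
  so that \<open>\<theta>\<^sub>i \<mapsto> \<theta>\<^sub>i + \<omega>\<^sub>i t\<close> modulo \<open>2\<pi>\<close> is multiplication by \<open>cis (\<omega>\<^sub>i t)\<close>.\<close>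

definition torus :: "(complex ^ 'n) set" where
  "torus = {z. \<forall>i. norm (z $ i) = 1}"

definition quasiperiodic_flow :: "('n \<Rightarrow> real) \<Rightarrow> real \<Rightarrow> complex ^ 'n \<Rightarrow> complex ^ 'n" where
  "quasiperiodic_flow \<omega> t z = (\<chi> i. cis (\<omega> i * t) * z $ i)"

definition conjugate_to_quasiperiodic ::
  "('a::euclidean_space \<Rightarrow> 'a) \<Rightarrow> 'a set \<Rightarrow> ('n::finite \<Rightarrow> real) \<Rightarrow> bool" where
  "conjugate_to_quasiperiodic f V \<omega> \<longleftrightarrow> (\<exists>h k.
     homeomorphism V torus h k \<and> C1_map_on V h \<and> C1_map_on torus k \<and>
     (\<forall>x\<in>V. \<forall>t\<ge>0. h (flow f t x) = quasiperiodic_flow \<omega> t (h x)))"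

end

theory Submission
  imports Defs
begin

text \<open>The error of an approximation is a telescoping sum over the kicks, each kick being
  transported by the flow to the final time. So it suffices that the flow has, near the trajectory
  \<open>x\<close>, a Lipschitz constant \<open>M\<close> that does not depend on the length of the time interval.

  On \<open>V\<close> the flow is Lipschitz uniformly in time, also backwards, because it is conjugate to
  isometries of the torus. Differentiating along curves in \<open>V\<close>, its derivative is bounded on tangent
  vectors; the contraction of the normal components then bounds it on all vectors. Normal
  contraction also makes the distance from \<open>x\<close> to \<open>V\<close> decay geometrically. Pulling nearest
  points of \<open>V\<close> back along the flow, which distorts distances by a bounded factor only, gives a
  Cauchy sequence; the orbit of its limit \<open>q\<close> is exponentially close to \<open>x\<close>. As \<open>f'\<close> is Hoelder
  continuous, the linearizations along \<open>x\<close> and along the orbit of \<open>q\<close> differ by a summable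
  amount, so the bound on the derivative carries over to a neighbourhood of \<open>x\<close>.\<close>

section \<open>Ordinary differential equations\<close>

text \<open>The constant \<open>M\<close> must not depend on time, but the neighbourhood of
  \<open>x\<close> on which it holds may shrink with \<open>t\<close>: \<open>E\<close> is a limit
  for \<open>h\<close> to 0 at fixed \<open>t\<close>, where the kicks become arbitrarily small.
  This order of quantifiers lets mere continuity of \<open>f'\<close> handle the deviation from
  \<open>x\<close>: an error of order 1 / t per period is allowed, so all periods together
  contribute a bounded amount. Hoelder continuity is spent only on comparing \<open>x\<close> with
  the orbit of \<open>q\<close>, where no shrinking neighbourhood helps. Two obstacles shape the
  rest. Solutions of \<open>f\<close> may blow up and \<open>f\<close> is only locally Lipschitz, so
  the estimates live in a ball of radius \<open>R\<close> that contains \<open>V\<close> and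
  \<open>x\<close> with margin 1; backward time is used only on \<open>V\<close>, through the torus.
  And normal contraction bounds only the normal part of the derivative on \<open>N\<close>, with a
  constant \<open>c\<close> that may exceed 1; the tangential part of the image of a normal vector
  is not controlled for long times. Hence time is cut into periods \<open>T\<close>, over which
  everything is bounded crudely, and the derivatives are composed along the cut.\<close>

lemma gronwall_norm:
  fixes D D' :: "real \<Rightarrow> 'a::real_inner"
  assumes D: "\<And>t. t \<in> {a..b} \<Longrightarrow> (D has_vector_derivative D' t) (at t within {a..b})"
    and bnd: "\<And>t. t \<in> {a..b} \<Longrightarrow> norm (D' t) \<le> L * norm (D t) + g"
    and L: "0 \<le> L" and g: "0 \<le> g" and t: "t \<in> {a..b}"
  shows "norm (D t) \<le> exp (L * (t - a)) * (norm (D a) + g * (t - a))"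
proof -
  have main: "norm (D t) \<le> exp (L * (t - a)) * (sqrt ((norm (D a))\<^sup>2 + \<delta>\<^sup>2) + g * (t - a))"
    if \<delta>: "\<delta> > 0" for \<delta> :: real
  proof -
    \<comment> \<open>The norm is not differentiable at \<open>0\<close>, hence the regularization by \<open>\<delta>\<close>.\<close>
    define N where "N s = sqrt (D s \<bullet> D s + \<delta>\<^sup>2)" for s
    define \<phi> where "\<phi> s = exp (- L * (s - a)) * N s - g * (s - a)" for s
    have Npos: "N s > 0" for s
      unfolding N_def using \<delta> by (simp add: add_nonneg_pos)
    have Nge: "norm (D s) \<le> N s" for s
      unfolding N_def by (rule real_le_rsqrt) (simp add: power2_norm_eq_inner)
    have contD: "continuous_on {a..b} D"
      by (meson D has_vector_derivative_continuous continuous_on_eq_continuous_within)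
    have cont\<phi>: "continuous_on {a..b} \<phi>"
      unfolding \<phi>_def N_def by (intro continuous_intros contD)
    have "\<phi> t \<le> \<phi> a"
    proof (rule DERIV_nonpos_imp_decreasing_open[of a t \<phi>])
      show "a \<le> t" using t by simp
      show "continuous_on {a..t} \<phi>"
        using cont\<phi> t by (auto intro: continuous_on_subset)
      fix s assume s: "a < s" "s < t"
      have Ds: "(D has_vector_derivative D' s) (at s)"
        using D[of s] s t by (simp add: at_within_Icc_at)
      have 1: "((\<lambda>s. D s \<bullet> D s + \<delta>\<^sup>2) has_real_derivative (2 * (D s \<bullet> D' s))) (at s)"
        unfolding has_real_derivative_iff_has_vector_derivative has_vector_derivative_def
        using Ds unfolding has_vector_derivative_def
        by (auto intro!: derivative_eq_intros simp: inner_commute algebra_simps)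
      have 2: "(N has_real_derivative (2 * (D s \<bullet> D' s)) / (2 * N s)) (at s)"
      proof -
        have "0 < D s \<bullet> D s + \<delta>\<^sup>2" using \<delta> by (simp add: add_nonneg_pos)
        from DERIV_chain2[OF DERIV_real_sqrt[OF this] 1] show ?thesis
          unfolding N_def by (simp add: inverse_eq_divide)
      qed
      have 3: "(\<phi> has_real_derivative (- L * exp (- L * (s - a)) * N s
          + exp (- L * (s - a)) * ((2 * (D s \<bullet> D' s)) / (2 * N s)) - g)) (at s)"
        unfolding \<phi>_def by (rule derivative_eq_intros 2 refl | simp)+
      have "D s \<bullet> D' s \<le> norm (D s) * norm (D' s)"
        using Cauchy_Schwarz_ineq2[of "D s" "D' s"] by linarith
      also have "\<dots> \<le> N s * norm (D' s)"
        by (intro mult_right_mono Nge) auto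
      finally have "(2 * (D s \<bullet> D' s)) / (2 * N s) \<le> norm (D' s)"
        using Npos[of s] by (simp add: divide_simps mult.commute)
      also have "\<dots> \<le> L * norm (D s) + g" using bnd[of s] s t by simp
      also have "\<dots> \<le> L * N s + g" using L Nge[of s] by (simp add: mult_left_mono)
      finally have 4: "(2 * (D s \<bullet> D' s)) / (2 * N s) - L * N s \<le> g" by simp
      have "exp (- L * (s - a)) * ((2 * (D s \<bullet> D' s)) / (2 * N s) - L * N s) \<le> exp (- L * (s - a)) * g"
        by (intro mult_left_mono 4) auto
      \<comment> \<open>The exponential weight is at most 1 to the right of \<open>a\<close>;
        dropping it gives the forcing term \<open>g * (t - a)\<close> without a division by
        \<open>L\<close>.\<close>
      also have "\<dots> \<le> 1 * g" using L s g by (intro mult_right_mono) auto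
      finally have "(- L * exp (- L * (s - a)) * N s
          + exp (- L * (s - a)) * ((2 * (D s \<bullet> D' s)) / (2 * N s)) - g) \<le> 0"
        by (simp add: algebra_simps)
      with 3 show "\<exists>y. DERIV \<phi> s :> y \<and> y \<le> 0" by blast
    qed
    then have "exp (- L * (t - a)) * N t \<le> N a + g * (t - a)" by (simp add: \<phi>_def)
    then have "N t \<le> exp (L * (t - a)) * (N a + g * (t - a))"
      by (simp add: exp_minus inverse_eq_divide divide_simps mult.commute)
    with Nge[of t] show ?thesis by (simp add: N_def power2_norm_eq_inner)
  qed
  have "((\<lambda>\<delta>. exp (L * (t - a)) * (sqrt ((norm (D a))\<^sup>2 + \<delta>\<^sup>2) + g * (t - a))) \<longlongrightarrow>
      exp (L * (t - a)) * (sqrt ((norm (D a))\<^sup>2 + 0\<^sup>2) + g * (t - a))) (at_right 0)"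
    by (intro tendsto_intros)
  moreover have "eventually (\<lambda>\<delta>. norm (D t) \<le> exp (L * (t - a)) * (sqrt ((norm (D a))\<^sup>2 + \<delta>\<^sup>2) + g * (t - a)))
      (at_right (0::real))"
    using eventually_at_right_less[of "0::real"] by eventually_elim (rule main)
  ultimately have "norm (D t) \<le> exp (L * (t - a)) * (sqrt ((norm (D a))\<^sup>2 + 0\<^sup>2) + g * (t - a))"
    by (intro tendsto_lowerbound) auto
  then show ?thesis by simp
qed

text \<open>A global Lipschitz condition excludes blow-up. It holds in both applications:
  \<open>f\<close> composed with the projection to a ball, and the linear variational equation along
  an orbit.\<close>

lemma picard_global_existence:
  fixes F :: "real \<Rightarrow> 'a::euclidean_space \<Rightarrow> 'a"
  assumes T: "0 \<le> T" and L: "0 < L"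
    and cont: "continuous_on ({0..T} \<times> UNIV) (\<lambda>(t, x). F t x)"
    and lip: "\<And>t x y. t \<in> {0..T} \<Longrightarrow> norm (F t x - F t y) \<le> L * norm (x - y)"
  obtains u where "ode_solution F {0..T} u" "u 0 = u0"
proof -
  \<comment> \<open>In terms of \<open>v t = exp (- 2 * L * t) *\<^sub>R u t\<close> the Picard operator is a contraction on all of
    \<open>[0, T]\<close> at once; clamping the time by \<open>c\<close> makes it act on functions defined on the whole line.\<close>
  define c where "c t = max 0 (min t T)" for t
  have c: "c t \<in> {0..T}" for t using T by (auto simp: c_def)
  have c_id: "c t = t" if "t \<in> {0..T}" for t using that by (auto simp: c_def)
  have contc: "continuous_on UNIV c" unfolding c_def by (intro continuous_intros)
  define I where "I v \<tau> = exp (- (2 * L * \<tau>)) *\<^sub>R (u0 + integral {0..\<tau>} (\<lambda>s. F s (exp (2 * L * s) *\<^sub>R v s)))"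
    for v \<tau>
  have contF: "continuous_on {0..T} (\<lambda>s. F s (exp (2 * L * s) *\<^sub>R v s))"
    if "continuous_on UNIV v" for v
  proof -
    have "continuous_on {0..T} (\<lambda>s. (s, exp (2 * L * s) *\<^sub>R v s))"
      using continuous_on_subset[OF that, of "{0..T}"] by (intro continuous_intros) auto
    from continuous_on_compose2[OF cont this] show ?thesis by auto
  qed
  have contI: "continuous_on {0..T} (I v)" if "continuous_on UNIV v" for v
    unfolding I_def
    by (intro continuous_intros indefinite_integral_continuous_1 integrable_continuous_interval contF that)
  have bc: "(\<lambda>t. I v (c t)) \<in> bcontfun" if "continuous_on UNIV v" for v
  proof -
    have "continuous_on UNIV (\<lambda>t. I v (c t))"
      by (rule continuous_on_compose2[OF contI[OF that] contc]) (use c in auto)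
    moreover have "bounded (range (\<lambda>t. I v (c t)))"
      by (rule bounded_subset[OF compact_imp_bounded[OF compact_continuous_image[OF contI[OF that]]]])
         (use c in auto)
    ultimately show ?thesis by (simp add: bcontfun_def)
  qed
  define G where "G v = Bcontfun (\<lambda>t. I (apply_bcontfun v) (c t))" for v :: "real \<Rightarrow>\<^sub>C 'a"
  have G: "apply_bcontfun (G v) t = I (apply_bcontfun v) (c t)" for v t
    unfolding G_def using bc[of "apply_bcontfun v"] by (simp add: Bcontfun_inverse continuous_on_apply_bcontfun)
  have contr: "dist (G v) (G w) \<le> 1/2 * dist v w" for v w
  proof (rule dist_bound)
    fix t
    define \<tau> where "\<tau> = c t"
    have \<tau>: "0 \<le> \<tau>" "\<tau> \<le> T" using c[of t] by (auto simp: \<tau>_def)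
    define d where "d = dist v w"
    let ?v = "\<lambda>s. F s (exp (2 * L * s) *\<^sub>R apply_bcontfun v s)"
    let ?w = "\<lambda>s. F s (exp (2 * L * s) *\<^sub>R apply_bcontfun w s)"
    have int: "?v integrable_on {0..\<tau>}" "?w integrable_on {0..\<tau>}"
      using \<tau> by (auto intro!: integrable_continuous_interval continuous_on_subset[OF contF])
    \<comment> \<open>Origin of the factor 1/2: the weight grows at rate \<open>2 * L\<close>, twice
      the Lipschitz constant, so the integral of \<open>L * exp (2 * L * s)\<close> is at most half
      of the final weight.\<close>
    have hi: "((\<lambda>s. L * exp (2 * L * s) * d) has_integral (exp (2 * L * \<tau>) * d / 2 - exp (2 * L * 0) * d / 2)) {0..\<tau>}"
      by (rule fundamental_theorem_of_calculus[OF \<tau>(1)])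
         (auto intro!: derivative_eq_intros simp flip: has_real_derivative_iff_has_vector_derivative)
    have "norm (integral {0..\<tau>} ?v - integral {0..\<tau>} ?w) = norm (integral {0..\<tau>} (\<lambda>s. ?v s - ?w s))"
      by (simp add: int integral_diff)
    also have "\<dots> \<le> integral {0..\<tau>} (\<lambda>s. L * exp (2 * L * s) * d)"
    proof (rule integral_norm_bound_integral)
      show "(\<lambda>s. ?v s - ?w s) integrable_on {0..\<tau>}" by (intro integrable_diff int)
      show "(\<lambda>s. L * exp (2 * L * s) * d) integrable_on {0..\<tau>}" using hi by blast
      fix s assume s: "s \<in> {0..\<tau>}"
      have "norm (?v s - ?w s) \<le> L * norm (exp (2 * L * s) *\<^sub>R apply_bcontfun v s - exp (2 * L * s) *\<^sub>R apply_bcontfun w s)"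
        using lip[of s] s \<tau> by simp
      also have "\<dots> = L * exp (2 * L * s) * dist (apply_bcontfun v s) (apply_bcontfun w s)"
        by (simp add: dist_norm flip: scaleR_diff_right)
      also have "\<dots> \<le> L * exp (2 * L * s) * d"
        unfolding d_def using L by (intro mult_left_mono dist_bounded) auto
      finally show "norm (?v s - ?w s) \<le> L * exp (2 * L * s) * d" .
    qed
    also have "\<dots> = (exp (2 * L * \<tau>) - 1) * d / 2" using hi by (auto dest!: integral_unique simp: algebra_simps diff_divide_distrib)
    finally have le: "norm (integral {0..\<tau>} ?v - integral {0..\<tau>} ?w) \<le> (exp (2 * L * \<tau>) - 1) * d / 2" .
    have "dist (apply_bcontfun (G v) t) (apply_bcontfun (G w) t)
        = exp (- (2 * L * \<tau>)) * norm (integral {0..\<tau>} ?v - integral {0..\<tau>} ?w)"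
      by (simp add: G I_def dist_norm \<tau>_def flip: scaleR_diff_right)
    also have "\<dots> \<le> exp (- (2 * L * \<tau>)) * ((exp (2 * L * \<tau>) - 1) * d / 2)"
      by (intro mult_left_mono le) auto
    also have "\<dots> = (1 - exp (- (2 * L * \<tau>))) * d / 2"
      by (simp add: algebra_simps exp_minus diff_divide_distrib)
    also have "\<dots> \<le> 1/2 * d" by (simp add: d_def algebra_simps)
    finally show "dist (apply_bcontfun (G v) t) (apply_bcontfun (G w) t) \<le> 1/2 * dist v w"
      by (simp add: d_def)
  qed
  obtain v where v: "G v = v" using banach_fix_type[of "1/2" G] contr by auto
  define u where "u t = exp (2 * L * t) *\<^sub>R apply_bcontfun v t" for t
  have contv: "continuous_on UNIV (apply_bcontfun v)" by (simp add: continuous_on_apply_bcontfun)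
  have u: "u t = u0 + integral {0..t} (\<lambda>s. F s (u s))" if "t \<in> {0..T}" for t
  proof -
    have "apply_bcontfun v t = I (apply_bcontfun v) t" using G[of v t] v c_id[OF that] by simp
    then show ?thesis unfolding u_def I_def by (simp add: exp_minus)
  qed
  have "ode_solution F {0..T} u"
    unfolding ode_solution_def
  proof
    fix t assume t: "t \<in> {0..T}"
    have "((\<lambda>t. u0 + integral {0..t} (\<lambda>s. F s (u s))) has_vector_derivative 0 + F t (u t)) (at t within {0..T})"
      using contF[OF contv] t
      by (intro has_vector_derivative_add has_vector_derivative_const integral_has_vector_derivative) (auto simp: u_def)
    then have "((\<lambda>t. u0 + integral {0..t} (\<lambda>s. F s (u s))) has_vector_derivative F t (u t)) (at t within {0..T})" by simp
    then show "(u has_vector_derivative F t (u t)) (at t within {0..T})"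
      by (rule has_vector_derivative_transform[OF t, rotated]) (use u in auto)
  qed
  moreover have "u 0 = u0" using u[of 0] T by simp
  ultimately show ?thesis by (rule that)
qed

text \<open>Read \<open>r\<close> as the size of a neighbourhood or as the inverse of a constant;
  with \<open>P\<close> antitone in \<open>r\<close>, the minimum over a finite subcover serves all
  points. The Hoelder constant, the angle between the two bundles, the approximation by tangents and
  the Lipschitz constants of the conjugacy are obtained this way.\<close>

lemma compact_uniform_radius:
  fixes V :: "'a::topological_space set" and P :: "'a \<Rightarrow> real \<Rightarrow> bool"
  assumes V: "compact V"
    and mono: "\<And>y r r'. P y r \<Longrightarrow> 0 < r' \<Longrightarrow> r' \<le> r \<Longrightarrow> P y r'"
    and loc: "\<And>p. p \<in> V \<Longrightarrow> \<exists>r>0. \<forall>\<^sub>F y in nhds p. y \<in> V \<longrightarrow> P y r"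
  obtains r where "0 < r" "\<And>y. y \<in> V \<Longrightarrow> P y r"
proof -
  have "\<exists>r U. 0 < r \<and> open U \<and> p \<in> U \<and> (\<forall>y\<in>U. y \<in> V \<longrightarrow> P y r)" if "p \<in> V" for p
    using loc[OF that] unfolding eventually_nhds by blast
  then obtain r U where rU: "\<And>p. p \<in> V \<Longrightarrow> 0 < r p" "\<And>p. p \<in> V \<Longrightarrow> open (U p)"
    "\<And>p. p \<in> V \<Longrightarrow> p \<in> U p" "\<And>p y. p \<in> V \<Longrightarrow> y \<in> U p \<Longrightarrow> y \<in> V \<Longrightarrow> P y (r p)"
    by metis
  obtain C where C: "C \<subseteq> V" "finite C" "V \<subseteq> (\<Union>c\<in>C. U c)"
    by (rule compactE_image[OF V, of V U]) (use rU(2,3) in auto)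
  \<comment> \<open>\<open>insert 1\<close> covers an empty subcover.\<close>
  define m where "m = Min (insert 1 (r ` C))"
  have m: "0 < m" using C rU(1) by (auto simp: m_def)
  have "P y m" if y: "y \<in> V" for y
  proof -
    obtain c where c: "c \<in> C" "y \<in> U c" using C y by blast
    have "m \<le> r c" using c C by (auto simp: m_def)
    then show ?thesis using mono[OF rU(4)[of c y] m] c C y by blast
  qed
  with m show ?thesis by (rule that)
qed

section \<open>Autonomous equations: uniqueness, continuation near a solution, linearization\<close>

lemma ode_solution_subset:
  "ode_solution F I u \<Longrightarrow> J \<subseteq> I \<Longrightarrow> ode_solution F J u"
  unfolding ode_solution_def by (meson has_vector_derivative_within_subset subsetD)

lemma ode_solution_continuous_on: "ode_solution F I u \<Longrightarrow> continuous_on I u"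
  unfolding ode_solution_def
  by (meson has_vector_derivative_continuous continuous_on_eq_continuous_within)

lemma ode_solution_shift:
  assumes "ode_solution (\<lambda>_. f) {a..b} u"
  shows "ode_solution (\<lambda>_. f) {a - c..b - c} (\<lambda>t. u (t + c))"
  unfolding ode_solution_def
proof
  fix t assume t: "t \<in> {a - c..b - c}"
  have img: "(\<lambda>t. t + c) ` {a - c..b - c} = {a..b}" by simp
  have "(u has_vector_derivative f (u (t + c))) (at (t + c) within (\<lambda>t. t + c) ` {a - c..b - c})"
    unfolding img using assms t by (auto simp: ode_solution_def)
  moreover have "((\<lambda>t. t + c) has_vector_derivative 1) (at t within {a - c..b - c})"
    by (auto intro!: derivative_eq_intros)
  ultimately show "((\<lambda>t. u (t + c)) has_vector_derivative f (u (t + c))) (at t within {a - c..b - c})"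
    using vector_diff_chain_within by (fastforce simp: o_def)
qed

text \<open>The radius \<open>R\<close> is a parameter and \<open>L\<close> bounds \<open>f'\<close>
  only inside that ball, so the same \<open>f\<close> can be interpreted again with a larger ball
  when solutions leave the current one.\<close>

locale C1_field =
  fixes f :: "'a::euclidean_space \<Rightarrow> 'a" and f' :: "'a \<Rightarrow> 'a \<Rightarrow>\<^sub>L 'a" and R L :: real
  assumes deriv: "\<And>y. (f has_derivative blinfun_apply (f' y)) (at y)"
    and cont: "continuous_on UNIV f'"
    and bound: "\<And>y. norm y \<le> R \<Longrightarrow> norm (f' y) \<le> L"
    and L: "0 < L"
begin

lemma lipschitz:
  assumes "norm y \<le> R" "norm z \<le> R"
  shows "norm (f y - f z) \<le> L * norm (y - z)"
  by (rule differentiable_bound[of "cball 0 R" f "\<lambda>y. blinfun_apply (f' y)"])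
     (use assms bound deriv in \<open>auto simp: norm_blinfun.rep_eq[symmetric] intro: has_derivative_at_withinI\<close>)

lemma sol_dist:
  assumes u: "ode_solution (\<lambda>_. f) {a..b} u" "\<And>t. t \<in> {a..b} \<Longrightarrow> norm (u t) \<le> R"
    and v: "ode_solution (\<lambda>_. f) {a..b} v" "\<And>t. t \<in> {a..b} \<Longrightarrow> norm (v t) \<le> R"
    and t: "t \<in> {a..b}"
  shows "norm (u t - v t) \<le> exp (L * (t - a)) * norm (u a - v a)"
proof -
  have "norm (u t - v t) \<le> exp (L * (t - a)) * (norm (u a - v a) + 0 * (t - a))"
  proof (rule gronwall_norm[where b = b and D' = "\<lambda>t. f (u t) - f (v t)"])
    show "((\<lambda>t. u t - v t) has_vector_derivative f (u s) - f (v s)) (at s within {a..b})"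
      if "s \<in> {a..b}" for s
      using u v that by (auto simp: ode_solution_def intro!: has_vector_derivative_diff)
    show "norm (f (u s) - f (v s)) \<le> L * norm (u s - v s) + 0" if "s \<in> {a..b}" for s
      using lipschitz u v that by simp
  qed (use L t in auto)
  then show ?thesis by simp
qed

text \<open>The hypothesis on \<open>y\<close> says that the Gronwall bound at the final time is at
  most 1, which is the margin by which \<open>x\<close> stays inside the ball.\<close>

lemma exists_near:
  assumes x: "ode_solution (\<lambda>_. f) {a..b} x" "\<And>t. t \<in> {a..b} \<Longrightarrow> norm (x t) \<le> R - 1"
    and ab: "a \<le> b" and y: "exp (L * (b - a)) * norm (y - x a) \<le> 1"
  obtains u where "ode_solution (\<lambda>_. f) {a..b} u" "u a = y"
    "\<And>t. t \<in> {a..b} \<Longrightarrow> norm (u t) \<le> R"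
    "\<And>t. t \<in> {a..b} \<Longrightarrow> norm (u t - x t) \<le> exp (L * (t - a)) * norm (y - x a)"
proof -
  have "norm (x a) \<le> R - 1" using x(2) ab by simp
  with norm_ge_zero[of "x a"] have R: "1 \<le> R" by linarith
  \<comment> \<open>\<open>f \<circ> c\<close> is globally Lipschitz, and its solutions that start close to \<open>x\<close> never leave the ball.\<close>
  define c where "c = closest_point (cball (0::'a) R)"
  have c: "norm (c z) \<le> R" for z
    using closest_point_in_set[of "cball (0::'a) R" z] R by (auto simp: c_def)
  have c_lip: "norm (c z - c w) \<le> norm (z - w)" for z w
    using closest_point_lipschitz[of "cball (0::'a) R" z w] R by (auto simp: c_def dist_norm)
  have c_id: "norm z \<le> R \<Longrightarrow> c z = z" for z by (simp add: c_def closest_point_self)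
  have lip: "norm (f (c z) - f (c w)) \<le> L * norm (z - w)" for z w
    by (rule order_trans[OF lipschitz[OF c c]]) (use L c_lip in \<open>simp add: mult_left_mono\<close>)
  have contc: "continuous_on UNIV c"
    using R unfolding c_def by (intro continuous_on_closest_point) auto
  have contf: "continuous_on UNIV f"
    by (intro continuous_at_imp_continuous_on ballI has_derivative_continuous[OF deriv])
  have "continuous_on ({0..b - a} \<times> UNIV) (\<lambda>(t::real, z). f (c z))"
    unfolding split_beta by (rule continuous_on_compose2[OF contf], rule continuous_on_compose2[OF contc])
       (auto intro: continuous_intros)
  from picard_global_existence[OF _ L this lip]
  obtain w where w: "ode_solution (\<lambda>_ z. f (c z)) {0..b - a} w" "w 0 = y"
    using ab by auto
  define u where "u t = w (t - a)" for t
  have u: "ode_solution (\<lambda>_ z. f (c z)) {a..b} u" "u a = y"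
    using ode_solution_shift[of "\<lambda>z. f (c z)", OF w(1), of "-a"] w(2) by (auto simp: u_def[abs_def])
  have dist: "norm (u t - x t) \<le> exp (L * (t - a)) * norm (y - x a)" if t: "t \<in> {a..b}" for t
  proof -
    have "norm (u t - x t) \<le> exp (L * (t - a)) * (norm (u a - x a) + 0 * (t - a))"
    proof (rule gronwall_norm[where b = b and D' = "\<lambda>t. f (c (u t)) - f (x t)"])
      show "((\<lambda>t. u t - x t) has_vector_derivative f (c (u s)) - f (x s)) (at s within {a..b})"
        if "s \<in> {a..b}" for s
        using u x that by (auto simp: ode_solution_def intro!: has_vector_derivative_diff)
      show "norm (f (c (u s)) - f (x s)) \<le> L * norm (u s - x s) + 0" if "s \<in> {a..b}" for s
        using lip[of "u s" "x s"] c_id[of "x s"] x(2)[OF that] by simp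
    qed (use L t in auto)
    then show ?thesis by (simp add: u)
  qed
  have uR: "norm (u t) \<le> R" if t: "t \<in> {a..b}" for t
  proof -
    have "exp (L * (t - a)) * norm (y - x a) \<le> exp (L * (b - a)) * norm (y - x a)"
      using t L by (intro mult_right_mono) auto
    then have "norm (u t - x t) \<le> 1" using dist[OF t] y by linarith
    then show ?thesis using x(2)[OF t] norm_triangle_sub[of "u t" "x t"] by linarith
  qed
  have "ode_solution (\<lambda>_. f) {a..b} u"
    using u(1) c_id uR by (auto simp: ode_solution_def)
  from that[OF this u(2) uR dist] show ?thesis .
qed

end

lemma C1_field_exists:
  fixes f :: "'a::euclidean_space \<Rightarrow> 'a"
  assumes "\<And>y. (f has_derivative blinfun_apply (f' y)) (at y)" "continuous_on UNIV f'"
  obtains L where "C1_field f f' R L"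
proof -
  have "compact (f' ` cball 0 R)"
    using assms(2) by (intro compact_continuous_image) (auto intro: continuous_on_subset)
  from compact_imp_bounded[OF this] obtain B where B: "\<And>y. y \<in> cball 0 R \<Longrightarrow> norm (f' y) \<le> B"
    unfolding bounded_iff by blast
  \<comment> \<open>The maximum with 1 secures \<open>0 < L\<close>.\<close>
  have "C1_field f f' R (max B 1)"
  proof
    show "norm (f' y) \<le> max B 1" if "norm y \<le> R" for y using B[of y] that by simp
  qed (use assms in auto)
  then show ?thesis by (rule that)
qed

context C1_field
begin

text \<open>\<open>u\<close> and \<open>v\<close> may leave the ball of radius \<open>R\<close>. On
  a compact interval both are bounded, so Gronwall is applied in a fresh interpretation with a
  larger ball.\<close>

lemma unique:
  assumes u: "ode_solution (\<lambda>_. f) {a..b} u" and v: "ode_solution (\<lambda>_. f) {a..b} v"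
    and "u a = v a" and t: "t \<in> {a..b}"
  shows "u t = v t"
proof -
  have "compact (u ` {a..b} \<union> v ` {a..b})"
    using u v by (intro compact_Un compact_continuous_image ode_solution_continuous_on) auto
  from compact_imp_bounded[OF this]
  obtain B where B: "\<And>y. y \<in> u ` {a..b} \<union> v ` {a..b} \<Longrightarrow> norm y \<le> B"
    unfolding bounded_iff by blast
  obtain M where "C1_field f f' B M" using C1_field_exists[OF deriv cont] .
  then interpret B: C1_field f f' B M .
  show ?thesis using B.sol_dist[OF u _ v _ t] B assms(3) by simp
qed

lemma flow_eq:
  assumes u: "ode_solution (\<lambda>_. f) {0..t} u" and t: "0 \<le> t"
  shows "flow f t (u 0) = u t"
  unfolding flow_def sol_def
proof (rule the_equality)
  show "\<exists>w. ode_solution (\<lambda>_. f) {0..t} w \<and> w 0 = u 0 \<and> w t = u t" using u by blast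
  show "y = u t" if "\<exists>w. ode_solution (\<lambda>_. f) {0..t} w \<and> w 0 = u 0 \<and> w t = y" for y
  proof -
    from that obtain w where w: "ode_solution (\<lambda>_. f) {0..t} w" "w 0 = u 0" "w t = y" by blast
    show ?thesis using unique[OF w(1) u w(2), of t] w(3) t by simp
  qed
qed

text \<open>Adding \<open>x\<close> turns solutions of the deviation equation into solutions of the
  autonomous one, so uniqueness is inherited from \<open>unique\<close>. The approximations can then
  be treated as differences of solutions of \<open>f\<close>.\<close>

lemma sol_deviation_eq:
  assumes u: "ode_solution (\<lambda>_. f) {s..t} u" and x: "ode_solution (\<lambda>_. f) {s..t} x"
    and st: "s \<le> t"
  shows "sol (\<lambda>s y. f (y + x s) - f (x s)) s (u s - x s) t = u t - x t"
  unfolding sol_def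
proof (rule the_equality)
  show "\<exists>w. ode_solution (\<lambda>s y. f (y + x s) - f (x s)) {s..t} w \<and> w s = u s - x s \<and> w t = u t - x t"
  proof (intro exI[of _ "\<lambda>t. u t - x t"] conjI refl)
    show "ode_solution (\<lambda>s y. f (y + x s) - f (x s)) {s..t} (\<lambda>t. u t - x t)"
      unfolding ode_solution_def diff_add_cancel
      by (intro ballI has_vector_derivative_diff) (use u x in \<open>auto simp: ode_solution_def\<close>)
  qed
  fix y
  assume "\<exists>w. ode_solution (\<lambda>s y. f (y + x s) - f (x s)) {s..t} w \<and> w s = u s - x s \<and> w t = y"
  then obtain w where w: "ode_solution (\<lambda>s y. f (y + x s) - f (x s)) {s..t} w" "w s = u s - x s" "w t = y"
    by blast
  have "((\<lambda>t. w t + x t) has_vector_derivative (f (w r + x r) - f (x r)) + f (x r)) (at r within {s..t})"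
    if "r \<in> {s..t}" for r
    using w(1) x that by (intro has_vector_derivative_add) (auto simp: ode_solution_def)
  then have "ode_solution (\<lambda>_. f) {s..t} (\<lambda>t. w t + x t)" by (simp add: ode_solution_def)
  from unique[OF this u, of t] have "w t + x t = u t" using w(2) st by simp
  then show "y = u t - x t" using w(3) by (simp add: eq_diff_eq)
qed

lemma uniform_modulus:
  assumes "0 < e"
  obtains d where "0 < d" "\<And>y z. norm y \<le> R \<Longrightarrow> norm z \<le> R \<Longrightarrow> norm (y - z) < d \<Longrightarrow> norm (f' y - f' z) \<le> e"
proof -
  have "uniformly_continuous_on (cball 0 R) f'"
    by (intro compact_uniformly_continuous continuous_on_subset[OF cont]) auto
  from this[unfolded uniformly_continuous_on_def, rule_format, OF assms]
  obtain d where "0 < d" "\<forall>y\<in>cball 0 R. \<forall>z\<in>cball 0 R. dist z y < d \<longrightarrow> dist (f' z) (f' y) < e"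
    by blast
  then show ?thesis by (intro that[of d]) (auto simp: dist_norm less_imp_le)
qed

text \<open>The derivative is the time-\<open>T\<close> map of the variational equation along
  \<open>P\<close>. One estimate \<open>est\<close> for pairs \<open>u\<close>, \<open>v\<close>
  yields both claims: with \<open>v = P\<close> and small \<eta> it gives differentiability; in
  general \<eta> also accounts for the distance of \<open>u\<close> and \<open>v\<close> from
  \<open>P\<close>, so \<open>P\<close> may be a different orbit from both.\<close>

lemma linearization:
  assumes P: "ode_solution (\<lambda>_. f) {0..T} P" "\<And>t. t \<in> {0..T} \<Longrightarrow> norm (P t) \<le> R - 1"
    and T: "0 \<le> T"
  defines "A \<equiv> frechet_derivative (flow f T) (at (P 0))"
  shows "(flow f T has_derivative A) (at (P 0))"
    and "\<And>u v \<eta>. \<lbrakk>ode_solution (\<lambda>_. f) {0..T} u; ode_solution (\<lambda>_. f) {0..T} v;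
       \<And>t. t \<in> {0..T} \<Longrightarrow> norm (u t) \<le> R; \<And>t. t \<in> {0..T} \<Longrightarrow> norm (v t) \<le> R;
       \<And>t \<xi>. t \<in> {0..T} \<Longrightarrow> \<xi> \<in> closed_segment (u t) (v t) \<Longrightarrow> norm (f' \<xi> - f' (P t)) \<le> \<eta>\<rbrakk>
      \<Longrightarrow> norm (u T - v T - A (u 0 - v 0)) \<le> \<eta> * T * exp (2 * L * T) * norm (u 0 - v 0)"
proof -
  have PR: "norm (P t) \<le> R" if "t \<in> {0..T}" for t using P(2)[OF that] by simp
  have fP: "norm (blinfun_apply (f' (P t)) y) \<le> L * norm y" if "t \<in> {0..T}" for t y
    by (rule order_trans[OF norm_blinfun]) (use bound[OF PR[OF that]] in \<open>simp add: mult_right_mono\<close>)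
  have "continuous_on ({0..T} \<times> UNIV) (\<lambda>q. f' (P (fst q)))"
    by (rule continuous_on_compose2[OF cont], rule continuous_on_compose2[OF ode_solution_continuous_on[OF P(1)]])
       (auto intro: continuous_intros)
  then have contA: "continuous_on ({0..T} \<times> UNIV) (\<lambda>(t, x). blinfun_apply (f' (P t)) x)"
    unfolding split_beta by (intro continuous_intros)
  have "\<exists>W. ode_solution (\<lambda>t. blinfun_apply (f' (P t))) {0..T} W \<and> W 0 = w" for w
  proof -
    have "norm (blinfun_apply (f' (P t)) x - blinfun_apply (f' (P t)) y) \<le> L * norm (x - y)"
      if "t \<in> {0..T}" for t x y
      using fP[OF that, of "x - y"] by (simp only: blinfun.diff_right)
    from picard_global_existence[OF T L contA this] show ?thesis by metis
  qed
  then obtain W where W: "\<And>w. ode_solution (\<lambda>t. blinfun_apply (f' (P t))) {0..T} (W w)" "\<And>w. W w 0 = w"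
    by metis
  have dW: "(W w has_vector_derivative blinfun_apply (f' (P t)) (W w t)) (at t within {0..T})"
    if "t \<in> {0..T}" for w t
    using W that by (auto simp: ode_solution_def)
  \<comment> \<open>Gronwall with zero data, that is, uniqueness for the variational equation. It
    makes \<open>B\<close> linear, although \<open>W\<close> was chosen separately for each initial
    value.\<close>
  have Wzero: "D T = 0" if D: "\<And>t. t \<in> {0..T} \<Longrightarrow> (D has_vector_derivative blinfun_apply (f' (P t)) (D t)) (at t within {0..T})"
    and D0: "D 0 = 0" for D :: "real \<Rightarrow> 'a"
  proof -
    have "norm (D T) \<le> exp (L * (T - 0)) * (norm (D 0) + 0 * (T - 0))"
      using fP D L T by (intro gronwall_norm[where b = T]) auto
    then show ?thesis using D0 by simp
  qed
  define B where "B w = W w T" for w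
  have "linear B"
  proof
    show "B (v + w) = B v + B w" for v w
    proof -
      have "W (v + w) T - W v T - W w T = 0"
      proof (rule Wzero[of "\<lambda>t. W (v + w) t - W v t - W w t"])
        fix t assume t: "t \<in> {0..T}"
        show "((\<lambda>t. W (v + w) t - W v t - W w t) has_vector_derivative
            blinfun_apply (f' (P t)) (W (v + w) t - W v t - W w t)) (at t within {0..T})"
          unfolding blinfun.diff_right by (intro has_vector_derivative_diff dW t)
      qed (simp add: W)
      then show ?thesis by (simp add: B_def algebra_simps)
    qed
    show "B (r *\<^sub>R w) = r *\<^sub>R B w" for r w
    proof -
      have "W (r *\<^sub>R w) T - r *\<^sub>R W w T = 0"
      proof (rule Wzero[of "\<lambda>t. W (r *\<^sub>R w) t - r *\<^sub>R W w t"])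
        fix t assume t: "t \<in> {0..T}"
        show "((\<lambda>t. W (r *\<^sub>R w) t - r *\<^sub>R W w t) has_vector_derivative
            blinfun_apply (f' (P t)) (W (r *\<^sub>R w) t - r *\<^sub>R W w t)) (at t within {0..T})"
          unfolding blinfun.diff_right blinfun.scaleR_right
          by (intro has_vector_derivative_diff dW t bounded_linear.has_vector_derivative[OF bounded_linear_scaleR_right])
      qed (simp add: W)
      then show ?thesis by (simp add: B_def)
    qed
  qed
  then have bl: "bounded_linear B" by (simp add: linear_conv_bounded_linear)
  have est: "norm (u T - v T - B (u 0 - v 0)) \<le> \<eta> * T * exp (2 * L * T) * norm (u 0 - v 0)"
    if u: "ode_solution (\<lambda>_. f) {0..T} u" "\<And>t. t \<in> {0..T} \<Longrightarrow> norm (u t) \<le> R"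
      and v: "ode_solution (\<lambda>_. f) {0..T} v" "\<And>t. t \<in> {0..T} \<Longrightarrow> norm (v t) \<le> R"
      and seg: "\<And>t \<xi>. t \<in> {0..T} \<Longrightarrow> \<xi> \<in> closed_segment (u t) (v t) \<Longrightarrow> norm (f' \<xi> - f' (P t)) \<le> \<eta>"
    for u v \<eta>
  proof -
    define w where "w = u 0 - v 0"
    have \<eta>: "0 \<le> \<eta>" using order_trans[OF norm_ge_zero seg[of 0 "u 0"]] T by simp
    define D where "D t = u t - v t - W w t" for t
    \<comment> \<open>Bounds the inhomogeneity in the linear equation for \<open>D\<close> below:
      \<eta> times the largest value that \<open>sol_dist\<close> allows for
      \<open>norm (u t - v t)\<close>. The initial value of \<open>D\<close> is 0.\<close>
    define g where "g = \<eta> * (exp (L * T) * norm w)"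
    have "norm (D T) \<le> exp (L * (T - 0)) * (norm (D 0) + g * (T - 0))"
    proof (rule gronwall_norm[where b = T and D' = "\<lambda>t. f (u t) - f (v t) - blinfun_apply (f' (P t)) (W w t)"])
      fix t assume t: "t \<in> {0..T}"
      show "(D has_vector_derivative f (u t) - f (v t) - blinfun_apply (f' (P t)) (W w t)) (at t within {0..T})"
        unfolding D_def using u v t dW by (intro has_vector_derivative_diff) (auto simp: ode_solution_def)
      \<comment> \<open>The nonlinear remainder: its derivative at \<xi> is
        \<open>f' \<xi> - f' (P t)\<close>, which the hypothesis on segments bounds by
        \<eta>.\<close>
      let ?g = "\<lambda>y. f y - blinfun_apply (f' (P t)) y"
      have "norm (?g (u t) - ?g (v t)) \<le> \<eta> * norm (u t - v t)"
      proof (rule differentiable_bound[of "closed_segment (u t) (v t)" ?g "\<lambda>y. blinfun_apply (f' y - f' (P t))"])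
        fix \<xi> assume "\<xi> \<in> closed_segment (u t) (v t)"
        show "(?g has_derivative blinfun_apply (f' \<xi> - f' (P t))) (at \<xi> within closed_segment (u t) (v t))"
          unfolding blinfun.diff_left
          by (intro has_derivative_diff has_derivative_at_withinI[OF deriv] bounded_linear_imp_has_derivative
              blinfun.bounded_linear_right)
        show "onorm (blinfun_apply (f' \<xi> - f' (P t))) \<le> \<eta>"
          using seg[OF t \<open>\<xi> \<in> _\<close>] by (simp add: norm_blinfun.rep_eq)
      qed auto
      also have "\<dots> \<le> \<eta> * (exp (L * (t - 0)) * norm w)"
        unfolding w_def using sol_dist[OF u v t] \<eta> by (intro mult_left_mono) auto
      also have "\<dots> \<le> g"
        unfolding g_def using \<eta> L t by (intro mult_left_mono mult_right_mono) auto
      finally have 1: "norm (?g (u t) - ?g (v t)) \<le> g" .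
      have "f (u t) - f (v t) - blinfun_apply (f' (P t)) (W w t)
          = blinfun_apply (f' (P t)) (D t) + (?g (u t) - ?g (v t))"
        by (simp add: D_def blinfun.diff_right)
      then show "norm (f (u t) - f (v t) - blinfun_apply (f' (P t)) (W w t)) \<le> L * norm (D t) + g"
        using norm_triangle_mono[OF fP[OF t, of "D t"] 1] by metis
    qed (use L T \<eta> in \<open>auto simp: g_def\<close>)
    also have "\<dots> = \<eta> * T * (exp (L * T) * exp (L * T)) * norm w"
      by (simp add: D_def W w_def g_def)
    also have "exp (L * T) * exp (L * T) = exp (2 * L * T)" by (simp flip: exp_add)
    finally show ?thesis by (simp add: D_def B_def w_def)
  qed
  have flowP: "flow f T (P 0) = P T" by (rule flow_eq[OF P(1) T])
  have der: "(flow f T has_derivative B) (at (P 0))"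
    unfolding has_derivative_at_alt
  proof (intro conjI bl allI impI)
    fix e :: real assume e: "0 < e"
    \<comment> \<open>\<open>e / M\<close> will be the \<eta> of \<open>est\<close>; the summand 1
      keeps \<open>M\<close> positive when \<open>T = 0\<close>.\<close>
    define M where "M = T * exp (2 * L * T) + 1"
    have M: "M > 0" using T by (simp add: M_def add_nonneg_pos)
    obtain d where d: "0 < d" "\<And>y z. norm y \<le> R \<Longrightarrow> norm z \<le> R \<Longrightarrow> norm (y - z) < d \<Longrightarrow> norm (f' y - f' z) \<le> e / M"
      using uniform_modulus[of "e / M"] e M by auto
    show "\<exists>d>0. \<forall>y. norm (y - P 0) < d \<longrightarrow> norm (flow f T y - flow f T (P 0) - B (y - P 0)) \<le> e * norm (y - P 0)"
    \<comment> \<open>The entry \<open>d\<close> keeps nearby solutions within the modulus of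
      continuity up to time \<open>T\<close>; the entry 1 makes \<open>exists_near\<close>
      applicable.\<close>
    proof (intro exI[of _ "min d 1 / exp (L * T)"] conjI allI impI)
      show "0 < min d 1 / exp (L * T)" using d by simp
      fix y assume "norm (y - P 0) < min d 1 / exp (L * T)"
      then have y: "exp (L * T) * norm (y - P 0) < min d 1" by (simp add: pos_less_divide_eq mult.commute)
      then have "exp (L * (T - 0)) * norm (y - P 0) \<le> 1" by simp
      from exists_near[OF P T this] obtain u where u: "ode_solution (\<lambda>_. f) {0..T} u" "u 0 = y"
        "\<And>t. t \<in> {0..T} \<Longrightarrow> norm (u t) \<le> R"
        "\<And>t. t \<in> {0..T} \<Longrightarrow> norm (u t - P t) \<le> exp (L * (t - 0)) * norm (y - P 0)" by blast
      have "norm (u T - P T - B (u 0 - P 0)) \<le> (e / M) * T * exp (2 * L * T) * norm (u 0 - P 0)"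
      proof (rule est[OF u(1,3) P(1) PR])
        fix t \<xi> assume t: "t \<in> {0..T}" and \<xi>: "\<xi> \<in> closed_segment (u t) (P t)"
        have "exp (L * (t - 0)) * norm (y - P 0) \<le> exp (L * T) * norm (y - P 0)"
          using t L by (intro mult_right_mono) auto
        then have "norm (u t - P t) < d" using u(4)[OF t] y by linarith
        moreover have "norm (\<xi> - P t) \<le> norm (u t - P t)"
          using segment_bound(2)[of \<xi> "u t" "P t"] \<xi> by (simp add: norm_minus_commute)
        moreover have "\<xi> \<in> cball 0 R"
          using \<xi> u(3)[OF t] PR[OF t] closed_segment_subset[of "u t" "cball 0 R" "P t"] by auto
        ultimately show "norm (f' \<xi> - f' (P t)) \<le> e / M"
          using d(2)[of \<xi> "P t"] PR[OF t] by auto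
      qed
      also have "\<dots> = e * ((M - 1) / M) * norm (u 0 - P 0)" by (simp add: M_def)
      also have "\<dots> \<le> e * 1 * norm (u 0 - P 0)"
        using e M by (intro mult_right_mono mult_left_mono) auto
      finally show "norm (flow f T y - flow f T (P 0) - B (y - P 0)) \<le> e * norm (y - P 0)"
        using flow_eq[OF u(1) T] flowP u(2) by simp
    qed
  qed
  have AB: "A = B" unfolding A_def using frechet_derivative_at[OF der] by simp
  show "(flow f T has_derivative A) (at (P 0))" using der AB by simp
  show "norm (u T - v T - A (u 0 - v 0)) \<le> \<eta> * T * exp (2 * L * T) * norm (u 0 - v 0)"
    if "ode_solution (\<lambda>_. f) {0..T} u" "ode_solution (\<lambda>_. f) {0..T} v"
       "\<And>t. t \<in> {0..T} \<Longrightarrow> norm (u t) \<le> R" "\<And>t. t \<in> {0..T} \<Longrightarrow> norm (v t) \<le> R"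
       "\<And>t \<xi>. t \<in> {0..T} \<Longrightarrow> \<xi> \<in> closed_segment (u t) (v t) \<Longrightarrow> norm (f' \<xi> - f' (P t)) \<le> \<eta>"
    for u v \<eta>
    unfolding AB using est[OF that(1,3,2,4,5)] by blast
qed

text \<open>\<open>exists_near\<close> only produces some solution with these bounds; by uniqueness
  it is the given one. So a solution that starts close to \<open>x\<close> cannot leave the
  ball.\<close>

lemma near_solution:
  assumes x: "ode_solution (\<lambda>_. f) {a..b} x" "\<And>t. t \<in> {a..b} \<Longrightarrow> norm (x t) \<le> R - 1"
    and u: "ode_solution (\<lambda>_. f) {a..b} u" and le: "exp (L * (b - a)) * norm (u a - x a) \<le> 1"
    and t: "t \<in> {a..b}"
  shows "norm (u t) \<le> R" and "norm (u t - x t) \<le> exp (L * (t - a)) * norm (u a - x a)"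
proof -
  have "a \<le> b" using t by simp
  have "norm (u t) \<le> R \<and> norm (u t - x t) \<le> exp (L * (t - a)) * norm (u a - x a)"
  proof (rule exists_near[OF x \<open>a \<le> b\<close> le])
    fix v assume v: "ode_solution (\<lambda>_. f) {a..b} v" "v a = u a" "\<And>t. t \<in> {a..b} \<Longrightarrow> norm (v t) \<le> R"
      "\<And>t. t \<in> {a..b} \<Longrightarrow> norm (v t - x t) \<le> exp (L * (t - a)) * norm (u a - x a)"
    have "v t = u t" by (rule unique[OF v(1) u v(2) t])
    then show ?thesis using v(3)[OF t] v(4)[OF t] by simp
  qed
  then show "norm (u t) \<le> R" "norm (u t - x t) \<le> exp (L * (t - a)) * norm (u a - x a)" by simp_all
qed

text \<open>One point lies in \<open>V\<close>, the other anywhere in the ball: this form compares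
  an orbit in \<open>V\<close> with a trajectory outside. Close pairs are handled by compactness of
  \<open>V\<close>, distant ones by the bound \<open>2 * L\<close>, which a constant absorbs since
  \<open>norm (y - z)\<close> is then at least \<open>r\<close>.\<close>

lemma compact_holder:
  assumes V: "compact V" "\<And>p. p \<in> V \<Longrightarrow> norm p \<le> R" and \<epsilon>: "0 < \<epsilon>"
    and loc_holder: "\<And>x. \<exists>r>0. \<exists>C. \<forall>y\<in>ball x r. \<forall>z\<in>ball x r. norm (f' y - f' z) \<le> C * norm (y - z) powr \<epsilon>"
  shows "\<exists>H\<ge>0. \<forall>z\<in>V. \<forall>y. norm y \<le> R \<longrightarrow> norm (f' y - f' z) \<le> H * norm (y - z) powr \<epsilon>"
proof -
  let ?P = "\<lambda>z r. \<forall>y. dist z y < r \<longrightarrow> norm (f' y - f' z) \<le> 1 / r * norm (y - z) powr \<epsilon>"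
  have mono: "?P z r'" if "?P z r" "0 < r'" "r' \<le> r" for z r r'
  proof (intro allI impI)
    fix y assume "dist z y < r'"
    then have "norm (f' y - f' z) \<le> 1 / r * norm (y - z) powr \<epsilon>" using that by simp
    also have "\<dots> \<le> 1 / r' * norm (y - z) powr \<epsilon>" using that by (intro mult_right_mono divide_left_mono) auto
    finally show "norm (f' y - f' z) \<le> 1 / r' * norm (y - z) powr \<epsilon>" .
  qed
  have loc: "\<exists>r>0. \<forall>\<^sub>F z in nhds p. z \<in> V \<longrightarrow> ?P z r" for p
  proof -
    obtain r0 C where r0: "0 < r0" "\<forall>y\<in>ball p r0. \<forall>z\<in>ball p r0. norm (f' y - f' z) \<le> C * norm (y - z) powr \<epsilon>"
      using loc_holder[of p] by blast
    \<comment> \<open>Half of \<open>r0\<close> lets both points fit into \<open>ball p r0\<close>;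
      the second entry achieves \<open>C \<le> 1 / r\<close>, whatever the sign of
      \<open>C\<close>.\<close>
    define r where "r = min (r0 / 2) (1 / (\<bar>C\<bar> + 1))"
    have r: "0 < r" "r \<le> r0 / 2" "r \<le> 1 / (\<bar>C\<bar> + 1)" using r0 by (auto simp: r_def)
    have "\<bar>C\<bar> + 1 \<le> 1 / r" using r by (simp add: field_simps)
    then have C: "C \<le> 1 / r" by simp
    have "\<forall>\<^sub>F z in nhds p. z \<in> ball p (r0 / 2)"
      by (intro eventually_nhds_in_open) (use r0 in auto)
    then have "\<forall>\<^sub>F z in nhds p. z \<in> V \<longrightarrow> ?P z r"
    proof eventually_elim
      case (elim z)
      show ?case
      proof (intro impI allI)
        fix y assume y: "dist z y < r"
        have "z \<in> ball p r0" "y \<in> ball p r0"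
          using elim y r(2) r0(1) dist_triangle[of p y z] by auto
        then have "norm (f' y - f' z) \<le> C * norm (y - z) powr \<epsilon>" using r0(2) by blast
        also have "\<dots> \<le> 1 / r * norm (y - z) powr \<epsilon>" by (rule mult_right_mono[OF C]) simp
        finally show "norm (f' y - f' z) \<le> 1 / r * norm (y - z) powr \<epsilon>" .
      qed
    qed
    then show ?thesis using r(1) by blast
  qed
  have "\<exists>r>0. \<forall>z\<in>V. ?P z r"
  proof (rule compact_uniform_radius[OF V(1), of ?P])
    show "?P z r'" if "?P z r" "0 < r'" "r' \<le> r" for z r r' by (rule mono[OF that])
    show "\<exists>r>0. \<forall>\<^sub>F z in nhds p. z \<in> V \<longrightarrow> ?P z r" if "p \<in> V" for p by (rule loc)
    show "\<exists>r>0. \<forall>z\<in>V. ?P z r" if "0 < r" "\<And>z. z \<in> V \<Longrightarrow> ?P z r" for r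
      using that by (intro exI[of _ r] conjI ballI) simp_all
  qed
  then obtain r where r: "0 < r" "\<forall>z\<in>V. ?P z r" by blast
  define H where "H = max (1 / r) (2 * L / r powr \<epsilon>)"
  have "norm (f' y - f' z) \<le> H * norm (y - z) powr \<epsilon>" if z: "z \<in> V" and y: "norm y \<le> R" for y z
  proof (cases "dist z y < r")
    case True
    then have "norm (f' y - f' z) \<le> 1 / r * norm (y - z) powr \<epsilon>" using r(2) z by blast
    also have "\<dots> \<le> H * norm (y - z) powr \<epsilon>" by (intro mult_right_mono) (auto simp: H_def)
    finally show ?thesis .
  next
    case False
    have "norm (f' y - f' z) \<le> 2 * L"
      using bound[OF y] bound[OF V(2)[OF z]] norm_triangle_ineq4[of "f' y" "f' z"] by linarith
    also have "\<dots> = 2 * L / r powr \<epsilon> * r powr \<epsilon>" using r by simp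
    also have "\<dots> \<le> 2 * L / r powr \<epsilon> * norm (y - z) powr \<epsilon>"
      using False r L \<epsilon> by (intro mult_left_mono powr_mono2) (auto simp: dist_norm norm_minus_commute)
    also have "\<dots> \<le> H * norm (y - z) powr \<epsilon>" by (intro mult_right_mono) (auto simp: H_def)
    finally show ?thesis .
  qed
  moreover have "0 \<le> H" using r(1) by (simp add: H_def le_max_iff_disj)
  ultimately show ?thesis by blast
qed

text \<open>All kicks are compared at the final time. Each one separates two solutions by at most
  \<open>h * \<alpha> h\<close> and is enlarged by \<open>M\<close> once, since \<open>lip\<close>
  covers the whole remaining interval; a bound applied from step to step would compound
  \<open>M\<close>. The deviation stays within \<open>r\<close> because
  \<open>M * t * \<alpha> h\<close> tends to 0.\<close>

lemma E_traj_le: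
  assumes x: "ode_solution (\<lambda>_. f) {0..} x" and M: "1 \<le> M" and t: "0 \<le> t" and r: "0 < r"
    and ex: "\<And>s y. 0 \<le> s \<Longrightarrow> s \<le> t \<Longrightarrow> norm (y - x s) \<le> r \<Longrightarrow>
      \<exists>u. ode_solution (\<lambda>_. f) {s..t} u \<and> u s = y"
    and lip: "\<And>s t' u v. 0 \<le> s \<Longrightarrow> s \<le> t' \<Longrightarrow> t' \<le> t \<Longrightarrow>
      ode_solution (\<lambda>_. f) {s..t'} u \<Longrightarrow> ode_solution (\<lambda>_. f) {s..t'} v \<Longrightarrow>
      norm (u s - x s) \<le> r \<Longrightarrow> norm (v s - x s) \<le> r \<Longrightarrow> norm (u t' - v t') \<le> M * norm (u s - v s)"
    and \<alpha>: "admissible \<alpha>"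
  shows "E_traj f x \<alpha> t \<le> ereal (M * t)"
proof -
  let ?F = "\<lambda>s y. f (y + x s) - f (x s)"
  have xon: "ode_solution (\<lambda>_. f) {a..b} x" if "0 \<le> a" for a b
    by (rule ode_solution_subset[OF x]) (use that in auto)
  have solE: "\<exists>u. ode_solution (\<lambda>_. f) {s..t} u \<and> u s = x s + \<eta> \<and> (\<forall>\<tau>\<in>{s..t}. sol ?F s \<eta> \<tau> = u \<tau> - x \<tau>)"
    if s: "0 \<le> s" "s \<le> t" and \<eta>: "norm \<eta> \<le> r" for s \<eta>
  proof -
    obtain u where u: "ode_solution (\<lambda>_. f) {s..t} u" "u s = x s + \<eta>"
      using ex[OF s, of "x s + \<eta>"] \<eta> by auto
    have "sol ?F s \<eta> \<tau> = u \<tau> - x \<tau>" if \<tau>: "\<tau> \<in> {s..t}" for \<tau>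
    proof -
      have "ode_solution (\<lambda>_. f) {s..\<tau>} u" by (rule ode_solution_subset[OF u(1)]) (use \<tau> in auto)
      from sol_deviation_eq[OF this xon[OF s(1)]] show ?thesis using \<tau> u(2) by simp
    qed
    with u show ?thesis by blast
  qed
  have sol_lip: "norm (sol ?F s \<eta> \<tau> - sol ?F s \<eta>' \<tau>) \<le> M * norm (\<eta> - \<eta>')"
    if s: "0 \<le> s" "s \<le> \<tau>" "\<tau> \<le> t" and \<eta>: "norm \<eta> \<le> r" "norm \<eta>' \<le> r" for s \<eta> \<eta>' \<tau>
  proof -
    have st: "s \<le> t" using s by simp
    obtain u where u: "ode_solution (\<lambda>_. f) {s..t} u" "u s = x s + \<eta>" "\<forall>\<tau>\<in>{s..t}. sol ?F s \<eta> \<tau> = u \<tau> - x \<tau>"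
      using solE[OF s(1) st \<eta>(1)] by blast
    obtain v where v: "ode_solution (\<lambda>_. f) {s..t} v" "v s = x s + \<eta>'" "\<forall>\<tau>\<in>{s..t}. sol ?F s \<eta>' \<tau> = v \<tau> - x \<tau>"
      using solE[OF s(1) st \<eta>(2)] by blast
    have "norm (u \<tau> - v \<tau>) \<le> M * norm (u s - v s)"
      using s u(2) v(2) \<eta>
      by (intro lip ode_solution_subset[OF u(1)] ode_solution_subset[OF v(1)]) auto
    then show ?thesis using u(2,3) v(2,3) s by simp
  qed
  have sol_0: "sol ?F s 0 \<tau> = 0" if "0 \<le> s" "s \<le> \<tau>" for s \<tau>
    using sol_deviation_eq[OF xon xon that(2)] that by simp
  have sol_semi: "sol ?F s' (sol ?F s \<eta> s') \<tau> = sol ?F s \<eta> \<tau>"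
    if s: "0 \<le> s" "s \<le> s'" "s' \<le> \<tau>" "\<tau> \<le> t" and \<eta>: "norm \<eta> \<le> r" for s s' \<tau> \<eta>
  proof -
    have st: "s \<le> t" "0 \<le> s'" using s by simp_all
    obtain u where u: "ode_solution (\<lambda>_. f) {s..t} u" "\<forall>\<tau>\<in>{s..t}. sol ?F s \<eta> \<tau> = u \<tau> - x \<tau>"
      using solE[OF s(1) st(1) \<eta>] by blast
    have "ode_solution (\<lambda>_. f) {s'..\<tau>} u" by (rule ode_solution_subset[OF u(1)]) (use s in auto)
    from sol_deviation_eq[OF this xon[OF st(2)] s(3)] show ?thesis using u(2) s by simp
  qed
  have est: "norm (y t) \<le> M * t * \<alpha> h"
    if h: "0 < h" and \<alpha>h: "0 < \<alpha> h" "M * t * \<alpha> h \<le> r" and y: "y \<in> approximations ?F \<alpha> h" for h y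
  proof -
    obtain v where v: "\<forall>n\<ge>1. norm (v n) \<le> 1" and y0: "y 0 = 0"
      and kick: "\<forall>n\<ge>1::nat. y (real n * h) =
        sol ?F ((real n - 1) * h) (y ((real n - 1) * h)) (real n * h) + (h * \<alpha> h) *\<^sub>R v n"
      and between: "\<forall>n\<ge>1::nat. \<forall>t. (real n - 1) * h \<le> t \<and> t < real n * h \<longrightarrow>
        y t = sol ?F ((real n - 1) * h) (y ((real n - 1) * h)) t"
      using y unfolding approximations_def mem_Collect_eq by (elim exE conjE)
    \<comment> \<open>The second conjunct is the invariant that avoids compounding: it bounds the
      continuation without further kicks at every later time, and a new kick changes this
      continuation by at most \<open>M * (h * \<alpha> h)\<close>.\<close>
    have ind: "norm (y (real n * h)) \<le> M * (real n * h) * \<alpha> h \<and>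
        (\<forall>\<tau>\<in>{real n * h..t}. norm (sol ?F (real n * h) (y (real n * h)) \<tau>) \<le> M * (real n * h) * \<alpha> h)"
      if "real n * h \<le> t" for n
      using that
    proof (induction n)
      case 0
      then show ?case using y0 sol_0[of 0] by simp
    next
      case (Suc n)
      define s where "s = real n * h"
      define s' where "s' = real (Suc n) * h"
      have s: "0 \<le> s" "s' = s + h" "s \<le> s'" "s' \<le> t" "s \<le> t"
        using h Suc.prems by (auto simp: s_def s'_def distrib_right)
      have IH: "norm (y s) \<le> M * s * \<alpha> h" "\<forall>\<tau>\<in>{s..t}. norm (sol ?F s (y s) \<tau>) \<le> M * s * \<alpha> h"
        using Suc.IH s(5) by (simp_all add: s_def)
      \<comment> \<open>The accumulated bounds lie below \<open>r\<close>, so \<open>lip\<close> and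
        the existence hypothesis apply both before and after the kick.\<close>
      have le_r: "M * s * \<alpha> h \<le> r" "M * s' * \<alpha> h \<le> r"
        using s M \<alpha>h by (auto intro!: order_trans[OF _ \<alpha>h(2)] mult_right_mono mult_left_mono)
      \<comment> \<open>The state at \<open>s'\<close> just before the kick. By
        \<open>sol_semi\<close> its continuation is that of \<open>y s\<close>, hence already
        bounded.\<close>
      define z where "z = sol ?F s (y s) s'"
      have z: "norm z \<le> M * s * \<alpha> h" unfolding z_def using IH(2) s by simp
      have ys': "y s' = z + (h * \<alpha> h) *\<^sub>R v (Suc n)"
        using kick[rule_format, of "Suc n"] by (simp add: z_def s_def s'_def)
      have kn: "norm (y s' - z) \<le> h * \<alpha> h"
        using v[rule_format, of "Suc n"] h \<alpha>h(1) mult_left_le[of "norm (v (Suc n))" "h * \<alpha> h"]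
        by (simp add: ys' abs_mult)
      also have "\<dots> \<le> M * (h * \<alpha> h)" using M h \<alpha>h(1) mult_right_mono[OF M, of "h * \<alpha> h"] by simp
      finally have kM: "norm (y s' - z) \<le> M * (h * \<alpha> h)" .
      have sum: "M * (h * \<alpha> h) + M * s * \<alpha> h = M * s' * \<alpha> h" by (simp add: s(2) algebra_simps)
      have ny: "norm (y s') \<le> M * s' * \<alpha> h"
        using norm_triangle_mono[OF kM z] sum by simp
      have "norm (sol ?F s' (y s') \<tau>) \<le> M * s' * \<alpha> h" if \<tau>: "\<tau> \<in> {s'..t}" for \<tau>
      proof -
        have "norm (sol ?F s' (y s') \<tau> - sol ?F s' z \<tau>) \<le> M * norm (y s' - z)"
          using s \<tau> z ny le_r by (intro sol_lip) auto
        also have "\<dots> \<le> M * (h * \<alpha> h)" using kn M by (intro mult_left_mono) auto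
        finally have 1: "norm (sol ?F s' (y s') \<tau> - sol ?F s' z \<tau>) \<le> M * (h * \<alpha> h)" .
        have "sol ?F s' z \<tau> = sol ?F s (y s) \<tau>"
          unfolding z_def using s \<tau> IH(1) le_r(1) by (intro sol_semi) auto
        then have 2: "norm (sol ?F s' z \<tau>) \<le> M * s * \<alpha> h" using IH(2) \<tau> s by simp
        show ?thesis using norm_triangle_mono[OF 1 2] sum by simp
      qed
      then show ?case using ny unfolding s'_def by blast
    qed
    define n where "n = nat \<lfloor>t / h\<rfloor>"
    have "real n \<le> t / h" "t / h < real n + 1" using t h unfolding n_def by (auto simp: le_nat_floor)
    then have n: "real n * h \<le> t" "t < real (Suc n) * h" using h by (auto simp: field_simps)
    \<comment> \<open>Since \<open>t\<close> lies in the half-open interval from \<open>n h\<close>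
      to \<open>(n + 1) h\<close>, the index is \<open>Suc n\<close>; if \<open>t\<close> is itself
      a kick time, that kick is already contained in \<open>y (real n * h)\<close>.\<close>
    have "y t = sol ?F (real n * h) (y (real n * h)) t"
      using between[rule_format, of "Suc n" t] n by simp
    then have "norm (y t) \<le> M * (real n * h) * \<alpha> h" using ind[OF n(1)] n(1) by simp
    also have "\<dots> \<le> M * t * \<alpha> h" using n(1) M \<alpha>h(1) by (intro mult_right_mono mult_left_mono) auto
    finally show ?thesis .
  qed
  have pos: "0 < \<alpha> h" if "0 < h" for h
    using \<alpha> that unfolding admissible_def strict_mono_on_def by (metis atLeast_iff less_imp_le order_refl)
  have "continuous_on {0..} \<alpha>" "\<alpha> 0 = 0" using \<alpha> by (simp_all add: admissible_def)
  from this(1)[unfolded continuous_on_def, rule_format, of 0] this(2)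
  have "(\<alpha> \<longlongrightarrow> 0) (at_right 0)" by (simp add: at_within_Ici_at_right)
  then have "((\<lambda>h. M * t * \<alpha> h) \<longlongrightarrow> M * t * 0) (at_right 0)" by (intro tendsto_mult tendsto_const)
  then have "\<forall>\<^sub>F h in at_right 0. M * t * \<alpha> h < r" by (rule order_tendstoD) (use r in simp)
  moreover have "\<forall>\<^sub>F h in at_right (0::real). 0 < h" by (rule eventually_at_right_less)
  ultimately have "\<forall>\<^sub>F h in at_right 0. e_sup ?F \<alpha> t h / ereal (\<alpha> h) \<le> ereal (M * t)"
  proof eventually_elim
    case (elim h)
    have "e_sup ?F \<alpha> t h \<le> ereal (M * t * \<alpha> h)"
      unfolding e_sup_def using est[OF elim(2) pos[OF elim(2)]] elim(1) by (intro SUP_least) simp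
    then have "e_sup ?F \<alpha> t h / ereal (\<alpha> h) \<le> ereal (M * t * \<alpha> h) / ereal (\<alpha> h)"
      by (rule ereal_divide_right_mono) (use pos[OF elim(2)] in simp)
    also have "\<dots> = ereal (M * t)" using pos[OF elim(2)] by simp
    finally show ?case .
  qed
  then show ?thesis unfolding E_traj_def E_zero_def by (rule Limsup_bounded)
qed

end

section \<open>Tangent and normal spaces of compact submanifolds\<close>

text \<open>Both points vary near \<open>w\<close>, and the derivative is taken at the moving point
  \<open>b\<close>. This uniformity comes from the continuity of \<open>G'\<close>, and it is needed
  when the foot point of a tangent vector moves.\<close>

lemma C1_strict_derivative:
  fixes G :: "'a::euclidean_space \<Rightarrow> 'b::euclidean_space" and G' :: "'a \<Rightarrow> 'a \<Rightarrow>\<^sub>L 'b"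
  assumes W: "open W" "w \<in> W" and G: "\<And>x. x \<in> W \<Longrightarrow> (G has_derivative blinfun_apply (G' x)) (at x)"
    and cont: "continuous_on W G'" and e: "0 < e"
  obtains r where "0 < r" "ball w r \<subseteq> W"
    "\<And>a b. a \<in> ball w r \<Longrightarrow> b \<in> ball w r \<Longrightarrow> norm (G a - G b - blinfun_apply (G' b) (a - b)) \<le> e * norm (a - b)"
proof -
  obtain r1 where r1: "0 < r1" "ball w r1 \<subseteq> W" using W open_contains_ball by blast
  obtain r2 where r2: "0 < r2" "\<And>x. x \<in> W \<Longrightarrow> dist x w < r2 \<Longrightarrow> dist (G' x) (G' w) < e / 2"
    using cont[unfolded continuous_on_iff, rule_format, OF W(2), of "e / 2"] e by auto
  define r where "r = min r1 r2"
  have rW: "ball w r \<subseteq> W" using r1 by (auto simp: r_def)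
  have close: "norm (G' x - G' b) \<le> e" if "x \<in> ball w r" "b \<in> ball w r" for x b
  proof -
    have "dist (G' x) (G' w) < e / 2" "dist (G' b) (G' w) < e / 2"
      using that rW by (intro r2(2); auto simp: r_def dist_commute)+
    then show ?thesis using dist_triangle2[of "G' x" "G' b" "G' w"] by (simp add: dist_norm)
  qed
  have "norm (G a - G b - blinfun_apply (G' b) (a - b)) \<le> norm (a - b) * e"
    if ab: "a \<in> ball w r" "b \<in> ball w r" for a b
  proof (rule differentiable_bound_linearization[where S = "ball w r"])
    show "b + t *\<^sub>R (a - b) \<in> ball w r" if "t \<in> {0..1}" for t
    proof -
      have "b + t *\<^sub>R (a - b) = (1 - t) *\<^sub>R b + t *\<^sub>R a" by (simp add: algebra_simps)
      then show ?thesis using convexD_alt[OF convex_ball[of w r] ab(2,1)] that by simp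
    qed
    show "(G has_derivative blinfun_apply (G' x)) (at x within ball w r)" if "x \<in> ball w r" for x
      using G rW that by (blast intro: has_derivative_at_withinI)
    show "onorm (blinfun_apply (G' x) - blinfun_apply (G' b)) \<le> e" if "x \<in> ball w r" for x
      using close[OF that ab(2)] by (simp add: norm_blinfun.rep_eq minus_blinfun.rep_eq fun_diff_def)
  qed (use ab in auto)
  then show ?thesis using r1 r2 rW by (intro that[of r]) (auto simp: r_def mult.commute)
qed

section \<open>Complementary subspaces and their projections\<close>

lemma direct_sumD:
  assumes "direct_sum T N"
  shows "subspace T" "subspace N" "T \<inter> N = {0}" "\<exists>a\<in>T. \<exists>b\<in>N. v = a + b"
  using assms unfolding direct_sum_def by blast+

text \<open>Addition is injective on \<open>T \<times> N\<close>, and an injective linear map on a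
  finite-dimensional space is bounded below. The inverse of \<kappa> bounds the norms of both
  projections.\<close>

lemma direct_sum_bounded_below:
  assumes "direct_sum T N"
  shows "\<exists>\<kappa>>0. \<forall>a\<in>T. \<forall>b\<in>N. \<kappa> * norm a \<le> norm (a + b) \<and> \<kappa> * norm b \<le> norm (a + b)"
proof -
  have s: "subspace T" "subspace N" "T \<inter> N = {0}" by (rule direct_sumD[OF assms])+
  have "\<exists>e>0. \<forall>x\<in>T \<times> N. norm (fst x + snd x) \<ge> e * norm x"
  proof (rule injective_imp_isometric)
    show "subspace (T \<times> N)" using s by (simp add: subspace_Times)
    then show "closed (T \<times> N)" by (rule closed_subspace)
    show "bounded_linear (\<lambda>x::'a \<times> 'a. fst x + snd x)"
      by (intro bounded_linear_add bounded_linear_fst bounded_linear_snd)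
    show "\<forall>x\<in>T \<times> N. fst x + snd x = 0 \<longrightarrow> x = 0"
    proof (intro ballI impI)
      fix x assume x: "x \<in> T \<times> N" "fst x + snd x = 0"
      then have eq: "snd x = - fst x" by (metis add.inverse_unique)
      have "fst x \<in> T" "snd x \<in> N" using x(1) by (simp_all add: mem_Times_iff)
      then have "snd x \<in> T \<inter> N" using subspace_neg[OF s(1), of "fst x"] unfolding eq by blast
      then have "snd x = 0" using s(3) by simp
      then show "x = 0" using eq by (simp add: prod_eq_iff)
    qed
  qed
  then obtain e where e: "0 < e" "\<And>a b. a \<in> T \<Longrightarrow> b \<in> N \<Longrightarrow> e * norm (a, b) \<le> norm (a + b)"
    by auto
  show ?thesis
  proof (intro exI[of _ e] conjI ballI e(1))
    fix a b assume ab: "a \<in> T" "b \<in> N"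
    have "e * norm a \<le> e * norm (a, b)" "e * norm b \<le> e * norm (a, b)"
      using e(1) norm_fst_le[of a b] norm_snd_le[of b a] by (simp_all add: mult_left_mono)
    then show "e * norm a \<le> norm (a + b)" "e * norm b \<le> norm (a + b)"
      using e(2)[OF ab] by linarith+
  qed
qed

lemma proj_along_eq:
  assumes "direct_sum T N" "a \<in> T" "b \<in> N"
  shows "proj_along T N (a + b) = b"
  unfolding proj_along_def
proof (rule the_equality)
  show "b \<in> N \<and> a + b - b \<in> T" using assms(2,3) by simp
next
  fix b' assume b': "b' \<in> N \<and> a + b - b' \<in> T"
  note s = direct_sumD(1-3)[OF assms(1)]
  have "b - b' \<in> N" by (rule subspace_diff[OF s(2) assms(3) conjunct1[OF b']])
  moreover have "(a + b - b') - a \<in> T" by (rule subspace_diff[OF s(1) conjunct2[OF b'] assms(2)])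
  then have "b - b' \<in> T" by simp
  ultimately have "b - b' \<in> T \<inter> N" by blast
  then show "b' = b" unfolding s(3) by simp
qed

text \<open>\<open>onorm_on\<close> is a supremum of reals and says something about a single vector
  only once the set is known to be bounded above. That follows from
  \<open>direct_sum_bounded_below\<close>: projecting to \<open>N\<close> enlarges norms by at most
  the factor 1 / \<kappa>.\<close>

lemma onorm_on_proj_bound:
  fixes A :: "'a::euclidean_space \<Rightarrow> 'a"
  assumes ds: "direct_sum T N" and M: "subspace M" and A: "bounded_linear A"
    and le: "onorm_on M (proj_along T N \<circ> A) \<le> C"
    and v: "v \<in> M" and Av: "A v = a + b" "a \<in> T" "b \<in> N"
  shows "norm b \<le> C * norm v"
proof (cases "v = 0")
  case True
  then have "a + b = 0" unfolding Av(1)[symmetric] using linear_0[OF bounded_linear.linear[OF A]] by simp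
  moreover have "0 \<in> T" "0 \<in> N" by (rule subspace_0 direct_sumD[OF ds])+
  ultimately have "b = 0"
    using proj_along_eq[OF ds Av(2,3)] proj_along_eq[OF ds, of 0 0] by (metis add_0)
  then show ?thesis by (simp add: True)
next
  case False
  define u where "u = v /\<^sub>R norm v"
  have u: "u \<in> M" "norm u \<le> 1" using False subspace_scale[OF M v] by (simp_all add: u_def)
  have sub: "subspace T" "subspace N" by (rule direct_sumD[OF ds])+
  obtain \<kappa> where \<kappa>: "0 < \<kappa>" "\<forall>a\<in>T. \<forall>b\<in>N. \<kappa> * norm a \<le> norm (a + b) \<and> \<kappa> * norm b \<le> norm (a + b)"
    using direct_sum_bounded_below[OF ds] by blast
  have "bdd_above ((\<lambda>v. norm ((proj_along T N \<circ> A) v)) ` {v \<in> M. norm v \<le> 1})"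
  proof (rule bdd_aboveI2)
    fix w assume w: "w \<in> {v \<in> M. norm v \<le> 1}"
    obtain p q where pq: "p \<in> T" "q \<in> N" "A w = p + q" using direct_sumD(4)[OF ds, of "A w"] by blast
    have "\<kappa> * norm q \<le> norm (A w)" using \<kappa>(2) pq by simp
    also have "\<dots> \<le> onorm A * norm w" by (rule onorm[OF A])
    also have "\<dots> \<le> onorm A * 1" using w onorm_pos_le[OF A] by (intro mult_left_mono) auto
    finally show "norm ((proj_along T N \<circ> A) w) \<le> onorm A / \<kappa>"
      using \<kappa>(1) by (simp add: pq proj_along_eq[OF ds] pos_le_divide_eq mult.commute)
  qed
  then have "norm ((proj_along T N \<circ> A) u) \<le> onorm_on M (proj_along T N \<circ> A)"
    unfolding onorm_on_def by (rule cSUP_upper[rotated]) (use u in simp)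
  then have "norm ((proj_along T N \<circ> A) u) \<le> C" using le by linarith
  moreover have "A u = a /\<^sub>R norm v + b /\<^sub>R norm v"
    unfolding u_def linear_cmul[OF bounded_linear.linear[OF A]] Av(1) by (rule scaleR_add_right)
  then have "(proj_along T N \<circ> A) u = b /\<^sub>R norm v"
    using proj_along_eq[OF ds, of "a /\<^sub>R norm v" "b /\<^sub>R norm v"]
      subspace_scale[OF sub(1) Av(2)] subspace_scale[OF sub(2) Av(3)] by (simp only: comp_apply)
  ultimately have "norm b / norm v \<le> C" by (simp add: divide_inverse mult.commute)
  then show ?thesis using False by (simp add: pos_divide_le_eq)
qed

section \<open>Curves, charts and tangent spaces\<close>

lemma vector_derivative_quotient:
  assumes "(\<gamma> has_vector_derivative v) (at 0)"
  shows "((\<lambda>s. (\<gamma> s - \<gamma> 0) /\<^sub>R s) \<longlongrightarrow> v) (at 0)"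
proof (rule LIM_zero_cancel, rule tendsto_norm_zero_cancel)
  have "((\<lambda>s. norm (\<gamma> s - \<gamma> 0 - s *\<^sub>R v) / norm s) \<longlongrightarrow> 0) (at 0)"
    using assms by (simp add: has_vector_derivative_def has_derivative_at)
  moreover have "\<forall>\<^sub>F s in at 0. norm (\<gamma> s - \<gamma> 0 - s *\<^sub>R v) / norm s = norm ((\<gamma> s - \<gamma> 0) /\<^sub>R s - v)"
  proof (rule eventually_at_topological[THEN iffD2], intro exI[of _ UNIV] conjI ballI impI)
    fix s :: real assume "s \<noteq> 0"
    then have "(\<gamma> s - \<gamma> 0) /\<^sub>R s - v = (\<gamma> s - \<gamma> 0 - s *\<^sub>R v) /\<^sub>R s"
      by (simp add: scaleR_diff_right)
    then show "norm (\<gamma> s - \<gamma> 0 - s *\<^sub>R v) / norm s = norm ((\<gamma> s - \<gamma> 0) /\<^sub>R s - v)"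
      by (simp add: divide_inverse mult.commute)
  qed auto
  ultimately show "((\<lambda>s. norm ((\<gamma> s - \<gamma> 0) /\<^sub>R s - v)) \<longlongrightarrow> 0) (at 0)"
    by (rule Lim_transform_eventually)
qed

text \<open>A Lipschitz estimate along a curve passes to difference quotients and hence to
  velocities. With \<delta> the image of \<gamma> under a flow map, it bounds the derivative of that
  map.\<close>

lemma vector_derivative_norm_le:
  assumes "(\<gamma> has_vector_derivative v) (at 0)" "(\<delta> has_vector_derivative w) (at 0)"
    and "\<forall>\<^sub>F s in at 0. norm (\<delta> s - \<delta> 0) \<le> C * norm (\<gamma> s - \<gamma> 0)"
  shows "norm w \<le> C * norm v"
proof (rule tendsto_le[of "at (0::real)"])
  show "((\<lambda>s. C * norm ((\<gamma> s - \<gamma> 0) /\<^sub>R s)) \<longlongrightarrow> C * norm v) (at 0)"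
    by (intro tendsto_intros vector_derivative_quotient assms)
  show "((\<lambda>s. norm ((\<delta> s - \<delta> 0) /\<^sub>R s)) \<longlongrightarrow> norm w) (at 0)"
    by (intro tendsto_intros vector_derivative_quotient assms)
  show "\<forall>\<^sub>F s in at 0. norm ((\<delta> s - \<delta> 0) /\<^sub>R s) \<le> C * norm ((\<gamma> s - \<gamma> 0) /\<^sub>R s)"
    using assms(3)
  proof eventually_elim
    case (elim s)
    from mult_left_mono[OF elim, of "inverse \<bar>s\<bar>"] show ?case by (simp add: mult.left_commute)
  qed
qed simp

text \<open>The derivatives that \<open>C1_on\<close> hides behind an existential are fixed here as
  continuous families \<open>Dg\<close> and \<open>Dg'\<close>, so that they can be compared at
  different points.\<close>

locale submanifold_chart =
  fixes V :: "'a::euclidean_space set" and U W :: "'a set" and g g' :: "'a \<Rightarrow> 'a" and S :: "'a set"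
    and Dg Dg' :: "'a \<Rightarrow> 'a \<Rightarrow>\<^sub>L 'a"
  assumes U: "open U" and W: "open W" and hom: "homeomorphism U W g g'"
    and Dg: "\<And>x. x \<in> U \<Longrightarrow> (g has_derivative blinfun_apply (Dg x)) (at x)" "continuous_on U Dg"
    and Dg': "\<And>x. x \<in> W \<Longrightarrow> (g' has_derivative blinfun_apply (Dg' x)) (at x)" "continuous_on W Dg'"
    and S: "subspace S" and img: "g ` (U \<inter> V) = W \<inter> S"
begin

lemma gW: "x \<in> U \<Longrightarrow> g x \<in> W" and g'U: "w \<in> W \<Longrightarrow> g' w \<in> U"
  and g'g: "x \<in> U \<Longrightarrow> g' (g x) = x" and gg': "w \<in> W \<Longrightarrow> g (g' w) = w"
  using hom by (auto simp: homeomorphism_def)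

lemma gS: "x \<in> U \<Longrightarrow> x \<in> V \<Longrightarrow> g x \<in> S" using img by blast

lemma g'V: "w \<in> W \<Longrightarrow> w \<in> S \<Longrightarrow> g' w \<in> V"
  using img g'g by (metis (no_types, lifting) IntE IntI image_iff)

lemma Dg'_Dg: "blinfun_apply (Dg' (g x)) (blinfun_apply (Dg x) v) = v" if x: "x \<in> U" for x v
proof -
  have "((g' \<circ> g) has_derivative (blinfun_apply (Dg' (g x)) \<circ> blinfun_apply (Dg x))) (at x)"
    using diff_chain_at[OF Dg(1)[OF x] Dg'(1)[OF gW[OF x]]] .
  moreover have "((g' \<circ> g) has_derivative (\<lambda>h. h)) (at x)"
    by (rule has_derivative_transform_within_open[OF has_derivative_ident U x]) (simp add: g'g)
  ultimately have "blinfun_apply (Dg' (g x)) \<circ> blinfun_apply (Dg x) = (\<lambda>h. h)"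
    by (rule has_derivative_unique)
  then show ?thesis by (metis comp_apply)
qed

lemma Dg_Dg': "blinfun_apply (Dg x) (blinfun_apply (Dg' (g x)) v) = v" if x: "x \<in> U" for x v
proof -
  have gx: "g x \<in> W" using gW[OF x] .
  have "((g \<circ> g') has_derivative (blinfun_apply (Dg (g' (g x))) \<circ> blinfun_apply (Dg' (g x)))) (at (g x))"
    using diff_chain_at[OF Dg'(1)[OF gx] Dg(1)[OF g'U[OF gx]]] .
  moreover have "((g \<circ> g') has_derivative (\<lambda>h. h)) (at (g x))"
    by (rule has_derivative_transform_within_open[OF has_derivative_ident W gx]) (simp add: gg')
  ultimately have "blinfun_apply (Dg x) \<circ> blinfun_apply (Dg' (g x)) = (\<lambda>h. h)"
    using has_derivative_unique g'g[OF x] by metis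
  then show ?thesis by (metis comp_apply)
qed

text \<open>The difference quotients of \<open>g \<circ> \<gamma>\<close> lie in the closed set
  \<open>S\<close>, so their limit does. The hypothesis is differentiability at 0 only, because
  images of curves under the flow are differentiated only at that point.\<close>

lemma curve_derivative:
  assumes y: "y \<in> U" and \<gamma>: "\<gamma> 0 = y" "(\<gamma> has_vector_derivative v) (at (0::real))"
    and ev: "\<forall>\<^sub>F s in at 0. \<gamma> s \<in> V" and yV: "y \<in> V"
  shows "blinfun_apply (Dg y) v \<in> S"
proof -
  have D: "((\<lambda>s. g (\<gamma> s)) has_derivative (\<lambda>h. h *\<^sub>R blinfun_apply (Dg y) v)) (at 0)"
    using diff_chain_at[OF \<gamma>(2)[unfolded has_vector_derivative_def], of g "blinfun_apply (Dg y)"] Dg(1)[OF y] \<gamma>(1)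
    by (simp add: o_def blinfun.scaleR_right)
  have lim: "((\<lambda>s. (g (\<gamma> s) - g y) /\<^sub>R s) \<longlongrightarrow> blinfun_apply (Dg y) v) (at 0)"
    using vector_derivative_quotient[OF D[folded has_vector_derivative_def]] \<gamma>(1) by simp
  have "isCont \<gamma> 0" using has_vector_derivative_continuous[OF \<gamma>(2)] .
  then have "\<forall>\<^sub>F s in at 0. \<gamma> s \<in> U"
    using topological_tendstoD[OF _ U] y \<gamma>(1) unfolding continuous_at by blast
  with ev have "\<forall>\<^sub>F s in at 0. (g (\<gamma> s) - g y) /\<^sub>R s \<in> S"
    by eventually_elim (use gS y yV S in \<open>auto intro!: subspace_scale subspace_diff\<close>)
  from Lim_in_closed_set[OF closed_subspace[OF S] this _ lim] show ?thesis by simp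
qed

lemma tangent_space_eq:
  assumes y: "y \<in> U" "y \<in> V"
  shows "tangent_space V y = {v. blinfun_apply (Dg y) v \<in> S}"
proof (intro equalityI subsetI)
  fix v assume "v \<in> tangent_space V y"
  then obtain \<gamma> e where \<gamma>: "e > 0" "\<gamma> ` {-e<..<e} \<subseteq> V" "\<gamma> 0 = y" "(\<gamma> has_vector_derivative v) (at (0::real))"
    unfolding tangent_space_def by blast
  have "\<forall>\<^sub>F s in at 0. s \<in> {-e<..<e}"
    using \<gamma>(1) by (intro eventually_at_in_open') auto
  then have "\<forall>\<^sub>F s in at 0. \<gamma> s \<in> V" by eventually_elim (use \<gamma> in auto)
  then show "v \<in> {v. blinfun_apply (Dg y) v \<in> S}" using curve_derivative[OF y(1) \<gamma>(3,4)] y by simp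
next
  fix v assume v: "v \<in> {v. blinfun_apply (Dg y) v \<in> S}"
  define z where "z = blinfun_apply (Dg y) v"
  have z: "z \<in> S" using v by (simp add: z_def)
  obtain r where r: "0 < r" "ball (g y) r \<subseteq> W" using W gW[OF y(1)] open_contains_ball by blast
  \<comment> \<open>Keeps \<open>s *\<^sub>R z\<close> shorter than \<open>r\<close>; the summand 1
    covers \<open>z = 0\<close>.\<close>
  define e where "e = r / (norm z + 1)"
  have e: "0 < e" using r by (simp add: e_def add_nonneg_pos)
  have inW: "g y + s *\<^sub>R z \<in> W" if "s \<in> {-e<..<e}" for s
  proof -
    have "norm (s *\<^sub>R z) \<le> \<bar>s\<bar> * (norm z + 1)" by (simp add: mult_left_mono)
    also have "\<dots> < e * (norm z + 1)" using that by (intro mult_strict_right_mono) (auto simp: add_nonneg_pos)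
    also have "\<dots> = r" using norm_ge_zero[of z] by (simp add: e_def add_nonneg_eq_0_iff)
    finally show ?thesis using r(2) by (auto simp: dist_norm)
  qed
  \<comment> \<open>A straight line in the slice, pulled back by the chart, realizes
    \<open>v\<close> as a velocity.\<close>
  define \<gamma> where "\<gamma> s = g' (g y + s *\<^sub>R z)" for s
  have d\<gamma>: "(\<gamma> has_vector_derivative blinfun_apply (Dg' (g y + s *\<^sub>R z)) z) (at s)" if "s \<in> {-e<..<e}" for s
  proof -
    have "((\<lambda>s. g y + s *\<^sub>R z) has_derivative (\<lambda>h. h *\<^sub>R z)) (at s)"
      by (auto intro!: derivative_eq_intros)
    from diff_chain_at[OF this Dg'(1)[OF inW[OF that]]] show ?thesis
      by (simp add: has_vector_derivative_def o_def \<gamma>_def[abs_def] blinfun.scaleR_right)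
  qed
  have "\<gamma> C1_differentiable_on {-e<..<e}"
    unfolding C1_differentiable_on_def
  proof (intro exI[of _ "\<lambda>s. blinfun_apply (Dg' (g y + s *\<^sub>R z)) z"] conjI ballI d\<gamma>)
    have "continuous_on {-e<..<e} (\<lambda>s. Dg' (g y + s *\<^sub>R z))"
      by (rule continuous_on_compose2[OF Dg'(2)]) (use inW in \<open>auto intro!: continuous_intros\<close>)
    then show "continuous_on {-e<..<e} (\<lambda>s. blinfun_apply (Dg' (g y + s *\<^sub>R z)) z)"
      by (intro continuous_intros)
  qed
  moreover have "\<gamma> ` {-e<..<e} \<subseteq> V"
  proof (intro image_subsetI)
    fix s assume "s \<in> {-e<..<e}"
    then show "\<gamma> s \<in> V"
      unfolding \<gamma>_def using S z gS[OF y] by (intro g'V inW subspace_add subspace_scale)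
  qed
  moreover have "\<gamma> 0 = y" using g'g y by (simp add: \<gamma>_def)
  moreover have "(\<gamma> has_vector_derivative v) (at 0)"
    using d\<gamma>[of 0] e Dg'_Dg[OF y(1), of v] by (simp add: z_def)
  ultimately show "v \<in> tangent_space V y" using e unfolding tangent_space_def by blast
qed

lemma Dg_isCont: "x \<in> U \<Longrightarrow> isCont Dg x" and Dg'_isCont: "w \<in> W \<Longrightarrow> isCont Dg' w"
  and g_isCont: "x \<in> U \<Longrightarrow> isCont g x"
  using Dg Dg' U W continuous_on_eq_continuous_at has_derivative_continuous by blast+

lemma eventually_Dg_bound: "p \<in> U \<Longrightarrow> \<forall>\<^sub>F y in nhds p. norm (Dg y) < norm (Dg p) + 1"
proof -
  assume p: "p \<in> U"
  have "(\<lambda>y. norm (Dg y)) \<midarrow>p\<rightarrow> norm (Dg p)" using Dg_isCont[OF p] by (auto simp: isCont_def intro: tendsto_norm)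
  then have "((\<lambda>y. norm (Dg y)) \<longlongrightarrow> norm (Dg p)) (nhds p)"
    using tendsto_at_iff_tendsto_nhds[of "\<lambda>y. norm (Dg y)" p] by blast
  then show ?thesis by (rule order_tendstoD) simp
qed

text \<open>Instead of adding \<tau> in space, its coordinate image \<open>s\<close> is added in the
  slice: \<open>g' (g y + s)\<close> lies in \<open>V\<close> and differs from
  \<open>y + \<tau>\<close> by the linearization error of \<open>g'\<close> at \<open>g y\<close>.
  The strict form of the derivative makes this error uniform in \<open>y\<close>.\<close>

lemma tangent_approx_local:
  assumes p: "p \<in> U" and e: "0 < e"
  shows "\<exists>r>0. \<forall>\<^sub>F y in nhds p. y \<in> V \<longrightarrow>
    (\<forall>\<tau>\<in>tangent_space V y. norm \<tau> \<le> r \<longrightarrow> infdist (y + \<tau>) V \<le> e * norm \<tau>)"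
proof -
  \<comment> \<open>\<open>M\<close> bounds \<open>Dg\<close> near \<open>p\<close>, hence
    \<open>norm s\<close> by \<open>M * norm \<tau>\<close>. This is why the strict derivative is
    used with \<open>e / M\<close> and the radius is \<open>\<rho> / (2 * M)\<close>.\<close>
  define M where "M = norm (Dg p) + 1"
  have M: "0 < M" by (simp add: M_def add_nonneg_pos)
  obtain \<rho> where \<rho>: "0 < \<rho>" "ball (g p) \<rho> \<subseteq> W"
    "\<And>a b. a \<in> ball (g p) \<rho> \<Longrightarrow> b \<in> ball (g p) \<rho> \<Longrightarrow>
      norm (g' a - g' b - blinfun_apply (Dg' b) (a - b)) \<le> (e / M) * norm (a - b)"
    using C1_strict_derivative[OF W gW[OF p] Dg', of "e / M"] e M by auto
  have "(g \<longlongrightarrow> g p) (nhds p)" using g_isCont[OF p] by (simp add: isCont_def tendsto_at_iff_tendsto_nhds)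
  then have "\<forall>\<^sub>F y in nhds p. g y \<in> ball (g p) (\<rho> / 2)"
    by (rule topological_tendstoD) (use \<rho> in auto)
  moreover have "\<forall>\<^sub>F y in nhds p. y \<in> U" using U p by (rule eventually_nhds_in_open)
  ultimately have "\<forall>\<^sub>F y in nhds p. y \<in> V \<longrightarrow>
    (\<forall>\<tau>\<in>tangent_space V y. norm \<tau> \<le> \<rho> / (2 * M) \<longrightarrow> infdist (y + \<tau>) V \<le> e * norm \<tau>)"
    using eventually_Dg_bound[OF p]
  proof eventually_elim
    case (elim y)
    show ?case
    proof (intro impI ballI)
      fix \<tau> assume y: "y \<in> V" and \<tau>: "\<tau> \<in> tangent_space V y" and le: "norm \<tau> \<le> \<rho> / (2 * M)"
      define s where "s = blinfun_apply (Dg y) \<tau>"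
      have sS: "s \<in> S" using \<tau> tangent_space_eq[OF elim(2) y] by (simp add: s_def)
      have "norm s \<le> norm (Dg y) * norm \<tau>" unfolding s_def by (rule norm_blinfun)
      also have "\<dots> \<le> M * norm \<tau>" using elim(3) by (intro mult_right_mono) (auto simp: M_def)
      finally have s: "norm s \<le> M * norm \<tau>" .
      also have "\<dots> \<le> \<rho> / 2" using le M by (simp add: field_simps)
      finally have s2: "norm s \<le> \<rho> / 2" .
      have gy: "dist (g p) (g y) < \<rho> / 2" using elim(1) by simp
      have "dist (g p) (g y + s) \<le> dist (g p) (g y) + norm s"
        using dist_triangle[of "g p" "g y + s" "g y"] by (simp add: dist_norm)
      then have b: "g y + s \<in> ball (g p) \<rho>" "g y \<in> ball (g p) \<rho>" using gy s2 \<rho> by auto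
      have "g' (g y + s) \<in> V" using b \<rho>(2) S sS gS[OF elim(2) y] by (intro g'V) (auto intro: subspace_add)
      then have "infdist (y + \<tau>) V \<le> dist (y + \<tau>) (g' (g y + s))" by (rule infdist_le)
      also have "\<dots> = norm (g' (g y + s) - g' (g y) - blinfun_apply (Dg' (g y)) (g y + s - g y))"
        using g'g[OF elim(2)] Dg'_Dg[OF elim(2), of \<tau>] by (simp add: s_def dist_norm norm_minus_commute algebra_simps)
      also have "\<dots> \<le> (e / M) * norm s" using \<rho>(3)[OF b] by simp
      also have "\<dots> \<le> (e / M) * (M * norm \<tau>)" using s e M by (intro mult_left_mono) auto
      also have "\<dots> = e * norm \<tau>" using M by simp
      finally show "infdist (y + \<tau>) V \<le> e * norm \<tau>" .
    qed
  qed
  then show ?thesis using \<rho> M by (intro exI[of _ "\<rho> / (2 * M)"]) auto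
qed

text \<open>\<open>a0\<close> is the vector at \<open>p\<close> with the same chart coordinates as
  \<open>a\<close>. The error is measured against \<open>a0\<close>, because the bounds to be
  carried over are those of the fixed splitting at \<open>p\<close>.\<close>

lemma tangent_gap:
  assumes p: "p \<in> U" "p \<in> V" and e: "0 < e"
  shows "\<forall>\<^sub>F y in nhds p. y \<in> V \<longrightarrow> (\<forall>a\<in>tangent_space V y. \<exists>a0\<in>tangent_space V p. norm (a - a0) \<le> e * norm a0)"
proof -
  define M where "M = norm (Dg p) + 1"
  have M: "0 < M" by (simp add: M_def add_nonneg_pos)
  have "isCont (\<lambda>y. Dg' (g y)) p" using g_isCont[OF p(1)] Dg'_isCont[OF gW[OF p(1)]] by (rule isCont_o2)
  then have "((\<lambda>y. Dg' (g y)) \<longlongrightarrow> Dg' (g p)) (nhds p)"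
    using tendsto_at_iff_tendsto_nhds[of "\<lambda>y. Dg' (g y)" p] unfolding isCont_def by blast
  then have "\<forall>\<^sub>F y in nhds p. dist (Dg' (g y)) (Dg' (g p)) < e / M"
    by (rule tendstoD) (use e M in auto)
  moreover have "\<forall>\<^sub>F y in nhds p. y \<in> U" using U p(1) by (rule eventually_nhds_in_open)
  ultimately show ?thesis
  proof eventually_elim
    case (elim y)
    show ?case
    proof (intro impI ballI)
      fix a assume y: "y \<in> V" and a: "a \<in> tangent_space V y"
      define s where "s = blinfun_apply (Dg y) a"
      define a0 where "a0 = blinfun_apply (Dg' (g p)) s"
      have s: "s = blinfun_apply (Dg p) a0" using Dg_Dg'[OF p(1)] by (simp add: a0_def)
      have sS: "s \<in> S" using a tangent_space_eq[OF elim(2) y] by (simp add: s_def)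
      have a0: "a0 \<in> tangent_space V p" using tangent_space_eq[OF p] s sS by simp
      have "norm s \<le> norm (Dg p) * norm a0" unfolding s by (rule norm_blinfun)
      also have "\<dots> \<le> M * norm a0" by (intro mult_right_mono) (auto simp: M_def)
      finally have s_le: "norm s \<le> M * norm a0" .
      have "a - a0 = blinfun_apply (Dg' (g y) - Dg' (g p)) s"
        using Dg'_Dg[OF elim(2), of a] by (simp add: a0_def s_def blinfun.diff_left)
      then have "norm (a - a0) \<le> norm (Dg' (g y) - Dg' (g p)) * norm s" by (simp add: norm_blinfun)
      also have "\<dots> \<le> (e / M) * (M * norm a0)"
        using elim(1) s_le e M by (intro mult_mono) (auto simp: dist_norm)
      also have "\<dots> = e * norm a0" using M by simp
      finally show "\<exists>a0\<in>tangent_space V p. norm (a - a0) \<le> e * norm a0" using a0 by blast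
    qed
  qed
qed

end

lemma submanifold_chart_exists:
  fixes V :: "'a::euclidean_space set"
  assumes "C1_submanifold k V" "p \<in> V"
  shows "\<exists>U W g g' S Dg Dg'. submanifold_chart V U W g g' S Dg Dg' \<and> p \<in> U"
  using assms(1)[unfolded C1_submanifold_def, rule_format, OF assms(2)]
proof (elim exE conjE)
  fix U W :: "'a set" and g g' S
  assume *: "open U" "p \<in> U" "open W" "homeomorphism U W g g'" "C1_on U g" "C1_on W g'"
    "subspace S" "g ` (U \<inter> V) = W \<inter> S"
  obtain Dg where Dg: "\<forall>x\<in>U. (g has_derivative blinfun_apply (Dg x)) (at x)" "continuous_on U Dg"
    using *(5) unfolding C1_on_def by blast
  obtain Dg' where Dg': "\<forall>x\<in>W. (g' has_derivative blinfun_apply (Dg' x)) (at x)" "continuous_on W Dg'"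
    using *(6) unfolding C1_on_def by blast
  have "submanifold_chart V U W g g' S Dg Dg'"
    by unfold_locales (use * Dg Dg' in simp_all)
  then show ?thesis using *(2) by blast
qed

lemma tangent_approx:
  assumes V: "compact V" "C1_submanifold k V" and e: "0 < e"
  shows "\<exists>r>0. \<forall>y\<in>V. \<forall>\<tau>\<in>tangent_space V y. norm \<tau> \<le> r \<longrightarrow> infdist (y + \<tau>) V \<le> e * norm \<tau>"
proof -
  let ?P = "\<lambda>y r. \<forall>\<tau>\<in>tangent_space V y. norm \<tau> \<le> r \<longrightarrow> infdist (y + \<tau>) V \<le> e * norm \<tau>"
  have mono: "?P y r'" if "?P y r" "r' \<le> r" for y r r'
    using that order_trans by blast
  have loc: "\<exists>r>0. \<forall>\<^sub>F y in nhds p. y \<in> V \<longrightarrow> ?P y r" if p: "p \<in> V" for p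
  proof -
    obtain U W g g' S Dg Dg' where *: "submanifold_chart V U W g g' S Dg Dg'" "p \<in> U"
      using submanifold_chart_exists[OF V(2) p] by blast
    show ?thesis by (rule submanifold_chart.tangent_approx_local[OF * e])
  qed
  show ?thesis
  proof (rule compact_uniform_radius[OF V(1), of ?P])
    show "?P y r'" if "?P y r" "0 < r'" "r' \<le> r" for y r r' by (rule mono[OF that(1,3)])
    show "\<exists>r>0. \<forall>\<^sub>F y in nhds p. y \<in> V \<longrightarrow> ?P y r" if "p \<in> V" for p by (rule loc[OF that])
    show ?thesis if "0 < r" "\<And>y. y \<in> V \<Longrightarrow> ?P y r" for r
      using that by (intro exI[of _ r] conjI ballI) simp_all
  qed
qed

lemma curve_derivative_tangent:
  assumes V: "C1_submanifold k V" and \<gamma>: "\<gamma> 0 \<in> V" "(\<gamma> has_vector_derivative v) (at (0::real))"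
    and ev: "\<forall>\<^sub>F s in at 0. \<gamma> s \<in> V"
  shows "v \<in> tangent_space V (\<gamma> 0)"
proof -
  obtain U W g g' S Dg Dg' where *: "submanifold_chart V U W g g' S Dg Dg'" "\<gamma> 0 \<in> U"
    using submanifold_chart_exists[OF V \<gamma>(1)] by blast
  show ?thesis
    using submanifold_chart.curve_derivative[OF * refl \<gamma>(2) ev \<gamma>(1)]
      submanifold_chart.tangent_space_eq[OF * \<gamma>(1)] by simp
qed

text \<open>The counterpart of \<open>tangent_gap\<close>, with frames in place of charts:
  \<open>v0\<close> has the coefficients of \<open>v\<close>, taken in the frame at
  \<open>p\<close>. These are bounded by \<open>norm v0\<close> through functionals dual to that
  frame.\<close>

lemma frame_gap:
  fixes N :: "'a::euclidean_space \<Rightarrow> 'a set"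
  assumes N: "continuous_subspaces V N" and p: "p \<in> V" and e: "0 < e"
  shows "\<forall>\<^sub>F y in nhds p. y \<in> V \<longrightarrow> (\<forall>v\<in>N y. \<exists>v0\<in>N p. norm (v - v0) \<le> e * norm v0)"
proof -
  obtain U and m :: nat and b where b: "open U" "p \<in> U" "\<And>i. i < m \<Longrightarrow> continuous_on (U \<inter> V) (b i)"
    "\<And>x. x \<in> U \<inter> V \<Longrightarrow> inj_on (\<lambda>i. b i x) {..<m}" 
    "\<And>x. x \<in> U \<inter> V \<Longrightarrow> independent ((\<lambda>i. b i x) ` {..<m})"
    "\<And>x. x \<in> U \<inter> V \<Longrightarrow> span ((\<lambda>i. b i x) ` {..<m}) = N x"
    using N[unfolded continuous_subspaces_def, rule_format, OF p] by blast
  have pUV: "p \<in> U \<inter> V" using b p by simp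
  have "\<exists>l :: 'a \<Rightarrow> real. linear l \<and> (\<forall>j<m. l (b j p) = (if j = i then 1 else 0))" if i: "i < m" for i
  proof -
    obtain l :: "'a \<Rightarrow> real" where l: "linear l"
      "\<forall>x\<in>(\<lambda>i. b i p) ` {..<m}. l x = (if x = b i p then 1 else 0)"
      using linear_independent_extend[OF b(5)[OF pUV], of "\<lambda>x. if x = b i p then 1 else 0"] by blast
    have "l (b j p) = (if j = i then 1 else 0)" if "j < m" for j
      using l(2) that i inj_onD[OF b(4)[OF pUV], of j i] by auto
    then show ?thesis using l(1) by blast
  qed
  then obtain l :: "nat \<Rightarrow> 'a \<Rightarrow> real" where l: "\<And>i. i < m \<Longrightarrow> linear (l i)"
    "\<And>i j. i < m \<Longrightarrow> j < m \<Longrightarrow> l i (b j p) = (if j = i then 1 else 0)"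
    by metis
  define K where "K = (\<Sum>i<m. onorm (l i))"
  have bl: "bounded_linear (l i)" if "i < m" for i using l(1)[OF that] by (simp add: linear_conv_bounded_linear)
  have K: "0 \<le> K" unfolding K_def by (intro sum_nonneg onorm_pos_le bl) simp
  \<comment> \<open>Chosen for \<open>K * \<delta> \<le> e\<close>: each frame vector moves by less
    than \<delta>, and the absolute values of the coefficients sum to at most
    \<open>K * norm v0\<close>.\<close>
  define \<delta> where "\<delta> = e / (K + 1)"
  have \<delta>: "0 < \<delta>" "K * \<delta> \<le> e" using e K by (auto simp: \<delta>_def field_simps)
  have "\<forall>\<^sub>F y in nhds p. y \<in> V \<longrightarrow> dist (b i y) (b i p) < \<delta>" if i: "i < m" for i
  proof -
    obtain d where d: "0 < d" "\<forall>y\<in>U \<inter> V. dist y p < d \<longrightarrow> dist (b i y) (b i p) < \<delta>"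
      using b(3)[OF i, unfolded continuous_on_iff, rule_format, OF pUV \<delta>(1)] by blast
    have "\<forall>\<^sub>F y in nhds p. dist y p < d" using d(1) by (auto simp: eventually_nhds_metric)
    moreover have "\<forall>\<^sub>F y in nhds p. y \<in> U" using b(1,2) by (rule eventually_nhds_in_open)
    ultimately show ?thesis by eventually_elim (use d(2) in blast)
  qed
  then have "\<forall>\<^sub>F y in nhds p. \<forall>i\<in>{..<m}. y \<in> V \<longrightarrow> dist (b i y) (b i p) < \<delta>"
    by (intro eventually_ball_finite) auto
  moreover have "\<forall>\<^sub>F y in nhds p. y \<in> U" using b(1,2) by (rule eventually_nhds_in_open)
  ultimately show ?thesis
  proof eventually_elim
    case (elim y)
    show ?case
    proof (intro impI ballI)
      fix v assume y: "y \<in> V" and v: "v \<in> N y"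
      have yUV: "y \<in> U \<inter> V" using y elim by simp
      have "v \<in> span ((\<lambda>i. b i y) ` {..<m})" using v b(6)[OF yUV] by simp
      then obtain u where "v = (\<Sum>w\<in>(\<lambda>i. b i y) ` {..<m}. u w *\<^sub>R w)"
        by (subst (asm) span_finite) auto
      then have v_eq: "v = (\<Sum>i<m. u (b i y) *\<^sub>R b i y)"
        by (simp add: sum.reindex[OF b(4)[OF yUV]])
      define c where "c i = u (b i y)" for i
      define v0 where "v0 = (\<Sum>i<m. c i *\<^sub>R b i p)"
      have v0: "v0 \<in> N p" unfolding v0_def b(6)[OF pUV, symmetric]
        by (intro span_sum span_scale span_base) auto
      have lv0: "l i v0 = c i" if i: "i < m" for i
      proof -
        have "l i v0 = (\<Sum>j<m. c j *\<^sub>R l i (b j p))"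
          unfolding v0_def by (simp add: linear_sum[OF l(1)[OF i]] linear_cmul[OF l(1)[OF i]])
        also have "\<dots> = (\<Sum>j<m. if j = i then c j else 0)" using l(2)[OF i] by (intro sum.cong) auto
        also have "\<dots> = c i" using i by simp
        finally show ?thesis .
      qed
      have "v - v0 = (\<Sum>i<m. c i *\<^sub>R (b i y - b i p))"
        unfolding v_eq v0_def c_def by (simp add: sum_subtractf scaleR_diff_right)
      then have "norm (v - v0) \<le> (\<Sum>i<m. norm (c i *\<^sub>R (b i y - b i p)))" by (simp only: norm_sum)
      also have "\<dots> \<le> (\<Sum>i<m. (onorm (l i) * norm v0) * \<delta>)"
      proof (intro sum_mono)
        fix i assume "i \<in> {..<m}"
        then have i: "i < m" by simp
        have "\<bar>c i\<bar> \<le> onorm (l i) * norm v0" using onorm[OF bl[OF i], of v0] lv0[OF i] by simp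
        moreover have "norm (b i y - b i p) \<le> \<delta>" using elim(1) i y by (auto simp: dist_norm less_imp_le)
        ultimately show "norm (c i *\<^sub>R (b i y - b i p)) \<le> (onorm (l i) * norm v0) * \<delta>"
          using onorm_pos_le[OF bl[OF i]] unfolding norm_scaleR by (intro mult_mono) auto
      qed
      also have "\<dots> = (K * \<delta>) * norm v0" by (simp add: K_def sum_distrib_right sum_distrib_left mult_ac)
      also have "\<dots> \<le> e * norm v0" by (intro mult_right_mono \<delta>) simp
      finally show "\<exists>v0\<in>N p. norm (v - v0) \<le> e * norm v0" using v0 by blast
    qed
  qed
qed

text \<open>At a single point this is \<open>direct_sum_bounded_below\<close>. The bound survives a
  small rotation of both summands, as measured by \<open>tangent_gap\<close> and
  \<open>frame_gap\<close>, and compactness makes it uniform.\<close>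

lemma normal_angle_bound:
  fixes N :: "'a::euclidean_space \<Rightarrow> 'a set"
  assumes V: "compact V" "C1_submanifold k V"
    and ds: "\<And>y. y \<in> V \<Longrightarrow> direct_sum (tangent_space V y) (N y)" and N: "continuous_subspaces V N"
  shows "\<exists>r>0. \<forall>y\<in>V. \<forall>a\<in>tangent_space V y. \<forall>b\<in>N y. r * norm b \<le> norm (a + b)"
proof -
  let ?P = "\<lambda>y r. \<forall>a\<in>tangent_space V y. \<forall>b\<in>N y. r * norm b \<le> norm (a + b)"
  have mono: "?P y r'" if "?P y r" "r' \<le> r" for y r r'
    using that mult_right_mono[OF that(2) norm_ge_zero] order_trans by blast
  have loc: "\<exists>r>0. \<forall>\<^sub>F y in nhds p. y \<in> V \<longrightarrow> ?P y r" if p: "p \<in> V" for p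
  proof -
    obtain U W g g' S Dg Dg' where *: "submanifold_chart V U W g g' S Dg Dg'" "p \<in> U"
      using submanifold_chart_exists[OF V(2) p] by blast
    obtain \<kappa> where \<kappa>: "0 < \<kappa>" "\<forall>a\<in>tangent_space V p. \<forall>b\<in>N p.
        \<kappa> * norm a \<le> norm (a + b) \<and> \<kappa> * norm b \<le> norm (a + b)"
      using direct_sum_bounded_below[OF ds[OF p]] by blast
    \<comment> \<open>Each error is then at most a quarter of \<open>norm (a0 + b0)\<close>, so that
      \<open>norm (a0 + b0)\<close> is at most \<open>2 * norm (a + b)\<close>; the entry 1 gives
      \<open>norm b \<le> 2 * norm b0\<close>.\<close>
    define e where "e = min (\<kappa> / 4) 1"
    have e: "0 < e" "e \<le> 1" "e \<le> \<kappa> / 4" using \<kappa> by (auto simp: e_def)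
    have "\<forall>\<^sub>F y in nhds p. y \<in> V \<longrightarrow> ?P y (\<kappa> / 8)"
      using submanifold_chart.tangent_gap[OF * p e(1)] frame_gap[OF N p e(1)]
    proof eventually_elim
      case (elim y)
      show ?case
      proof (intro impI ballI)
        fix a b assume y: "y \<in> V" and a: "a \<in> tangent_space V y" and b: "b \<in> N y"
        obtain a0 where a0: "a0 \<in> tangent_space V p" "norm (a - a0) \<le> e * norm a0" using elim(1) y a by blast
        obtain b0 where b0: "b0 \<in> N p" "norm (b - b0) \<le> e * norm b0" using elim(2) y b by blast
        define n where "n = norm (a0 + b0)"
        have n: "\<kappa> * norm a0 \<le> n" "\<kappa> * norm b0 \<le> n" using \<kappa>(2) a0(1) b0(1) by (auto simp: n_def)
        have ea: "e * norm a0 \<le> n / 4" "e * norm b0 \<le> n / 4"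
          using mult_right_mono[OF e(3), of "norm a0"] mult_right_mono[OF e(3), of "norm b0"] n by auto
        have "norm (a0 + b0) \<le> norm (a + b) + norm (a - a0) + norm (b - b0)"
          using norm_triangle_ineq4[of "a + b" "(a - a0) + (b - b0)"] norm_triangle_ineq[of "a - a0" "b - b0"]
          by (simp add: algebra_simps)
        then have "n \<le> 2 * norm (a + b)" using a0(2) b0(2) ea by (simp add: n_def[symmetric])
        moreover have "norm b \<le> norm b0 + norm (b - b0)" by (metis norm_triangle_sub add.commute)
        then have "norm b \<le> 2 * norm b0" using b0(2) mult_right_mono[OF e(2), of "norm b0"] by simp
        then have "\<kappa> * norm b \<le> \<kappa> * (2 * norm b0)" using \<kappa>(1) by (intro mult_left_mono) auto
        ultimately show "\<kappa> / 8 * norm b \<le> norm (a + b)" using n(2) norm_ge_zero[of "a + b"] by linarith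
      qed
    qed
    then show ?thesis using \<kappa> by (intro exI[of _ "\<kappa> / 8"]) auto
  qed
  show ?thesis
  proof (rule compact_uniform_radius[OF V(1), of ?P])
    show "?P y r'" if "?P y r" "0 < r'" "r' \<le> r" for y r r' by (rule mono[OF that(1,3)])
    show "\<exists>r>0. \<forall>\<^sub>F y in nhds p. y \<in> V \<longrightarrow> ?P y r" if "p \<in> V" for p by (rule loc[OF that])
    show ?thesis if "0 < r" "\<And>y. y \<in> V \<Longrightarrow> ?P y r" for r
      using that by (intro exI[of _ r] conjI ballI) simp_all
  qed
qed

section \<open>Quasiperiodic flows\<close>

text \<open>\<open>S\<close> need not be convex, so the mean value inequality is applied to local
  extensions on balls. Pairs at distance at least \<open>r\<close> are treated by the boundedness of
  \<open>g\<close>.\<close>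

lemma C1_map_on_lipschitz:
  fixes g :: "'a::euclidean_space \<Rightarrow> 'b::euclidean_space"
  assumes S: "compact S" and g: "C1_map_on S g" and cont: "continuous_on S g"
  shows "\<exists>B>0. \<forall>x\<in>S. \<forall>y\<in>S. norm (g x - g y) \<le> B * norm (x - y)"
proof -
  \<comment> \<open>\<open>r\<close> is both a radius and the inverse of a Lipschitz constant, so that \<open>?P\<close> is antitone in \<open>r\<close>.\<close>
  let ?P = "\<lambda>y r. \<forall>z\<in>S. dist y z < r \<longrightarrow> norm (g y - g z) \<le> 1 / r * norm (y - z)"
  have mono: "?P y r'" if "?P y r" "0 < r'" "r' \<le> r" for y r r'
  proof (intro ballI impI)
    fix z assume "z \<in> S" "dist y z < r'"
    then have "norm (g y - g z) \<le> 1 / r * norm (y - z)" using that by simp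
    also have "\<dots> \<le> 1 / r' * norm (y - z)" using that by (intro mult_right_mono divide_left_mono) auto
    finally show "norm (g y - g z) \<le> 1 / r' * norm (y - z)" .
  qed
  have loc: "\<exists>r>0. \<forall>\<^sub>F y in nhds p. y \<in> S \<longrightarrow> ?P y r" if p: "p \<in> S" for p
  proof -
    obtain U G where U: "open U" "p \<in> U" "C1_on U G" "\<forall>x\<in>U \<inter> S. G x = g x"
      using g[unfolded C1_map_on_def, rule_format, OF p] by blast
    obtain G' where G': "\<forall>x\<in>U. (G has_derivative blinfun_apply (G' x)) (at x)" "continuous_on U G'"
      using U(3) unfolding C1_on_def by blast
    obtain r1 where r1: "0 < r1" "ball p r1 \<subseteq> U" using U open_contains_ball by blast
    obtain r2 where r2: "0 < r2" "\<forall>x\<in>U. dist x p < r2 \<longrightarrow> dist (G' x) (G' p) < 1"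
      using G'(2)[unfolded continuous_on_iff, rule_format, OF U(2), of 1] by auto
    define \<rho> where "\<rho> = min r1 r2"
    define M where "M = norm (G' p) + 1"
    have \<rho>: "0 < \<rho>" "ball p \<rho> \<subseteq> U" using r1 r2 by (auto simp: \<rho>_def)
    have M: "0 < M" by (simp add: M_def add_nonneg_pos)
    have G'M: "norm (G' x) \<le> M" if "x \<in> ball p \<rho>" for x
    proof -
      have "x \<in> U" "dist x p < r2" using that \<rho>(2) by (auto simp: \<rho>_def dist_commute)
      then have "dist (G' x) (G' p) < 1" using r2(2) by blast
      then show ?thesis using norm_triangle_sub[of "G' x" "G' p"] by (simp add: M_def dist_norm)
    qed
    have lip: "norm (G y - G z) \<le> M * norm (y - z)" if yz: "y \<in> ball p \<rho>" "z \<in> ball p \<rho>" for y z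
    proof (rule differentiable_bound[OF convex_ball _ _ yz])
      show "(G has_derivative blinfun_apply (G' x)) (at x within ball p \<rho>)" if "x \<in> ball p \<rho>" for x
        using G'(1) \<rho>(2) that by (blast intro: has_derivative_at_withinI)
      show "onorm (blinfun_apply (G' x)) \<le> M" if "x \<in> ball p \<rho>" for x
        using G'M[OF that] by (simp add: norm_blinfun.rep_eq)
    qed
    define r where "r = min (\<rho> / 2) (1 / M)"
    have r: "0 < r" "r \<le> \<rho> / 2" "r \<le> 1 / M" using \<rho> M by (auto simp: r_def)
    have "M \<le> 1 / r" using r M by (simp add: field_simps)
    have "\<forall>\<^sub>F y in nhds p. y \<in> ball p (\<rho> / 2)"
      by (intro eventually_nhds_in_open) (use \<rho> in auto)
    then have "\<forall>\<^sub>F y in nhds p. y \<in> S \<longrightarrow> ?P y r"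
    proof eventually_elim
      case (elim y)
      show ?case
      proof (intro impI ballI)
        fix z assume y: "y \<in> S" and z: "z \<in> S" "dist y z < r"
        have b: "y \<in> ball p \<rho>" "z \<in> ball p \<rho>"
          using elim z(2) r(2) \<rho>(1) dist_triangle[of p z y] by auto
        have "g y = G y" "g z = G z" using U(4) b \<rho>(2) y z by auto
        then have "norm (g y - g z) \<le> M * norm (y - z)" using lip[OF b] by simp
        also have "\<dots> \<le> 1 / r * norm (y - z)" using \<open>M \<le> 1 / r\<close> by (rule mult_right_mono) simp
        finally show "norm (g y - g z) \<le> 1 / r * norm (y - z)" .
      qed
    qed
    then show ?thesis using r(1) by blast
  qed
  have "\<exists>r>0. \<forall>y\<in>S. ?P y r"
  proof (rule compact_uniform_radius[OF S, of ?P])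
    show "?P y r'" if "?P y r" "0 < r'" "r' \<le> r" for y r r' by (rule mono[OF that])
    show "\<exists>r>0. \<forall>\<^sub>F y in nhds p. y \<in> S \<longrightarrow> ?P y r" if "p \<in> S" for p by (rule loc[OF that])
    show "\<exists>r>0. \<forall>y\<in>S. ?P y r" if "0 < r" "\<And>y. y \<in> S \<Longrightarrow> ?P y r" for r
      using that by (intro exI[of _ r] conjI ballI) simp_all
  qed
  then obtain r where r: "0 < r" "\<forall>y\<in>S. ?P y r" by blast
  obtain B where B: "\<forall>y\<in>S. norm (g y) \<le> B"
    using compact_imp_bounded[OF compact_continuous_image[OF cont S]] unfolding bounded_iff by blast
  define C where "C = max (1 / r) (2 * B / r)"
  have "norm (g x - g y) \<le> C * norm (x - y)" if x: "x \<in> S" and y: "y \<in> S" for x y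
  proof (cases "dist x y < r")
    case True
    then have "norm (g x - g y) \<le> 1 / r * norm (x - y)" using r(2) x y by blast
    also have "\<dots> \<le> C * norm (x - y)" by (intro mult_right_mono) (auto simp: C_def)
    finally show ?thesis .
  next
    case False
    have B0: "0 \<le> B" using B x norm_ge_zero order_trans by blast
    have "norm (g x - g y) \<le> 2 * B" using B[rule_format, OF x] B[rule_format, OF y] norm_triangle_ineq4[of "g x" "g y"] by linarith
    also have "\<dots> = 2 * B / r * r" using r by simp
    also have "\<dots> \<le> 2 * B / r * norm (x - y)"
      using False r B0 by (intro mult_left_mono) (auto simp: dist_norm)
    also have "\<dots> \<le> C * norm (x - y)" by (intro mult_right_mono) (auto simp: C_def)
    finally show ?thesis .
  qed
  moreover have "0 < C" using r(1) by (simp add: C_def less_max_iff_disj)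
  ultimately show ?thesis by blast
qed

lemma quasiperiodic_flow_add:
  "quasiperiodic_flow \<omega> (s + t) z = quasiperiodic_flow \<omega> s (quasiperiodic_flow \<omega> t z)"
  by (simp add: quasiperiodic_flow_def vec_eq_iff cis_mult distrib_left mult.assoc[symmetric])

lemma quasiperiodic_flow_isometry:
  "norm (quasiperiodic_flow \<omega> t z - quasiperiodic_flow \<omega> t w) = norm (z - w)"
  by (simp add: quasiperiodic_flow_def norm_vec_def norm_mult flip: right_diff_distrib)

lemma quasiperiodic_flow_torus: "z \<in> torus \<Longrightarrow> quasiperiodic_flow \<omega> t z \<in> torus"
  by (simp add: quasiperiodic_flow_def torus_def norm_mult)

text \<open>\<open>flow f t\<close> is unspecified for negative \<open>t\<close>. Conjugating the
  rotations, which form a group, extends it on \<open>V\<close> to all real times. As they are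
  isometries, the product of the Lipschitz constants of \<open>k\<close> and \<open>h\<close> serves
  as \<open>K\<close> at every time.\<close>

lemma quasiperiodic_extension:
  assumes V: "compact V" and conj: "conjugate_to_quasiperiodic f V \<omega>"
    and inv: "\<forall>p\<in>V. \<forall>t\<ge>0. flow f t p \<in> V"
  shows "\<exists>\<Phi> K. 0 < K \<and> (\<forall>t. \<forall>p\<in>V. \<Phi> t p \<in> V) \<and> (\<forall>s t. \<forall>p\<in>V. \<Phi> (s + t) p = \<Phi> s (\<Phi> t p)) \<and>
    (\<forall>p\<in>V. \<Phi> 0 p = p) \<and> (\<forall>p\<in>V. \<forall>t\<ge>0. flow f t p = \<Phi> t p) \<and>
    (\<forall>t. \<forall>p\<in>V. \<forall>q\<in>V. norm (\<Phi> t p - \<Phi> t q) \<le> K * norm (p - q))"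
proof -
  obtain h k where hom: "homeomorphism V torus h k" and C1: "C1_map_on V h" "C1_map_on torus k"
    and hf: "\<forall>x\<in>V. \<forall>t\<ge>0. h (flow f t x) = quasiperiodic_flow \<omega> t (h x)"
    using conj unfolding conjugate_to_quasiperiodic_def by blast
  have hk: "\<And>x. x \<in> V \<Longrightarrow> k (h x) = x" "\<And>z. z \<in> torus \<Longrightarrow> h (k z) = z"
    "\<And>x. x \<in> V \<Longrightarrow> h x \<in> torus" "\<And>z. z \<in> torus \<Longrightarrow> k z \<in> V"
    "continuous_on V h" "continuous_on torus k" "h ` V = torus"
    using hom by (auto simp: homeomorphism_def)
  have tor: "compact (torus :: (complex ^ 'b) set)"
    using compact_continuous_image[OF hk(5) V] hk(7) by simp
  obtain B1 where B1: "0 < B1" "\<forall>x\<in>V. \<forall>y\<in>V. norm (h x - h y) \<le> B1 * norm (x - y)"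
    using C1_map_on_lipschitz[OF V C1(1) hk(5)] by blast
  obtain B2 where B2: "0 < B2" "\<forall>x\<in>torus. \<forall>y\<in>torus. norm (k x - k y) \<le> B2 * norm (x - y)"
    using C1_map_on_lipschitz[OF tor C1(2) hk(6)] by blast
  define \<Phi> where "\<Phi> t p = k (quasiperiodic_flow \<omega> t (h p))" for t p
  show ?thesis
  proof (intro exI[of _ \<Phi>] exI[of _ "B2 * B1"] conjI allI ballI impI)
    show "0 < B2 * B1" using B1 B2 by simp
    show "\<Phi> t p \<in> V" if "p \<in> V" for t p
      unfolding \<Phi>_def using that by (intro hk quasiperiodic_flow_torus)
    show "\<Phi> (s + t) p = \<Phi> s (\<Phi> t p)" if "p \<in> V" for s t p
      using hk(2)[OF quasiperiodic_flow_torus[OF hk(3)[OF that]]] by (simp add: \<Phi>_def quasiperiodic_flow_add)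
    show "\<Phi> 0 p = p" if "p \<in> V" for p
      using hk(1)[OF that] by (simp add: \<Phi>_def quasiperiodic_flow_def)
    show "flow f t p = \<Phi> t p" if "p \<in> V" "0 \<le> t" for p t
      using hf that hk(1)[OF inv[rule_format, OF that]] by (simp add: \<Phi>_def)
    show "norm (\<Phi> t p - \<Phi> t q) \<le> B2 * B1 * norm (p - q)" if "p \<in> V" "q \<in> V" for t p q
    proof -
      have "norm (\<Phi> t p - \<Phi> t q) \<le> B2 * norm (h p - h q)"
        using B2(2) hk(3) that quasiperiodic_flow_torus quasiperiodic_flow_isometry[of \<omega> t "h p" "h q"]
        unfolding \<Phi>_def by metis
      also have "\<dots> \<le> B2 * (B1 * norm (p - q))" using B1 B2 that by (intro mult_left_mono) auto
      finally show ?thesis by simp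
    qed
  qed
qed

section \<open>Trajectories attracted by a normally contracting submanifold\<close>

lemma half_power_cauchy_limit:
  fixes q :: "nat \<Rightarrow> 'a::banach"
  assumes step: "\<And>n. norm (q (Suc n) - q n) \<le> C * (1/2) ^ n"
  shows "\<exists>l. q \<longlonglongrightarrow> l \<and> (\<forall>n. norm (q n - l) \<le> 2 * C * (1/2) ^ n)"
proof -
  have C: "0 \<le> C" using order_trans[OF norm_ge_zero step[of 0]] by simp
  \<comment> \<open>The factor \<open>1 - (1/2) ^ m\<close> is that of the exact geometric sum,
    which lets the induction close.\<close>
  have dist: "norm (q (n + m) - q n) \<le> 2 * C * (1/2) ^ n * (1 - (1/2) ^ m)" for n m
  proof (induction m)
    case (Suc m)
    have "norm (q (n + Suc m) - q n) \<le> norm (q (Suc (n + m)) - q (n + m)) + norm (q (n + m) - q n)"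
      using norm_triangle_ineq[of "q (Suc (n + m)) - q (n + m)" "q (n + m) - q n"] by simp
    also have "\<dots> \<le> C * (1/2) ^ (n + m) + 2 * C * (1/2) ^ n * (1 - (1/2) ^ m)"
      by (intro add_mono step Suc.IH)
    also have "\<dots> = 2 * C * (1/2) ^ n * (1 - (1/2) ^ Suc m)" by (simp add: power_add algebra_simps)
    finally show ?case .
  qed simp
  have le: "norm (q m - q n) \<le> 2 * C * (1/2) ^ n" if "n \<le> m" for m n
  proof -
    have "norm (q (n + (m - n)) - q n) \<le> 2 * C * (1/2) ^ n * (1 - (1/2) ^ (m - n))" by (rule dist)
    also have "\<dots> \<le> 2 * C * (1/2) ^ n * 1" using C by (intro mult_left_mono) auto
    finally show ?thesis using that by simp
  qed
  have lim0: "(\<lambda>n. 2 * C * (1/2) ^ n) \<longlonglongrightarrow> 0"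
    using tendsto_mult_left[OF LIMSEQ_power_zero[of "1/2::real"], of "2 * C"] by simp
  have "Cauchy q"
  proof (rule CauchyI)
    fix e :: real assume "0 < e"
    with lim0 obtain M where M: "\<And>n. n \<ge> M \<Longrightarrow> 2 * C * (1/2) ^ n < e"
      using order_tendstoD(2)[OF lim0 \<open>0 < e\<close>] unfolding eventually_sequentially by blast
    have "norm (q m - q n) < e" if "m \<ge> M" "n \<ge> M" for m n
    proof (cases "n \<le> m")
      case True
      then show ?thesis using le[OF True] M[OF that(2)] by linarith
    next
      case False
      then show ?thesis using le[of m n] M[OF that(1)] by (simp add: norm_minus_commute)
    qed
    then show "\<exists>M. \<forall>m\<ge>M. \<forall>n\<ge>M. norm (q m - q n) < e" by blast
  qed
  then obtain l where l: "q \<longlonglongrightarrow> l" unfolding Cauchy_convergent_iff convergent_def by blast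
  have "norm (q n - l) \<le> 2 * C * (1/2) ^ n" for n
  proof (rule LIMSEQ_le_const2)
    show "(\<lambda>m. norm (q m - q n)) \<longlonglongrightarrow> norm (q n - l)"
      using tendsto_norm[OF tendsto_diff[OF l tendsto_const[of "q n"]]] by (simp add: norm_minus_commute)
    show "\<exists>M. \<forall>m\<ge>M. norm (q m - q n) \<le> 2 * C * (1/2) ^ n" using le by blast
  qed
  with l show ?thesis by blast
qed

text \<open>\<Phi> is the flow on \<open>V\<close> as a group in real time, with \<open>K\<close>
  uniform in time. \<open>V\<close> lies in the ball of radius \<open>R - 1\<close>, so
  \<open>exists_near\<close> applies along every orbit in \<open>V\<close>.\<close>

locale attractor = C1_field f f' R L
  for f :: "'a::euclidean_space \<Rightarrow> 'a" and f' R L +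
  fixes V :: "'a set" and k :: nat and \<Phi> :: "real \<Rightarrow> 'a \<Rightarrow> 'a" and K :: real
    and N :: "'a \<Rightarrow> 'a set" and c \<mu> :: real
  assumes V: "compact V" "C1_submanifold k V" "V \<noteq> {}" "\<And>p. p \<in> V \<Longrightarrow> norm p \<le> R - 1"
    and K: "0 < K" and \<Phi>_V: "\<And>t p. p \<in> V \<Longrightarrow> \<Phi> t p \<in> V"
    and \<Phi>_add: "\<And>s t p. p \<in> V \<Longrightarrow> \<Phi> (s + t) p = \<Phi> s (\<Phi> t p)" and \<Phi>_0: "\<And>p. p \<in> V \<Longrightarrow> \<Phi> 0 p = p"
    and \<Phi>_lip: "\<And>t p q. p \<in> V \<Longrightarrow> q \<in> V \<Longrightarrow> norm (\<Phi> t p - \<Phi> t q) \<le> K * norm (p - q)"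
    and orbit: "\<And>p. p \<in> V \<Longrightarrow> ode_solution (\<lambda>_. f) {0..} (\<lambda>t. \<Phi> t p)"
    and ds: "\<And>p. p \<in> V \<Longrightarrow> direct_sum (tangent_space V p) (N p)"
    and N: "continuous_subspaces V N" and c: "0 < c" and \<mu>: "0 < \<mu>"
    and contraction: "\<And>p t. p \<in> V \<Longrightarrow> 0 \<le> t \<Longrightarrow> onorm_on (N p)
        (proj_along (tangent_space V (\<Phi> t p)) (N (\<Phi> t p)) \<circ> frechet_derivative (flow f t) (at p))
        \<le> c * exp (- \<mu> * t)"
begin

section \<open>The derivative of the flow at points of \<open>V\<close>\<close>

definition D :: "real \<Rightarrow> 'a \<Rightarrow> 'a \<Rightarrow> 'a" where
  "D t p = frechet_derivative (flow f t) (at p)"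

lemma orbit_on: "p \<in> V \<Longrightarrow> ode_solution (\<lambda>_. f) {0..T} (\<lambda>t. \<Phi> t p)"
  by (rule ode_solution_subset[OF orbit]) auto

lemma orbit_norm: "p \<in> V \<Longrightarrow> norm (\<Phi> t p) \<le> R - 1"
  by (intro V(4) \<Phi>_V)

lemma flow_orbit: "p \<in> V \<Longrightarrow> 0 \<le> t \<Longrightarrow> flow f t p = \<Phi> t p"
  using flow_eq[OF orbit_on, of p t] by (simp add: \<Phi>_0)

lemma flow_0: "flow f 0 y = y"
proof -
  have "ode_solution (\<lambda>_. f) {0..0} (\<lambda>_. y)"
    by (simp add: ode_solution_def has_vector_derivative_def has_derivative_within_singleton_iff
        bounded_linear_scaleR_left)
  from flow_eq[OF this] show ?thesis by simp
qed

lemma D_has_derivative: "p \<in> V \<Longrightarrow> 0 \<le> t \<Longrightarrow> (flow f t has_derivative D t p) (at p)"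
  unfolding D_def using linearization(1)[OF orbit_on orbit_norm, of p t] by (simp add: \<Phi>_0)

lemma D_linear: "p \<in> V \<Longrightarrow> 0 \<le> t \<Longrightarrow> linear (D t p)"
  by (rule has_derivative_linear[OF D_has_derivative])

lemma D_estimate:
  assumes "p \<in> V" "0 \<le> T"
    and "ode_solution (\<lambda>_. f) {0..T} u" "ode_solution (\<lambda>_. f) {0..T} v"
    and "\<And>t. t \<in> {0..T} \<Longrightarrow> norm (u t) \<le> R" "\<And>t. t \<in> {0..T} \<Longrightarrow> norm (v t) \<le> R"
    and "\<And>t \<xi>. t \<in> {0..T} \<Longrightarrow> \<xi> \<in> closed_segment (u t) (v t) \<Longrightarrow> norm (f' \<xi> - f' (\<Phi> t p)) \<le> \<eta>"
  shows "norm (u T - v T - D T p (u 0 - v 0)) \<le> \<eta> * T * exp (2 * L * T) * norm (u 0 - v 0)"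
  using linearization(2)[OF orbit_on[OF assms(1)] orbit_norm[OF assms(1)] assms(2-7)] assms(1)
  by (simp add: D_def \<Phi>_0)

text \<open>Off \<open>V\<close> solutions may blow up; for fixed \<open>t\<close>, starting points
  within \<open>exp (- L * t)\<close> of \<open>p\<close> are close enough for
  \<open>exists_near\<close>.\<close>

lemma flow_near:
  assumes p: "p \<in> V" and t: "0 \<le> t"
  shows "\<forall>\<^sub>F y in nhds p. \<exists>u. ode_solution (\<lambda>_. f) {0..t} u \<and> u 0 = y \<and> (\<forall>s\<in>{0..t}. norm (u s) \<le> R)
    \<and> norm (u t - \<Phi> t p) \<le> exp (L * t) * norm (y - p)"
proof -
  have "\<forall>\<^sub>F y in nhds p. y \<in> ball p (exp (- L * t))"
    by (intro eventually_nhds_in_open) auto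
  then show ?thesis
  proof eventually_elim
    case (elim y)
    then have "norm (y - p) \<le> exp (- L * t)" by (simp add: dist_norm norm_minus_commute)
    then have "exp (L * t) * norm (y - p) \<le> exp (L * t) * exp (- L * t)" by (intro mult_left_mono) auto
    also have "\<dots> = 1" by (simp flip: exp_add)
    finally have le: "exp (L * (t - 0)) * norm (y - \<Phi> 0 p) \<le> 1" using p by (simp add: \<Phi>_0)
    show ?case
    proof (rule exists_near[OF orbit_on[OF p] orbit_norm[OF p] t le])
      fix u assume u: "ode_solution (\<lambda>_. f) {0..t} u" "u 0 = y" "\<And>s. s \<in> {0..t} \<Longrightarrow> norm (u s) \<le> R"
        "\<And>s. s \<in> {0..t} \<Longrightarrow> norm (u s - \<Phi> s p) \<le> exp (L * (s - 0)) * norm (y - \<Phi> 0 p)"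
      then show ?thesis using u(4)[of t] t p by (intro exI[of _ u]) (simp add: \<Phi>_0)
    qed
  qed
qed

text \<open>A crude bound that grows with \<open>t\<close>, used only over a single period. It
  follows from \<open>flow_near\<close> along the line through \<open>p\<close> in direction
  \<open>v\<close>.\<close>

lemma D_norm_le:
  assumes p: "p \<in> V" and t: "0 \<le> t"
  shows "norm (D t p v) \<le> exp (L * t) * norm v"
proof (rule vector_derivative_norm_le)
  have "((\<lambda>s. p + s *\<^sub>R v) has_derivative (\<lambda>h. h *\<^sub>R v)) (at 0)"
    by (auto intro!: derivative_eq_intros)
  then show d: "((\<lambda>s. p + s *\<^sub>R v) has_vector_derivative v) (at 0)"
    by (simp add: has_vector_derivative_def)
  have "(flow f t has_derivative D t p) (at (p + 0 *\<^sub>R v))" using D_has_derivative[OF p t] by simp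
  from diff_chain_at[OF d[unfolded has_vector_derivative_def] this]
  show "((\<lambda>s. flow f t (p + s *\<^sub>R v)) has_vector_derivative D t p v) (at 0)"
    by (simp add: has_vector_derivative_def o_def linear_cmul[OF D_linear[OF p t]])
  have "((\<lambda>s. p + s *\<^sub>R v) \<longlongrightarrow> p + 0 *\<^sub>R v) (at 0)" by (intro tendsto_intros)
  then have "filterlim (\<lambda>s. p + s *\<^sub>R v) (nhds p) (at 0)" by simp
  from eventually_compose_filterlim[OF flow_near[OF p t] this]
  show "\<forall>\<^sub>F s in at 0. norm (flow f t (p + s *\<^sub>R v) - flow f t (p + 0 *\<^sub>R v))
      \<le> exp (L * t) * norm (p + s *\<^sub>R v - (p + 0 *\<^sub>R v))"
  proof eventually_elim
    case (elim s)
    then show ?case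
    proof (elim exE conjE)
      fix u assume u: "ode_solution (\<lambda>_. f) {0..t} u" "u 0 = p + s *\<^sub>R v"
        "norm (u t - \<Phi> t p) \<le> exp (L * t) * norm (p + s *\<^sub>R v - p)"
      have "flow f t (p + s *\<^sub>R v) = u t" using flow_eq[OF u(1) t] unfolding u(2) .
      moreover have "flow f t (p + 0 *\<^sub>R v) = \<Phi> t p" using flow_orbit[OF p t] by simp
      ultimately show ?thesis using u(3) by simp
    qed
  qed
qed

text \<open>The semigroup law is available only where solutions exist; a neighbourhood of
  \<open>p\<close> is enough to differentiate it by the chain rule.\<close>

lemma flow_add_near:
  assumes p: "p \<in> V" and s: "0 \<le> s" and t: "0 \<le> t"
  shows "\<forall>\<^sub>F y in nhds p. flow f (s + t) y = flow f s (flow f t y)"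
proof -
  have "0 \<le> s + t" using s t by simp
  from flow_near[OF p this] show ?thesis
  proof eventually_elim
    case (elim y)
    then obtain u where u: "ode_solution (\<lambda>_. f) {0..s + t} u" "u 0 = y" by (elim exE conjE)
    have "ode_solution (\<lambda>_. f) {0..t} u" using s by (intro ode_solution_subset[OF u(1)]) auto
    from flow_eq[OF this t] have 1: "flow f t y = u t" unfolding u(2) .
    have "ode_solution (\<lambda>_. f) {0 - t..s + t - t} (\<lambda>r. u (r + t))" using ode_solution_shift[OF u(1)] .
    then have "ode_solution (\<lambda>_. f) {0..s} (\<lambda>r. u (r + t))"
      by (rule ode_solution_subset) (use t in simp)
    from flow_eq[OF this s] have 2: "flow f s (u t) = u (s + t)" by simp
    have "flow f (s + t) (u 0) = u (s + t)" using s t by (intro flow_eq[OF u(1)]) simp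
    then have "flow f (s + t) y = u (s + t)" unfolding u(2) .
    then show ?case using 1 2 by simp
  qed
qed

lemma D_add:
  assumes p: "p \<in> V" and s: "0 \<le> s" and t: "0 \<le> t"
  shows "D (s + t) p v = D s (\<Phi> t p) (D t p v)"
proof -
  have "(flow f s has_derivative D s (\<Phi> t p)) (at (flow f t p))"
    using D_has_derivative[OF \<Phi>_V[OF p] s] flow_orbit[OF p t] by simp
  from diff_chain_at[OF D_has_derivative[OF p t] this]
  have 1: "((\<lambda>y. flow f s (flow f t y)) has_derivative D s (\<Phi> t p) \<circ> D t p) (at p)" by (simp add: o_def)
  obtain U where U: "open U" "p \<in> U" "\<forall>y\<in>U. flow f (s + t) y = flow f s (flow f t y)"
    using flow_add_near[OF assms] unfolding eventually_nhds by blast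
  have "(flow f (s + t) has_derivative D s (\<Phi> t p) \<circ> D t p) (at p)"
    by (rule has_derivative_transform_within_open[OF 1 U(1,2)]) (use U(3) in simp)
  moreover have "(flow f (s + t) has_derivative D (s + t) p) (at p)" using s t by (intro D_has_derivative p) simp
  ultimately have "D (s + t) p = D s (\<Phi> t p) \<circ> D t p" by (rule has_derivative_unique[symmetric])
  then show ?thesis by simp
qed

lemma D_0: "p \<in> V \<Longrightarrow> D 0 p v = v"
proof -
  assume p: "p \<in> V"
  have "flow f 0 = (\<lambda>y. y)" using flow_0 by auto
  then have "((\<lambda>y. y) has_derivative D 0 p) (at p)" using D_has_derivative[OF p order_refl] by simp
  from has_derivative_unique[OF this has_derivative_ident] have "D 0 p = (\<lambda>y. y)" .
  then show ?thesis by simp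
qed

lemma D_tangent:
  assumes p: "p \<in> V" and t: "0 \<le> t" and a: "a \<in> tangent_space V p"
  shows "D t p a \<in> tangent_space V (\<Phi> t p)" and "norm (D t p a) \<le> K * norm a"
proof -
  obtain \<gamma> e where \<gamma>: "e > 0" "\<gamma> ` {-e<..<e} \<subseteq> V" "\<gamma> 0 = p" "(\<gamma> has_vector_derivative a) (at (0::real))"
    using a unfolding tangent_space_def by blast
  have "\<forall>\<^sub>F s in at 0. s \<in> {-e<..<e}"
    using \<gamma>(1) by (intro eventually_at_in_open') auto
  then have ev: "\<forall>\<^sub>F s in at 0. \<gamma> s \<in> V" by eventually_elim (use \<gamma> in auto)
  define \<delta> where "\<delta> s = flow f t (\<gamma> s)" for s
  have \<delta>0: "\<delta> 0 = \<Phi> t p" using flow_orbit[OF p t] \<gamma>(3) by (simp add: \<delta>_def)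
  have "(flow f t has_derivative D t p) (at (\<gamma> 0))" using D_has_derivative[OF p t] \<gamma>(3) by simp
  from diff_chain_at[OF \<gamma>(4)[unfolded has_vector_derivative_def] this]
  have d: "(\<delta> has_vector_derivative D t p a) (at 0)"
    by (simp add: has_vector_derivative_def o_def \<delta>_def[abs_def] linear_cmul[OF D_linear[OF p t]])
  have "\<forall>\<^sub>F s in at 0. \<delta> s \<in> V" using ev by eventually_elim (simp add: \<delta>_def flow_orbit t \<Phi>_V)
  from curve_derivative_tangent[OF V(2) _ d this] show "D t p a \<in> tangent_space V (\<Phi> t p)"
    using \<Phi>_V[OF p] by (simp add: \<delta>0)
  show "norm (D t p a) \<le> K * norm a"
  proof (rule vector_derivative_norm_le[OF \<gamma>(4) d])
    show "\<forall>\<^sub>F s in at 0. norm (\<delta> s - \<delta> 0) \<le> K * norm (\<gamma> s - \<gamma> 0)"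
      using ev
    proof eventually_elim
      case (elim s)
      then show ?case using \<Phi>_lip[OF elim p, of t] by (simp add: \<delta>0 \<gamma>(3)) (simp add: \<delta>_def flow_orbit t)
    qed
  qed
qed

lemma D_normal:
  assumes p: "p \<in> V" and t: "0 \<le> t" and b: "b \<in> N p"
    and eq: "D t p b = a' + b'" "a' \<in> tangent_space V (\<Phi> t p)" "b' \<in> N (\<Phi> t p)"
  shows "norm b' \<le> c * exp (- \<mu> * t) * norm b"
proof (rule onorm_on_proj_bound[where A = "D t p", OF ds[OF \<Phi>_V[OF p, of t]] _ _ _ b eq])
  show "subspace (N p)" using direct_sumD(2)[OF ds[OF p]] .
  show "bounded_linear (D t p)" using D_has_derivative[OF p t] by (rule has_derivative_bounded_linear)
  show "onorm_on (N p) (proj_along (tangent_space V (\<Phi> t p)) (N (\<Phi> t p)) \<circ> D t p) \<le> c * exp (- \<mu> * t)"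
    unfolding D_def by (rule contraction[OF p t])
qed

text \<open>The cocycle split at the last period or at the first: the former generates recursions
  along an orbit, the latter absorbs one step into a transport
  \<open>D (real m * T)\<close>.\<close>

lemma D_Suc:
  assumes "p \<in> V" "0 \<le> T"
  shows "D (real (Suc n) * T) p v = D T (\<Phi> (real n * T) p) (D (real n * T) p v)"
    and "D (real (Suc n) * T) p v = D (real n * T) (\<Phi> T p) (D T p v)"
  using D_add[of p T "real n * T" v] D_add[of p "real n * T" T v] assms
  by (simp_all add: distrib_right add.commute)

lemma \<Phi>_Suc: "p \<in> V \<Longrightarrow> \<Phi> T (\<Phi> (real n * T) p) = \<Phi> (real (Suc n) * T) p"
  using \<Phi>_add[of p T "real n * T"] by (simp add: distrib_right)

text \<open>The normal components of the images of a normal vector decay geometrically. Their tangential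
  errors \<open>d n\<close> therefore form a geometric series, and each of them is transported boundedly.\<close>

lemma normal_bounded:
  assumes T: "0 < T"
  shows "\<exists>M>0. \<forall>p\<in>V. \<forall>b\<in>N p. \<forall>n::nat. norm (D (real n * T) p b) \<le> M * norm b"
proof -
  define \<rho> where "\<rho> = exp (- \<mu> * T)"
  have \<rho>: "0 < \<rho>" "\<rho> < 1" using T \<mu> by (auto simp: \<rho>_def)
  \<comment> \<open>\<open>d n\<close> will be a difference of two normal parts, one pushed forward
    over a period (factor \<open>exp (L * T)\<close>), the other taken as it is (factor 1).\<close>
  define E where "E = exp (L * T) + 1"
  have E: "0 < E" by (simp add: E_def add_pos_pos)
  \<comment> \<open>The first summand is for the tangential part, \<open>K\<close> times the
    geometric series of the errors; \<open>c\<close> is for the normal part.\<close>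
  define M where "M = K * (E * c / (1 - \<rho>)) + c"
  have "0 < M" using K E c \<rho> by (simp add: M_def add_pos_pos)
  moreover have "norm (D (real n * T) p b) \<le> M * norm b" if p: "p \<in> V" and b: "b \<in> N p" for p b n
  proof -
    define q where "q n = \<Phi> (real n * T) p" for n
    have q: "q n \<in> V" for n using \<Phi>_V[OF p] by (simp add: q_def)
    have qS: "\<Phi> T (q n) = q (Suc n)" for n using \<Phi>_Suc[OF p] by (simp add: q_def)
    have "\<forall>n. \<exists>a b'. a \<in> tangent_space V (q n) \<and> b' \<in> N (q n) \<and> D (real n * T) p b = a + b'"
      using direct_sumD(4)[OF ds[OF q]] by blast
    then obtain al be where ab: "\<And>n. al n \<in> tangent_space V (q n)" "\<And>n. be n \<in> N (q n)"
      "\<And>n. D (real n * T) p b = al n + be n" by metis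
    have be: "norm (be n) \<le> c * \<rho> ^ n * norm b" for n
    proof -
      have "norm (be n) \<le> c * exp (- \<mu> * (real n * T)) * norm b"
        using T by (intro D_normal[OF p _ b ab(3)] ab[unfolded q_def]) simp
      also have "exp (- \<mu> * (real n * T)) = \<rho> ^ n"
        by (simp add: \<rho>_def mult.left_commute flip: exp_of_nat_mult)
      finally show ?thesis .
    qed
    have q0: "q 0 = p" by (simp add: q_def \<Phi>_0 p)
    have "b = al 0 + be 0" using ab(3)[of 0] D_0[OF p] by simp
    moreover have "0 \<in> tangent_space V p" using subspace_0[OF direct_sumD(1)[OF ds[OF p]]] .
    \<comment> \<open>By uniqueness of the decomposition there is no tangential part at time 0, so
      the sum over the errors starts from zero.\<close>
    ultimately have "be 0 = b"
      using proj_along_eq[OF ds[OF p] _ b, of 0] proj_along_eq[OF ds[OF p], of "al 0" "be 0"] ab(1,2)[of 0] q0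
      by simp
    with \<open>b = al 0 + be 0\<close> have al0: "al 0 = 0" by simp
    define d where "d n = al (Suc n) - D T (q n) (al n)" for n
    \<comment> \<open>The tangential error is expressed by normal components alone, so it inherits
      their geometric decay.\<close>
    have d_eq: "d n = D T (q n) (be n) - be (Suc n)" for n
    proof -
      have "al (Suc n) + be (Suc n) = D T (q n) (al n) + D T (q n) (be n)"
        using D_Suc(1)[OF p, of T n b] T ab(3)[of "Suc n"] ab(3)[of n] linear_add[OF D_linear[OF q]]
        by (simp add: q_def)
      then show ?thesis by (simp add: d_def algebra_simps)
    qed
    have dT: "d n \<in> tangent_space V (q (Suc n))" for n
      unfolding d_def using D_tangent(1)[OF q _ ab(1), of T] T qS
      by (intro subspace_diff[OF direct_sumD(1)[OF ds[OF q]]] ab(1)) auto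
    have d_le: "norm (d n) \<le> E * c * \<rho> ^ n * norm b" for n
    proof -
      have "norm (d n) \<le> exp (L * T) * norm (be n) + norm (be (Suc n))"
        unfolding d_eq using D_norm_le[OF q, of T n "be n"] T norm_triangle_ineq4[of "D T (q n) (be n)" "be (Suc n)"]
        by simp
      also have "\<dots> \<le> exp (L * T) * (c * \<rho> ^ n * norm b) + c * \<rho> ^ n * norm b"
      proof (intro add_mono mult_left_mono be order_trans[OF be[of "Suc n"]] mult_right_mono)
        show "\<rho> ^ Suc n \<le> \<rho> ^ n" using \<rho> by (intro power_decreasing) auto
      qed (use c in auto)
      also have "\<dots> = E * c * \<rho> ^ n * norm b" by (simp add: E_def algebra_simps)
      finally show ?thesis .
    qed
    \<comment> \<open>Stating the bound for all later times \<open>m\<close> replaces the variation of constants formula.\<close>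
    have sum: "norm (D (real m * T) (q n) (al n)) \<le> K * (\<Sum>i<n. norm (d i))" for m n
    proof (induction n arbitrary: m)
      case 0
      then show ?case using linear_0[OF D_linear[OF q]] T by (simp add: al0)
    next
      case (Suc n)
      have "D (real m * T) (q (Suc n)) (al (Suc n))
          = D (real m * T) (q (Suc n)) (D T (q n) (al n)) + D (real m * T) (q (Suc n)) (d n)"
        using T linear_add[OF D_linear[OF q], of "real m * T" "Suc n" "D T (q n) (al n)" "d n"] by (simp add: d_def)
      also have "D (real m * T) (q (Suc n)) (D T (q n) (al n)) = D (real (Suc m) * T) (q n) (al n)"
        using D_Suc(2)[OF q, of T m n] T qS by simp
      finally have "norm (D (real m * T) (q (Suc n)) (al (Suc n)))
          \<le> norm (D (real (Suc m) * T) (q n) (al n)) + norm (D (real m * T) (q (Suc n)) (d n))"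
        using norm_triangle_ineq by metis
      also have "\<dots> \<le> K * (\<Sum>i<n. norm (d i)) + K * norm (d n)"
        using T by (intro add_mono Suc.IH D_tangent(2)[OF q _ dT]) simp
      finally show ?case by (simp add: distrib_left)
    qed
    have "(\<Sum>i<n. norm (d i)) \<le> (\<Sum>i<n. E * c * norm b * \<rho> ^ i)"
      by (intro sum_mono) (use d_le in \<open>simp add: mult_ac\<close>)
    also have "\<dots> = E * c * norm b * (\<Sum>i<n. \<rho> ^ i)" by (simp add: sum_distrib_left)
    also have "\<dots> \<le> E * c * norm b * (1 / (1 - \<rho>))"
      using \<rho> E c by (intro mult_left_mono) (auto simp: sum_gp_strict divide_right_mono)
    finally have "(\<Sum>i<n. norm (d i)) \<le> E * c * norm b * (1 / (1 - \<rho>))" .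
    then have "K * (\<Sum>i<n. norm (d i)) \<le> K * (E * c / (1 - \<rho>)) * norm b"
      using K by (auto dest: mult_left_mono[of _ _ K] simp: mult_ac)
    moreover have "norm (al n) \<le> K * (\<Sum>i<n. norm (d i))" using sum[of 0 n] D_0[OF q] by simp
    moreover have "\<rho> ^ n \<le> 1" using \<rho> by (simp add: power_le_one)
    then have "c * \<rho> ^ n * norm b \<le> c * 1 * norm b" using c by (intro mult_right_mono mult_left_mono) auto
    ultimately have "norm (al n + be n) \<le> K * (E * c / (1 - \<rho>)) * norm b + c * norm b"
      using be[of n] norm_triangle_ineq[of "al n" "be n"] by linarith
    then show ?thesis unfolding ab(3) M_def by (simp add: distrib_right)
  qed
  ultimately show ?thesis by blast
qed

lemma D_bounded:
  assumes T: "0 < T"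
  shows "\<exists>M\<ge>1. \<forall>p\<in>V. \<forall>n::nat. \<forall>v. norm (D (real n * T) p v) \<le> M * norm v"
proof -
  obtain M where M: "0 < M" "\<forall>p\<in>V. \<forall>b\<in>N p. \<forall>n::nat. norm (D (real n * T) p b) \<le> M * norm b"
    using normal_bounded[OF T] by blast
  obtain r where r: "0 < r" "\<forall>y\<in>V. \<forall>a\<in>tangent_space V y. \<forall>b\<in>N y. r * norm b \<le> norm (a + b)"
    using normal_angle_bound[OF V(1,2) ds N] by blast
  \<comment> \<open>The angle bound controls both components:
    \<open>norm b \<le> norm v / r\<close>, and then
    \<open>norm a \<le> (1 + 1 / r) * norm v\<close>.\<close>
  define C where "C = max 1 (K * (1 + 1 / r) + M / r)"
  have "norm (D (real n * T) p v) \<le> C * norm v" if p: "p \<in> V" for p n v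
  proof -
    obtain a b where ab: "a \<in> tangent_space V p" "b \<in> N p" "v = a + b"
      using direct_sumD(4)[OF ds[OF p], of v] by blast
    have nT: "0 \<le> real n * T" using T by simp
    have b: "norm b \<le> norm v / r" using r ab p by (simp add: pos_le_divide_eq mult.commute)
    have "norm a \<le> norm v + norm b" using ab(3) norm_triangle_ineq4[of v b] by simp
    then have a: "norm a \<le> (1 + 1 / r) * norm v" using b by (simp add: distrib_right)
    have "norm (D (real n * T) p v) \<le> norm (D (real n * T) p a) + norm (D (real n * T) p b)"
      unfolding ab(3) linear_add[OF D_linear[OF p nT]] by (rule norm_triangle_ineq)
    also have "\<dots> \<le> K * norm a + M * norm b"
      using D_tangent(2)[OF p nT ab(1)] M(2) p ab(2) by (intro add_mono) auto
    also have "\<dots> \<le> K * ((1 + 1 / r) * norm v) + M * (norm v / r)"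
      using a b K M by (intro add_mono mult_left_mono) auto
    also have "\<dots> = (K * (1 + 1 / r) + M / r) * norm v" by (simp add: algebra_simps)
    also have "\<dots> \<le> C * norm v" by (intro mult_right_mono) (auto simp: C_def)
    finally show ?thesis .
  qed
  then show ?thesis by (intro exI[of _ C]) (auto simp: C_def)
qed

text \<open>Let \<open>w\<close> lead from the nearest point \<open>p\<close> of \<open>V\<close> to
  \<open>u 0\<close>. After time \<open>T\<close> the normal part of its image is small; the
  tangential part may have grown, but moving along it hardly changes the distance to
  \<open>V\<close>. Linearization error, normal part and tangent approximation cost at most
  \<open>norm w / 8\<close> each.\<close>

lemma distance_halving:
  "\<exists>T>0. \<exists>\<delta>>0. \<forall>u. ode_solution (\<lambda>_. f) {0..T} u \<longrightarrow> (\<forall>t\<in>{0..T}. norm (u t) \<le> R) \<longrightarrow>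
    infdist (u 0) V \<le> \<delta> \<longrightarrow> infdist (u T) V \<le> infdist (u 0) V / 2"
proof -
  obtain r where r: "0 < r" "\<forall>y\<in>V. \<forall>a\<in>tangent_space V y. \<forall>b\<in>N y. r * norm b \<le> norm (a + b)"
    using normal_angle_bound[OF V(1,2) ds N] by blast
  \<comment> \<open>The inequality \<open>1 + \<mu> * T \<le> exp (\<mu> * T)\<close> turns this
    choice into \<open>c * exp (- \<mu> * T) \<le> r / 8\<close>; the angle bound \<open>r\<close>
    then converts \<open>norm b\<close> into \<open>norm w\<close>.\<close>
  define T where "T = 8 * c / r / \<mu>"
  have T: "0 < T" using c r \<mu> by (simp add: T_def)
  have "\<mu> * T = 8 * c / r" using \<mu> by (simp add: T_def)
  then have "8 * c / r \<le> exp (\<mu> * T)" using exp_ge_add_one_self[of "\<mu> * T"] by linarith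
  then have "8 * c \<le> r * exp (\<mu> * T)" using r(1) by (simp add: pos_divide_le_eq mult.commute)
  then have "8 * c * exp (- \<mu> * T) \<le> r * exp (\<mu> * T) * exp (- \<mu> * T)" by (intro mult_right_mono) auto
  then have cT: "c * exp (- \<mu> * T) \<le> r / 8" by (simp add: mult.assoc flip: exp_add)
  define E where "E = exp (L * T)"
  have E: "0 < E" "1 \<le> E" using L T by (auto simp: E_def)
  define \<eta> where "\<eta> = 1 / (8 * T * exp (2 * L * T))"
  have \<eta>: "0 < \<eta>" "\<eta> * T * exp (2 * L * T) = 1 / 8" using T by (auto simp: \<eta>_def)
  obtain d where d: "0 < d" "\<And>y z. norm y \<le> R \<Longrightarrow> norm z \<le> R \<Longrightarrow> norm (y - z) < d \<Longrightarrow> norm (f' y - f' z) \<le> \<eta>"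
    using uniform_modulus[OF \<eta>(1)] by metis
  have "0 < 1 / (8 * (E + 1))" using E by simp
  from tangent_approx[OF V(1,2) this] obtain r1 where r1: "0 < r1"
    "\<forall>y\<in>V. \<forall>\<tau>\<in>tangent_space V y. norm \<tau> \<le> r1 \<longrightarrow> infdist (y + \<tau>) V \<le> 1 / (8 * (E + 1)) * norm \<tau>"
    by blast
  \<comment> \<open>The first entry keeps \<open>u\<close> within \<open>d\<close> of the orbit of
    \<open>p\<close> up to time \<open>T\<close>, the second keeps the tangent vector \<tau> within
    the radius \<open>r1\<close>.\<close>
  define \<delta> where "\<delta> = min (d / (2 * E)) (r1 / (E + 1))"
  have \<delta>: "0 < \<delta>" "E * \<delta> < d" "(E + 1) * \<delta> \<le> r1"
  proof -
    show "0 < \<delta>" using d r1 E by (simp add: \<delta>_def)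
    have "E * \<delta> \<le> E * (d / (2 * E))" using E by (intro mult_left_mono) (auto simp: \<delta>_def)
    also have "\<dots> < d" using E d by simp
    finally show "E * \<delta> < d" .
    have "(E + 1) * \<delta> \<le> (E + 1) * (r1 / (E + 1))" using E by (intro mult_left_mono) (auto simp: \<delta>_def)
    also have "\<dots> = r1" using E by simp
    finally show "(E + 1) * \<delta> \<le> r1" .
  qed
  have "infdist (u T) V \<le> infdist (u 0) V / 2"
    if u: "ode_solution (\<lambda>_. f) {0..T} u" "\<forall>t\<in>{0..T}. norm (u t) \<le> R" "infdist (u 0) V \<le> \<delta>" for u
  proof -
    obtain p where p: "p \<in> V" "infdist (u 0) V = dist (u 0) p"
      using infdist_attains_inf[OF compact_imp_closed[OF V(1)] V(3)] by metis
    define w where "w = u 0 - p"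
    have w: "infdist (u 0) V = norm w" "norm w \<le> \<delta>" using p u(3) by (auto simp: w_def dist_norm)
    have PR: "norm (\<Phi> t p) \<le> R" for t using orbit_norm[OF p(1), of t] by simp
    have seg: "norm (f' \<xi> - f' (\<Phi> t p)) \<le> \<eta>" if t: "t \<in> {0..T}" and \<xi>: "\<xi> \<in> closed_segment (u t) (\<Phi> t p)" for t \<xi>
    proof (rule d(2)[OF _ PR])
      show "norm \<xi> \<le> R" using \<xi> u(2) t PR[of t] closed_segment_subset[of "u t" "cball 0 R" "\<Phi> t p"] by auto
      have "norm (\<xi> - \<Phi> t p) \<le> norm (u t - \<Phi> t p)"
        using segment_bound(2)[OF \<xi>] by (simp add: norm_minus_commute)
      also have "\<dots> \<le> exp (L * (t - 0)) * norm (u 0 - \<Phi> 0 p)"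
        by (rule sol_dist[OF u(1) _ orbit_on[OF p(1)] PR t]) (use u(2) in simp)
      also have "\<dots> \<le> E * \<delta>"
        using t L w E by (intro mult_mono) (auto simp: E_def \<Phi>_0[OF p(1)] w_def)
      finally show "norm (\<xi> - \<Phi> t p) < d" using \<delta>(2) by simp
    qed
    have "norm (u T - \<Phi> T p - D T p (u 0 - \<Phi> 0 p)) \<le> \<eta> * T * exp (2 * L * T) * norm (u 0 - \<Phi> 0 p)"
      by (rule D_estimate[OF p(1) _ u(1) orbit_on[OF p(1)] _ PR seg]) (use T u(2) in auto)
    then have lin: "norm (u T - \<Phi> T p - D T p w) \<le> norm w / 8" by (simp add: \<eta>(2) \<Phi>_0[OF p(1)] w_def)
    obtain a b where ab: "a \<in> tangent_space V p" "b \<in> N p" "w = a + b"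
      using direct_sumD(4)[OF ds[OF p(1)], of w] by blast
    have y: "\<Phi> T p \<in> V" by (rule \<Phi>_V[OF p(1)])
    obtain a' b' where ab': "a' \<in> tangent_space V (\<Phi> T p)" "b' \<in> N (\<Phi> T p)" "D T p b = a' + b'"
      using direct_sumD(4)[OF ds[OF y], of "D T p b"] by blast
    have T0: "0 \<le> T" using T by simp
    have "norm b' \<le> c * exp (- \<mu> * T) * norm b" by (rule D_normal[OF p(1) T0 ab(2) ab'(3,1,2)])
    also have "\<dots> \<le> r / 8 * norm b" using cT by (rule mult_right_mono) simp
    also have "\<dots> \<le> norm w / 8" using r(2) p(1) ab by auto
    finally have b': "norm b' \<le> norm w / 8" .
    \<comment> \<open>All tangential contributions together: the image of \<open>a\<close> and the
      tangential part of the image of \<open>b\<close>, over which the contraction hypothesis has no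
      control.\<close>
    define \<tau> where "\<tau> = D T p a + a'"
    have \<tau>T: "\<tau> \<in> tangent_space V (\<Phi> T p)"
      unfolding \<tau>_def by (intro subspace_add[OF direct_sumD(1)[OF ds[OF y]]] D_tangent(1)[OF p(1) T0] ab ab')
    have \<tau>_eq: "D T p w = \<tau> + b'"
      unfolding ab(3) linear_add[OF D_linear[OF p(1) T0]] ab'(3) \<tau>_def by simp
    have "norm \<tau> \<le> norm (D T p w) + norm b'" using \<tau>_eq norm_triangle_ineq4[of "D T p w" b'] by simp
    also have "\<dots> \<le> E * norm w + norm w"
      unfolding E_def using D_norm_le[OF p(1) T0, of w] b' norm_ge_zero[of w] by linarith
    finally have \<tau>: "norm \<tau> \<le> (E + 1) * norm w" by (simp add: distrib_right)
    also have "\<dots> \<le> (E + 1) * \<delta>" using w(2) E by (intro mult_left_mono) auto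
    finally have "norm \<tau> \<le> r1" using \<delta>(3) by simp
    then have "infdist (\<Phi> T p + \<tau>) V \<le> 1 / (8 * (E + 1)) * norm \<tau>" using r1(2) y \<tau>T by blast
    also have "\<dots> \<le> 1 / (8 * (E + 1)) * ((E + 1) * norm w)" using \<tau> E by (intro mult_left_mono) auto
    also have "\<dots> = norm w / 8" using E by (simp add: field_simps)
    finally have 1: "infdist (\<Phi> T p + \<tau>) V \<le> norm w / 8" .
    have "dist (u T) (\<Phi> T p + \<tau>) = norm ((u T - \<Phi> T p - D T p w) + b')"
      unfolding dist_norm \<tau>_eq by (simp add: algebra_simps)
    also have "\<dots> \<le> norm w / 8 + norm w / 8" using norm_triangle_mono[OF lin b'] .
    finally show ?thesis using 1 infdist_triangle[of "u T" V "\<Phi> T p + \<tau>"] norm_ge_zero[of w] unfolding w(1) by linarith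
  qed
  then show ?thesis using T \<delta>(1) by blast
qed

lemma shadowing:
  assumes x: "ode_solution (\<lambda>_. f) {0..} x" "\<And>t. 0 \<le> t \<Longrightarrow> norm (x t) \<le> R"
    and lim: "((\<lambda>t. infdist (x t) V) \<longlongrightarrow> 0) at_top"
  shows "\<exists>T>0. \<exists>q\<in>V. \<exists>C\<ge>0. \<forall>n::nat. norm (x (real n * T) - \<Phi> (real n * T) q) \<le> C * (1/2) ^ n"
proof -
  obtain T \<delta> where T: "0 < T" and \<delta>: "0 < \<delta>" and half: "\<forall>u. ode_solution (\<lambda>_. f) {0..T} u \<longrightarrow>
      (\<forall>t\<in>{0..T}. norm (u t) \<le> R) \<longrightarrow> infdist (u 0) V \<le> \<delta> \<longrightarrow> infdist (u T) V \<le> infdist (u 0) V / 2"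
    using distance_halving by blast
  have sol: "ode_solution (\<lambda>_. f) {0..T} (\<lambda>t. x (t + real n * T))" for n
  proof -
    have "ode_solution (\<lambda>_. f) {real n * T..T + real n * T} x"
      by (rule ode_solution_subset[OF x(1)]) (use T in auto)
    from ode_solution_shift[OF this, of "real n * T"] show ?thesis by simp
  qed
  have xR: "norm (x (t + real n * T)) \<le> R" if "t \<in> {0..T}" for t n
    using that T by (intro x(2)) auto
  have Suc: "T + real n * T = real (Suc n) * T" for n by (simp add: distrib_right)
  define \<beta> where "\<beta> n = infdist (x (real n * T)) V" for n
  have \<beta>0: "0 \<le> \<beta> n" for n by (simp add: \<beta>_def infdist_nonneg)
  obtain t0 where t0: "\<forall>t\<ge>t0. infdist (x t) V < \<delta>"
    using order_tendstoD(2)[OF lim \<delta>] unfolding eventually_at_top_linorder by blast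
  obtain n0 where n0: "t0 \<le> real n0 * T" using reals_Archimedean3[OF T, rule_format, of t0] less_imp_le by blast
  have step: "\<beta> (Suc n) \<le> \<beta> n / 2" if n: "n0 \<le> n" for n
  proof -
    have "real n0 * T \<le> real n * T" using n T by (intro mult_right_mono) auto
    then have "infdist (x (0 + real n * T)) V \<le> \<delta>" using t0 n0 by (simp add: less_imp_le)
    from half[rule_format, OF sol xR this] show ?thesis by (simp add: \<beta>_def distrib_right)
  qed
  \<comment> \<open>The sum dominates each of its terms \<open>\<beta> i * 2 ^ i\<close>, which
    settles all \<open>n \<le> n0\<close>; beyond \<open>n0\<close> the halving step takes
    over.\<close>
  define C0 where "C0 = (\<Sum>i\<le>n0. \<beta> i * 2 ^ i)"
  have \<beta>: "\<beta> n \<le> C0 * (1/2) ^ n" for n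
  proof (cases "n \<le> n0")
    case True
    then have "\<beta> n * 2 ^ n \<le> C0" unfolding C0_def by (intro member_le_sum) (auto simp: \<beta>0)
    then have "\<beta> n * 2 ^ n * (1/2) ^ n \<le> C0 * (1/2) ^ n" by (rule mult_right_mono) simp
    then show ?thesis by (simp add: mult.assoc flip: power_mult_distrib)
  next
    case False
    then have "n0 \<le> n" by simp
    then show ?thesis
    proof (induction n rule: dec_induct)
      case base
      have "\<beta> n0 * 2 ^ n0 \<le> C0" unfolding C0_def by (intro member_le_sum) (auto simp: \<beta>0)
      then have "\<beta> n0 * 2 ^ n0 * (1/2) ^ n0 \<le> C0 * (1/2) ^ n0" by (rule mult_right_mono) simp
      then show ?case by (simp add: mult.assoc flip: power_mult_distrib)
    next
      case (step n)
      then show ?case using \<open>n0 \<le> n \<Longrightarrow> \<beta> (Suc n) \<le> \<beta> n / 2\<close> by simp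
    qed
  qed
  have "\<exists>p\<in>V. \<beta> n = norm (x (real n * T) - p)" for n
    using infdist_attains_inf[OF compact_imp_closed[OF V(1)] V(3), of "x (real n * T)"]
    unfolding \<beta>_def dist_norm by metis
  then obtain p where p: "\<And>n. p n \<in> V" "\<And>n. \<beta> n = norm (x (real n * T) - p n)" by metis
  define E where "E = exp (L * T)"
  have near: "norm (x (real (Suc n) * T) - \<Phi> T (p n)) \<le> E * \<beta> n" for n
  proof -
    have "norm (x (T + real n * T) - \<Phi> T (p n)) \<le> exp (L * (T - 0)) * norm (x (0 + real n * T) - \<Phi> 0 (p n))"
    proof (rule sol_dist[OF sol xR orbit_on[OF p(1)]])
      show "norm (\<Phi> t (p n)) \<le> R" for t using orbit_norm[OF p(1)[of n], of t] by simp
    qed (use T in auto)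
    then show ?thesis by (simp add: Suc E_def p \<Phi>_0)
  qed
  \<comment> \<open>The time-0 point of the orbit in \<open>V\<close> that passes through
    \<open>p n\<close> at time \<open>real n * T\<close>; negative times are available since \<Phi>
    is a group.\<close>
  define q where "q n = \<Phi> (- (real n * T)) (p n)" for n
  have qV: "q n \<in> V" for n unfolding q_def by (rule \<Phi>_V[OF p(1)])
  have \<Phi>q: "\<Phi> (real n * T) (q n) = p n" for n
    unfolding q_def \<Phi>_add[OF p(1), symmetric] by (simp add: \<Phi>_0 p(1))
  define C1 where "C1 = K * (C0 / 2 + E * C0)"
  have "norm (q (Suc n) - q n) \<le> C1 * (1/2) ^ n" for n
  proof -
    \<comment> \<open>Written this way, \<open>q n\<close> and \<open>q (Suc n)\<close> are images
      under the same map, so their distance is at most \<open>K\<close> times that of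
      \<open>\<Phi> T (p n)\<close> and \<open>p (Suc n)\<close>, both close to \<open>x\<close> at
      time \<open>real (Suc n) * T\<close>.\<close>
    have "\<Phi> (- (real (Suc n) * T)) (\<Phi> T (p n)) = q n"
      unfolding q_def \<Phi>_add[OF p(1), symmetric] by (simp add: algebra_simps)
    then have "norm (q (Suc n) - q n) \<le> K * norm (p (Suc n) - \<Phi> T (p n))"
      using \<Phi>_lip[OF p(1)[of "Suc n"] \<Phi>_V[OF p(1)[of n], of T], of "- (real (Suc n) * T)"]
      unfolding q_def by simp
    also have "norm (p (Suc n) - \<Phi> T (p n)) \<le> \<beta> (Suc n) + E * \<beta> n"
      using near[of n] p(2)[of "Suc n"] norm_triangle_ineq4[of "x (real (Suc n) * T) - \<Phi> T (p n)" "x (real (Suc n) * T) - p (Suc n)"]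
      by simp
    also have "\<dots> \<le> C0 * (1/2) ^ Suc n + E * (C0 * (1/2) ^ n)"
      by (intro add_mono mult_left_mono \<beta>) (simp add: E_def)
    also have "K * \<dots> = C1 * (1/2) ^ n" by (simp add: C1_def algebra_simps)
    finally show ?thesis using K by simp
  qed
  then obtain l where l: "q \<longlonglongrightarrow> l" "\<forall>n. norm (q n - l) \<le> 2 * C1 * (1/2) ^ n"
    using half_power_cauchy_limit by blast
  have lV: "l \<in> V" using closed_sequentially[OF compact_imp_closed[OF V(1)] _ l(1)] qV by blast
  define C where "C = C0 + K * (2 * C1)"
  have est: "norm (x (real n * T) - \<Phi> (real n * T) l) \<le> C * (1/2) ^ n" for n
  proof -
    have "norm (\<Phi> (real n * T) (q n) - \<Phi> (real n * T) l) \<le> K * norm (q n - l)" by (rule \<Phi>_lip[OF qV lV])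
    also have "\<dots> \<le> K * (2 * C1 * (1/2) ^ n)" using l(2) K by (intro mult_left_mono) auto
    finally have "norm (p n - \<Phi> (real n * T) l) \<le> K * (2 * C1 * (1/2) ^ n)" unfolding \<Phi>q .
    moreover have "norm (x (real n * T) - p n) \<le> C0 * (1/2) ^ n" using \<beta>[of n] unfolding p(2) .
    ultimately have "norm ((x (real n * T) - p n) + (p n - \<Phi> (real n * T) l)) \<le> C0 * (1/2) ^ n + K * (2 * C1 * (1/2) ^ n)"
      by (intro norm_triangle_mono)
    then show ?thesis by (simp add: C_def algebra_simps)
  qed
  have "0 \<le> C" using order_trans[OF norm_ge_zero est[of 0]] by simp
  with T lV est show ?thesis by blast
qed

text \<open>A discrete variation of constants. Tracking the transport of \<open>w n\<close> over all
  numbers \<open>m\<close> of further periods keeps \<open>M\<close> as a single prefactor, whereas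
  bounding each factor separately would give powers of \<open>M\<close>. The product of the
  \<open>1 + M * \<beta> i\<close> is estimated by the exponential of the sum.\<close>

lemma perturbed_products:
  assumes T: "0 < T" and q: "q \<in> V" and M: "1 \<le> M"
    and DM: "\<And>p n v. p \<in> V \<Longrightarrow> norm (D (real n * T) p v) \<le> M * norm v"
    and \<beta>: "\<And>n. 0 \<le> \<beta> n"
    and step: "\<And>n. j \<le> n \<Longrightarrow> n < n1 \<Longrightarrow>
      norm (w (Suc n) - D T (\<Phi> (real n * T) q) (w n)) \<le> \<beta> n * norm (w n)"
    and n: "j \<le> n" "n \<le> n1"
  shows "norm (D (real m * T) (\<Phi> (real n * T) q) (w n)) \<le> M * norm (w j) * exp (M * (\<Sum>i\<in>{j..<n}. \<beta> i))"
  using n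
proof (induction n arbitrary: m rule: dec_induct)
  case base
  then show ?case using DM[OF \<Phi>_V[OF q]] by simp
next
  case (step n)
  define Q where "Q n = \<Phi> (real n * T) q" for n
  have Q: "Q n \<in> V" for n unfolding Q_def by (rule \<Phi>_V[OF q])
  define B where "B = M * norm (w j) * exp (M * (\<Sum>i\<in>{j..<n}. \<beta> i))"
  have IH: "norm (D (real m * T) (Q n) (w n)) \<le> B" for m
    unfolding Q_def B_def using step by simp
  have wB: "norm (w n) \<le> B" using IH[of 0] D_0[OF Q] by simp
  define e where "e = w (Suc n) - D T (Q n) (w n)"
  have e: "norm e \<le> \<beta> n * norm (w n)" unfolding e_def Q_def using assms(6)[of n] step by simp
  have mT: "0 \<le> real m * T" using T by simp
  have "D (real m * T) (Q (Suc n)) (w (Suc n)) = D (real m * T) (Q (Suc n)) (D T (Q n) (w n)) + D (real m * T) (Q (Suc n)) e"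
    using linear_add[OF D_linear[OF Q mT], of "Suc n" "D T (Q n) (w n)" e] by (simp add: e_def)
  also have "D (real m * T) (Q (Suc n)) (D T (Q n) (w n)) = D (real (Suc m) * T) (Q n) (w n)"
    using D_Suc(2)[OF Q, of T m n "w n"] T \<Phi>_Suc[OF q, of T n] by (simp add: Q_def)
  finally have "norm (D (real m * T) (Q (Suc n)) (w (Suc n)))
      \<le> norm (D (real (Suc m) * T) (Q n) (w n)) + norm (D (real m * T) (Q (Suc n)) e)"
    using norm_triangle_ineq by metis
  also have "\<dots> \<le> B + M * (\<beta> n * B)"
  proof (intro add_mono IH)
    have "norm (D (real m * T) (Q (Suc n)) e) \<le> M * norm e" by (rule DM[OF Q])
    also have "\<dots> \<le> M * (\<beta> n * norm (w n))" using e M by (intro mult_left_mono) auto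
    also have "\<dots> \<le> M * (\<beta> n * B)" using wB M \<beta> by (intro mult_left_mono) auto
    finally show "norm (D (real m * T) (Q (Suc n)) e) \<le> M * (\<beta> n * B)" .
  qed
  also have "\<dots> = B * (1 + M * \<beta> n)" by (simp add: algebra_simps)
  also have "\<dots> \<le> B * exp (M * \<beta> n)"
    using M by (intro mult_left_mono exp_ge_add_one_self) (simp add: B_def)
  also have "\<dots> = M * norm (w j) * exp (M * (\<Sum>i\<in>{j..<Suc n}. \<beta> i))"
    using step(1) by (simp add: B_def distrib_left exp_add mult.assoc)
  finally show ?case unfolding Q_def .
qed

text \<open>\<open>M\<close> is chosen before \<open>t\<close>, and \<open>r\<close> after it. Over
  full periods the difference of two solutions follows the cocycle along the orbit of
  \<open>q\<close> up to relative errors whose sum is bounded independently of \<open>t\<close>, so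
  \<open>perturbed_products\<close> applies.\<close>

lemma uniformly_lipschitz_flow:
  assumes x: "ode_solution (\<lambda>_. f) {0..} x" "\<And>t. 0 \<le> t \<Longrightarrow> norm (x t) \<le> R - 1"
    and lim: "((\<lambda>t. infdist (x t) V) \<longlongrightarrow> 0) at_top" and \<epsilon>: "0 < \<epsilon>" and H: "0 \<le> H"
    and holder: "\<And>y z. z \<in> V \<Longrightarrow> norm y \<le> R \<Longrightarrow> norm (f' y - f' z) \<le> H * norm (y - z) powr \<epsilon>"
  shows "\<exists>M\<ge>1. \<forall>t\<ge>0. \<exists>r>0. exp (L * t) * r \<le> 1 \<and> (\<forall>s t' u v. 0 \<le> s \<longrightarrow> s \<le> t' \<longrightarrow> t' \<le> t \<longrightarrow>
    ode_solution (\<lambda>_. f) {s..t'} u \<longrightarrow> ode_solution (\<lambda>_. f) {s..t'} v \<longrightarrow>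
    norm (u s - x s) \<le> r \<longrightarrow> norm (v s - x s) \<le> r \<longrightarrow> norm (u t' - v t') \<le> M * norm (u s - v s))"
proof -
  have xR: "norm (x t) \<le> R" if "0 \<le> t" for t using x(2)[OF that] by simp
  obtain T q C where T: "0 < T" and q: "q \<in> V" and C: "0 \<le> C"
    and shadow: "\<forall>n::nat. norm (x (real n * T) - \<Phi> (real n * T) q) \<le> C * (1/2) ^ n"
    using shadowing[OF x(1) xR lim] by blast
  obtain M where M: "1 \<le> M" "\<forall>p\<in>V. \<forall>n::nat. \<forall>v. norm (D (real n * T) p v) \<le> M * norm v"
    using D_bounded[OF T] by blast
  define E where "E = exp (L * T)"
  have E: "1 \<le> E" using L T by (simp add: E_def)
  define B where "B = T * exp (2 * L * T)"
  have B: "0 \<le> B" using T by (simp add: B_def)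
  \<comment> \<open>The Hoelder exponent turns the decay \<open>(1/2) ^ i\<close> of the distance to
    the orbit of \<open>q\<close> into the decay \<open>\<theta> ^ i\<close> of the difference of
    derivatives, still geometric.\<close>
  define \<theta> where "\<theta> = (1/2::real) powr \<epsilon>"
  have \<theta>: "0 < \<theta>" "\<theta> < 1" using \<epsilon> powr_less_mono2[of \<epsilon> "1/2::real" 1] by (auto simp: \<theta>_def)
  define G where "G = H * (E * C) powr \<epsilon>"
  have G: "0 \<le> G" using H by (simp add: G_def)
  \<comment> \<open>Bound for the sum of the relative errors: the 1 stems from the deviation of
    \<open>u\<close> and \<open>v\<close> from \<open>x\<close>, the geometric series from that of
    \<open>x\<close> from the orbit of \<open>q\<close>.\<close>
  define S where "S = B * (1 + G / (1 - \<theta>))"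
  \<comment> \<open>The two factors \<open>E\<close> pay for the incomplete periods at both ends of
    the time interval.\<close>
  define M' where "M' = E * (M * exp (M * S)) * E"
  have S: "0 \<le> S" using B G \<theta> by (simp add: S_def)
  have "1 * 1 \<le> M * exp (M * S)" using M S by (intro mult_mono) auto
  then have "E * 1 \<le> E * (M * exp (M * S))" using E by (intro mult_left_mono) auto
  then have "E * 1 * 1 \<le> E * (M * exp (M * S)) * E" using E by (intro mult_mono) auto
  then have EM': "E \<le> M'" by (simp add: M'_def)

  have sol_shift: "ode_solution (\<lambda>_. f) {0..T} (\<lambda>\<tau>. u (\<tau> + real i * T))"
    if u: "ode_solution (\<lambda>_. f) {s..t'} u" and i: "s \<le> real i * T" "real (Suc i) * T \<le> t'" for u s t' and i :: nat
  proof -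
    have "{real i * T..T + real i * T} \<subseteq> {s..t'}" using i by (auto simp: distrib_right)
    from ode_solution_shift[OF ode_solution_subset[OF u this], of "real i * T"] show ?thesis by simp
  qed
  have \<Phi>\<Phi>: "\<Phi> \<tau> (\<Phi> (real i * T) q) = \<Phi> (\<tau> + real i * T) q" for \<tau> i by (simp add: \<Phi>_add q)
  have \<Phi>R: "norm (\<Phi> t q) \<le> R" for t using orbit_norm[OF q, of t] by simp

  have close: "norm (f' (x (\<tau> + real i * T)) - f' (\<Phi> (\<tau> + real i * T) q)) \<le> G * \<theta> ^ i"
    if \<tau>: "\<tau> \<in> {0..T}" for \<tau> and i :: nat
  proof -
    have "norm (x (\<tau> + real i * T) - \<Phi> \<tau> (\<Phi> (real i * T) q))
        \<le> exp (L * (\<tau> - 0)) * norm (x (0 + real i * T) - \<Phi> 0 (\<Phi> (real i * T) q))"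
    proof (rule sol_dist[OF _ _ orbit_on[OF \<Phi>_V[OF q]] _ \<tau>])
      show "ode_solution (\<lambda>_. f) {0..T} (\<lambda>\<tau>. x (\<tau> + real i * T))"
        using T by (intro sol_shift[where s = 0 and t' = "real (Suc i) * T"] ode_solution_subset[OF x(1)]) auto
      show "norm (x (\<tau> + real i * T)) \<le> R" if "\<tau> \<in> {0..T}" for \<tau> using that T by (intro xR) auto
      show "norm (\<Phi> \<tau> (\<Phi> (real i * T) q)) \<le> R" for \<tau> unfolding \<Phi>\<Phi> by (rule \<Phi>R)
    qed
    also have "\<dots> \<le> E * (C * (1/2) ^ i)"
      using \<tau> L shadow E by (intro mult_mono) (auto simp: E_def \<Phi>_0[OF \<Phi>_V[OF q]])
    finally have le: "norm (x (\<tau> + real i * T) - \<Phi> (\<tau> + real i * T) q) \<le> E * C * (1/2) ^ i" by (simp add: \<Phi>\<Phi>)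
    have "norm (f' (x (\<tau> + real i * T)) - f' (\<Phi> (\<tau> + real i * T) q))
        \<le> H * norm (x (\<tau> + real i * T) - \<Phi> (\<tau> + real i * T) q) powr \<epsilon>"
      using \<tau> T by (intro holder \<Phi>_V[OF q] xR) auto
    also have "\<dots> \<le> H * (E * C * (1/2) ^ i) powr \<epsilon>" using le H \<epsilon> by (intro mult_left_mono powr_mono2) auto
    also have "(E * C * (1/2) ^ i) powr \<epsilon> = (E * C) powr \<epsilon> * \<theta> ^ i"
    proof -
      have "((1/2::real) ^ i) powr \<epsilon> = \<theta> ^ i"
        by (simp add: \<theta>_def powr_realpow[symmetric] powr_powr mult.commute)
      then show ?thesis using E C by (simp add: powr_mult)
    qed
    finally show ?thesis by (simp add: G_def)
  qed

  have "\<exists>r>0. exp (L * t) * r \<le> 1 \<and> (\<forall>s t' u v. 0 \<le> s \<longrightarrow> s \<le> t' \<longrightarrow> t' \<le> t \<longrightarrow>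
    ode_solution (\<lambda>_. f) {s..t'} u \<longrightarrow> ode_solution (\<lambda>_. f) {s..t'} v \<longrightarrow>
    norm (u s - x s) \<le> r \<longrightarrow> norm (v s - x s) \<le> r \<longrightarrow> norm (u t' - v t') \<le> M' * norm (u s - v s))"
    if t: "0 \<le> t" for t
  proof -
    \<comment> \<open>At most \<open>t / T\<close> full periods fit, so errors of size \<eta> per
      period add up to at most 1.\<close>
    define \<eta> where "\<eta> = 1 / (t / T + 1)"
    have \<eta>: "0 < \<eta>" using t T by (simp add: \<eta>_def add_nonneg_pos)
    obtain d where d: "0 < d" "\<And>y z. norm y \<le> R \<Longrightarrow> norm z \<le> R \<Longrightarrow> norm (y - z) < d \<Longrightarrow> norm (f' y - f' z) \<le> \<eta>"
      using uniform_modulus[OF \<eta>] by metis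
    \<comment> \<open>The factor \<open>exp (- L * t)\<close> compensates the growth up to time
      \<open>t\<close>; 1 is the margin for staying in the ball, and \<open>d / 2\<close> keeps
      solutions in the range of the modulus.\<close>
    define r where "r = min 1 (d / 2) * exp (- L * t)"
    have r: "0 < r" "exp (L * t) * r = min 1 (d / 2)" using d(1) by (auto simp: r_def exp_minus)
    define \<beta> where "\<beta> i = (\<eta> + G * \<theta> ^ i) * B" for i :: nat
    have \<beta>: "0 \<le> \<beta> i" for i using \<eta> G \<theta> B by (simp add: \<beta>_def)

    have main: "norm (u t' - v t') \<le> M' * norm (u s - v s)"
      if s: "0 \<le> s" "s \<le> t'" "t' \<le> t" and u: "ode_solution (\<lambda>_. f) {s..t'} u" "norm (u s - x s) \<le> r"
        and v: "ode_solution (\<lambda>_. f) {s..t'} v" "norm (v s - x s) \<le> r" for s t' u v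
    proof -
      have xs: "ode_solution (\<lambda>_. f) {s..t'} x" "\<And>\<tau>. \<tau> \<in> {s..t'} \<Longrightarrow> norm (x \<tau>) \<le> R - 1"
        using s by (auto intro: ode_solution_subset[OF x(1)] x(2))
      have small: "exp (L * (\<tau> - s)) * norm (y s - x s) \<le> min 1 (d / 2)"
        if "norm (y s - x s) \<le> r" "\<tau> \<in> {s..t'}" for y \<tau>
      proof -
        have "exp (L * (\<tau> - s)) * norm (y s - x s) \<le> exp (L * t) * r"
          using that s L r(1) by (intro mult_mono) auto
        then show ?thesis using r(2) by simp
      qed
      have nearby: "norm (y \<tau>) \<le> R \<and> norm (y \<tau> - x \<tau>) < d"
        if y: "ode_solution (\<lambda>_. f) {s..t'} y" "norm (y s - x s) \<le> r" and \<tau>: "\<tau> \<in> {s..t'}" for y \<tau>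
      proof -
        have le: "exp (L * (t' - s)) * norm (y s - x s) \<le> 1" using small[where y = y and \<tau> = t', OF y(2)] s by simp
        show ?thesis
          using near_solution[OF xs y(1) le \<tau>] small[where y = y, OF y(2) \<tau>] d(1) by simp
      qed
      have uv: "norm (u b - v b) \<le> exp (L * (b - a)) * norm (u a - v a)" if ab: "s \<le> a" "a \<le> b" "b \<le> t'" for a b
      proof (rule sol_dist[where b = b])
        show "ode_solution (\<lambda>_. f) {a..b} u" "ode_solution (\<lambda>_. f) {a..b} v"
          using ab by (auto intro: ode_solution_subset[OF u(1)] ode_solution_subset[OF v(1)])
        show "norm (u \<tau>) \<le> R" "norm (v \<tau>) \<le> R" if "\<tau> \<in> {a..b}" for \<tau>
          using nearby[OF u, of \<tau>] nearby[OF v, of \<tau>] ab that by auto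
      qed (use ab in auto)
      have uvE: "norm (u b - v b) \<le> E * norm (u a - v a)" if "s \<le> a" "a \<le> b" "b \<le> t'" "b - a \<le> T" for a b
      proof -
        have "exp (L * (b - a)) * norm (u a - v a) \<le> E * norm (u a - v a)"
          using that L unfolding E_def by (intro mult_right_mono) auto
        with uv[OF that(1-3)] show ?thesis by linarith
      qed
      \<comment> \<open>\<open>real j * T\<close> is the first multiple of \<open>T\<close> from
        \<open>s\<close> on, \<open>real n * T\<close> the last one up to \<open>t'\<close>. If
        \<open>n < j\<close>, the interval is shorter than a period.\<close>
      define j n where "j = nat \<lceil>s / T\<rceil>" and "n = nat \<lfloor>t' / T\<rfloor>"
      have "s / T \<le> real j" "real j < s / T + 1" "real n \<le> t' / T" "t' / T < real n + 1"
        using s T unfolding j_def n_def by (auto simp: le_nat_floor) linarith+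
      then have jn: "s \<le> real j * T" "real j * T < s + T" "real n * T \<le> t'" "t' < real n * T + T"
        using T by (auto simp: field_simps)
      show ?thesis
      proof (cases "j \<le> n")
        case False
        then have "real (Suc n) * T \<le> real j * T" using T by (intro mult_right_mono) auto
        then have "t' - s \<le> T" using jn by (simp add: distrib_right)
        then have "norm (u t' - v t') \<le> E * norm (u s - v s)" using uvE[of s t'] s by simp
        also have "\<dots> \<le> M' * norm (u s - v s)" using EM' by (rule mult_right_mono) simp
        finally show ?thesis .
      next
        case True
        define w where "w i = u (real i * T) - v (real i * T)" for i :: nat
        have jnT: "real j * T \<le> real n * T" using True T by (intro mult_right_mono) auto
        have step: "norm (w (Suc i) - D T (\<Phi> (real i * T) q) (w i)) \<le> \<beta> i * norm (w i)"
          if i: "j \<le> i" "i < n" for i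
        proof -
          have "real j * T \<le> real i * T" "real (Suc i) * T \<le> real n * T"
            using i T by (auto intro!: mult_right_mono)
          then have iT: "s \<le> real i * T" "real (Suc i) * T \<le> t'" using jn by linarith+
          have in_st: "\<tau> + real i * T \<in> {s..t'}" if "\<tau> \<in> {0..T}" for \<tau>
            using that iT by (auto simp: distrib_right)
          have "norm (u (T + real i * T) - v (T + real i * T)
              - D T (\<Phi> (real i * T) q) (u (0 + real i * T) - v (0 + real i * T)))
            \<le> (\<eta> + G * \<theta> ^ i) * T * exp (2 * L * T) * norm (u (0 + real i * T) - v (0 + real i * T))"
          proof (rule D_estimate[OF \<Phi>_V[OF q] less_imp_le[OF T] sol_shift[OF u(1) iT] sol_shift[OF v(1) iT]])
            fix \<tau> assume \<tau>: "\<tau> \<in> {0..T}"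
            let ?\<tau> = "\<tau> + real i * T"
            note nu = nearby[OF u in_st[OF \<tau>]] and nv = nearby[OF v in_st[OF \<tau>]]
            show "norm (u ?\<tau>) \<le> R" "norm (v ?\<tau>) \<le> R" using nu nv by simp_all
            fix \<xi> assume \<xi>: "\<xi> \<in> closed_segment (u ?\<tau>) (v ?\<tau>)"
            have "\<xi> \<in> cball 0 R" using \<xi> nu nv closed_segment_subset[of "u ?\<tau>" "cball 0 R" "v ?\<tau>"] by auto
            moreover have "\<xi> \<in> ball (x ?\<tau>) d"
              using \<xi> nu nv closed_segment_subset[of "u ?\<tau>" "ball (x ?\<tau>) d" "v ?\<tau>"]
              by (auto simp: dist_norm norm_minus_commute)
            ultimately have "norm (f' \<xi> - f' (x ?\<tau>)) \<le> \<eta>"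
              using \<tau> T by (intro d(2) xR) (auto simp: dist_norm norm_minus_commute)
            from norm_triangle_mono[OF this close[OF \<tau>, of i]]
            show "norm (f' \<xi> - f' (\<Phi> \<tau> (\<Phi> (real i * T) q))) \<le> \<eta> + G * \<theta> ^ i" by (simp add: \<Phi>\<Phi>)
          qed
          then show ?thesis by (simp add: w_def \<beta>_def B_def distrib_right mult.assoc)
        qed
        have "norm (D (real 0 * T) (\<Phi> (real n * T) q) (w n)) \<le> M * norm (w j) * exp (M * (\<Sum>i\<in>{j..<n}. \<beta> i))"
          by (rule perturbed_products[OF T q M(1) _ \<beta> step True order_refl]) (use M(2) in blast)
        then have wn: "norm (w n) \<le> M * norm (w j) * exp (M * (\<Sum>i\<in>{j..<n}. \<beta> i))"
          by (simp add: D_0[OF \<Phi>_V[OF q]])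
        have "(\<Sum>i\<in>{j..<n}. \<beta> i) \<le> (\<Sum>i<n. \<beta> i)" by (rule sum_mono2) (use \<beta> in auto)
        also have "\<dots> = (real n * \<eta> + G * (\<Sum>i<n. \<theta> ^ i)) * B"
          unfolding \<beta>_def by (simp add: sum.distrib sum_distrib_left flip: sum_distrib_right)
        also have "\<dots> \<le> (1 + G * (1 / (1 - \<theta>))) * B"
        proof (intro mult_right_mono add_mono mult_left_mono)
          have "real n * T \<le> t" using jn s by linarith
          then have "real n \<le> t / T" using T by (simp add: pos_le_divide_eq)
          then show "real n * \<eta> \<le> 1" using t T by (simp add: \<eta>_def divide_le_eq add_nonneg_pos)
          show "(\<Sum>i<n. \<theta> ^ i) \<le> 1 / (1 - \<theta>)" using \<theta> by (auto simp: sum_gp_strict divide_right_mono)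
        qed (use G B in auto)
        also have "\<dots> = S" by (simp add: S_def)
        finally have "M * norm (w j) * exp (M * (\<Sum>i\<in>{j..<n}. \<beta> i)) \<le> M * norm (w j) * exp (M * S)"
          using M(1) by (intro mult_left_mono) auto
        with wn have wn: "norm (w n) \<le> M * exp (M * S) * norm (w j)" by (simp add: mult_ac)
        have "norm (w j) \<le> E * norm (u s - v s)" unfolding w_def by (rule uvE) (use jn jnT in linarith)+
        then have "norm (w n) \<le> M * exp (M * S) * (E * norm (u s - v s))"
          using wn M(1) by (meson mult_left_mono order_trans mult_nonneg_nonneg exp_ge_zero zero_le_one)
        moreover have "norm (u t' - v t') \<le> E * norm (w n)" unfolding w_def by (rule uvE) (use jn jnT in linarith)+
        ultimately have "norm (u t' - v t') \<le> E * (M * exp (M * S) * (E * norm (u s - v s)))"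
          using E by (meson mult_left_mono order_trans zero_le_one)
        then show ?thesis by (simp add: M'_def mult_ac)
      qed
    qed
    show ?thesis
      using main r by (intro exI[of _ r] conjI allI impI) auto
  qed
  moreover have "1 \<le> M'" using E EM' by linarith
  ultimately show ?thesis by blast
qed

end

section \<open>The error bound\<close>

theorem theorem7p5:
  fixes f :: "real ^ 'd \<Rightarrow> real ^ 'd"
    and x :: "real \<Rightarrow> real ^ 'd"
    and x0 :: "real ^ 'd"
    and V :: "(real ^ 'd) set"
    and \<omega> :: "'n::finite \<Rightarrow> real"
    and \<epsilon> :: real
    and k :: nat
  assumes "\<epsilon> > 0"
    and "C1_Holder \<epsilon> f"
    and "ode_solution (\<lambda>_. f) {0..} x"
    and "x 0 = x0"
    and "compact V"
    and "C1_submanifold k V"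
    and "invariant f V"
    and "normally_contracting f V"
    and "((\<lambda>t. infdist (x t) V) \<longlongrightarrow> 0) at_top"
    and "conjugate_to_quasiperiodic f V \<omega>"
  shows "\<exists>K>0. \<forall>\<alpha>. admissible \<alpha> \<longrightarrow> (\<forall>t\<ge>0. E_traj f x \<alpha> t \<le> ereal (K * t))"
proof -
  obtain f' where f': "\<forall>x. (f has_derivative blinfun_apply (f' x)) (at x)" "continuous_on UNIV f'"
    and holder: "\<forall>x. \<exists>r>0. \<exists>C. \<forall>y\<in>ball x r. \<forall>z\<in>ball x r. norm (f' y - f' z) \<le> C * norm (y - z) powr \<epsilon>"
    using assms(2) unfolding C1_Holder_def by blast
  obtain h where "h ` V = (torus :: (complex ^ 'n) set)"
    using assms(10) unfolding conjugate_to_quasiperiodic_def homeomorphism_def by blast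
  \<comment> \<open>\<open>V\<close> inherits a point from the torus; nearest points of
    \<open>V\<close> require this.\<close>
  moreover have "(\<chi> i. 1) \<in> (torus :: (complex ^ 'n) set)" by (simp add: torus_def)
  ultimately have "V \<noteq> {}" by blast

  obtain B where B: "\<forall>p\<in>V. norm p \<le> B"
    using compact_imp_bounded[OF assms(5)] unfolding bounded_iff by blast
  obtain t0 where t0: "\<forall>t\<ge>t0. infdist (x t) V < 1"
    using order_tendstoD(2)[OF assms(9), of 1] unfolding eventually_at_top_linorder by auto
  have "compact (x ` {0..t0})"
    by (rule compact_continuous_image[OF ode_solution_continuous_on[OF ode_solution_subset[OF assms(3)]]]) auto
  from compact_imp_bounded[OF this] obtain B' where B': "\<forall>y\<in>x ` {0..t0}. norm y \<le> B'"
    unfolding bounded_iff by (rule exE)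
  \<comment> \<open>After \<open>t0\<close> the trajectory is within 1 of \<open>V\<close>, hence in
    the ball of radius \<open>B + 1\<close>; before, it is bounded by \<open>B'\<close>. The final 1
    is the margin of \<open>exists_near\<close>.\<close>
  define R where "R = max (B + 1) B' + 1"
  have VR: "norm p \<le> R - 1" if "p \<in> V" for p using B[rule_format, OF that] by (simp add: R_def)
  have xR: "norm (x t) \<le> R - 1" if "0 \<le> t" for t
  proof (cases "t \<le> t0")
    case True
    then show ?thesis using B' that by (auto simp: R_def le_max_iff_disj)
  next
    case False
    obtain p where p: "p \<in> V" "infdist (x t) V = dist (x t) p"
      using infdist_attains_inf[OF compact_imp_closed[OF assms(5)] \<open>V \<noteq> {}\<close>] by metis
    have "infdist (x t) V < 1" using t0 False by simp
    then have "norm (x t - p) < 1" unfolding p(2) dist_norm .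
    then show ?thesis using B[rule_format, OF p(1)] norm_triangle_sub[of "x t" p] by (simp add: R_def le_max_iff_disj)
  qed
  have "\<exists>L. C1_field f f' R L"
  proof (rule C1_field_exists)
    show "(f has_derivative blinfun_apply (f' y)) (at y)" for y using f'(1) by blast
    show "\<exists>L. C1_field f f' R L" if "C1_field f f' R L" for L using that by blast
  qed (rule f'(2))
  then obtain L where L: "C1_field f f' R L" by (rule exE)
  then interpret C1_field f f' R L .

  have flow_u: "\<exists>u. ode_solution (\<lambda>_. f) {0..} u \<and> u 0 = p \<and> (\<forall>t\<ge>0. flow f t p = u t \<and> u t \<in> V)"
    if p: "p \<in> V" for p
  proof -
    obtain u where u: "ode_solution (\<lambda>_. f) {0..} u" "u 0 = p" "\<forall>t\<ge>0. u t \<in> V"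
      using assms(7)[unfolded invariant_def, rule_format, OF p] by (elim exE conjE)
    have "flow f t p = u t" if t: "0 \<le> t" for t
    proof -
      have "ode_solution (\<lambda>_. f) {0..t} u" by (rule ode_solution_subset[OF u(1)]) auto
      from flow_eq[OF this t] show ?thesis using u(2) by simp
    qed
    then show ?thesis using u by blast
  qed
  have flow_V: "\<forall>p\<in>V. \<forall>t\<ge>0. flow f t p \<in> V"
  proof (intro ballI allI impI)
    fix p and t :: real assume p: "p \<in> V" and t: "0 \<le> t"
    from flow_u[OF p] show "flow f t p \<in> V" by (elim exE conjE) (use t in simp)
  qed
  obtain \<Phi> K where \<Phi>: "0 < K" "\<forall>t. \<forall>p\<in>V. \<Phi> t p \<in> V" "\<forall>s t. \<forall>p\<in>V. \<Phi> (s + t) p = \<Phi> s (\<Phi> t p)"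
    "\<forall>p\<in>V. \<Phi> 0 p = p" "\<forall>p\<in>V. \<forall>t\<ge>0. flow f t p = \<Phi> t p"
    "\<forall>t. \<forall>p\<in>V. \<forall>q\<in>V. norm (\<Phi> t p - \<Phi> t q) \<le> K * norm (p - q)"
    using quasiperiodic_extension[OF assms(5,10) flow_V] by (elim exE conjE)
  \<comment> \<open>For nonnegative times \<Phi> agrees with the solution that invariance provides,
    and so satisfies the equation.\<close>
  have orbit: "ode_solution (\<lambda>_. f) {0..} (\<lambda>t. \<Phi> t p)" if p: "p \<in> V" for p
  proof -
    obtain u where u: "ode_solution (\<lambda>_. f) {0..} u" "\<forall>t\<ge>0. flow f t p = u t \<and> u t \<in> V"
      using flow_u[OF p] by (elim exE conjE)
    have eq: "\<Phi> t p = u t" if "t \<in> {0..}" for t using u(2) \<Phi>(5) p that by simp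
    show ?thesis
      unfolding ode_solution_def
    proof
      fix t :: real assume t: "t \<in> {0..}"
      have "(u has_vector_derivative f (\<Phi> t p)) (at t within {0..})"
        using u(1) t eq[OF t] by (simp add: ode_solution_def)
      then show "((\<lambda>t. \<Phi> t p) has_vector_derivative f (\<Phi> t p)) (at t within {0..})"
        by (rule has_vector_derivative_transform[OF t, rotated]) (use eq in simp)
    qed
  qed
  obtain N c \<mu> where N: "\<forall>x\<in>V. direct_sum (tangent_space V x) (N x)" "continuous_subspaces V N" "c > 0" "\<mu> > 0"
    "\<forall>x\<in>V. \<forall>t\<ge>0. onorm_on (N x) (proj_along (tangent_space V (flow f t x)) (N (flow f t x)) \<circ>
       frechet_derivative (flow f t) (at x)) < c * exp (- \<mu> * t)"
    using assms(8) unfolding normally_contracting_def by (elim exE conjE)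
  interpret attractor f f' R L V k \<Phi> K N c \<mu>
  proof
    show "onorm_on (N p) (proj_along (tangent_space V (\<Phi> t p)) (N (\<Phi> t p)) \<circ> frechet_derivative (flow f t) (at p))
        \<le> c * exp (- \<mu> * t)" if "p \<in> V" "0 \<le> t" for p t
      using N(5)[rule_format, OF that] \<Phi>(5)[rule_format, OF that] by simp
  qed (use assms(5,6) \<open>V \<noteq> {}\<close> VR \<Phi> orbit N in simp_all)

  have VR': "norm p \<le> R" if "p \<in> V" for p using VR[OF that] by simp
  have "\<exists>H\<ge>0. \<forall>z\<in>V. \<forall>y. norm y \<le> R \<longrightarrow> norm (f' y - f' z) \<le> H * norm (y - z) powr \<epsilon>"
    by (rule compact_holder[OF assms(5) VR' assms(1) holder[rule_format]])
  then obtain H where H: "0 \<le> H" "\<forall>z\<in>V. \<forall>y. norm y \<le> R \<longrightarrow> norm (f' y - f' z) \<le> H * norm (y - z) powr \<epsilon>"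
    by (elim exE conjE)
  have "\<exists>M\<ge>1. \<forall>t\<ge>0. \<exists>r>0. exp (L * t) * r \<le> 1 \<and> (\<forall>s t' u v. 0 \<le> s \<longrightarrow> s \<le> t' \<longrightarrow> t' \<le> t \<longrightarrow>
    ode_solution (\<lambda>_. f) {s..t'} u \<longrightarrow> ode_solution (\<lambda>_. f) {s..t'} v \<longrightarrow>
    norm (u s - x s) \<le> r \<longrightarrow> norm (v s - x s) \<le> r \<longrightarrow> norm (u t' - v t') \<le> M * norm (u s - v s))"
    by (rule uniformly_lipschitz_flow[OF assms(3) xR assms(9,1) H(1) H(2)[rule_format]])
  then obtain M where M: "1 \<le> M" "\<forall>t\<ge>0. \<exists>r>0. exp (L * t) * r \<le> 1 \<and> (\<forall>s t' u v. 0 \<le> s \<longrightarrow> s \<le> t' \<longrightarrow> t' \<le> t \<longrightarrow>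
    ode_solution (\<lambda>_. f) {s..t'} u \<longrightarrow> ode_solution (\<lambda>_. f) {s..t'} v \<longrightarrow>
    norm (u s - x s) \<le> r \<longrightarrow> norm (v s - x s) \<le> r \<longrightarrow> norm (u t' - v t') \<le> M * norm (u s - v s))"
    by (elim exE conjE)
  have "E_traj f x \<alpha> t \<le> ereal (M * t)" if \<alpha>: "admissible \<alpha>" and t: "0 \<le> t" for \<alpha> t
  proof -
    obtain r where r: "0 < r" "exp (L * t) * r \<le> 1"
      "\<forall>s t' u v. 0 \<le> s \<longrightarrow> s \<le> t' \<longrightarrow> t' \<le> t \<longrightarrow>
        ode_solution (\<lambda>_. f) {s..t'} u \<longrightarrow> ode_solution (\<lambda>_. f) {s..t'} v \<longrightarrow>
        norm (u s - x s) \<le> r \<longrightarrow> norm (v s - x s) \<le> r \<longrightarrow> norm (u t' - v t') \<le> M * norm (u s - v s)"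
      using M(2)[rule_format, OF t] by (elim exE conjE)
    show ?thesis
    proof (rule E_traj_le[OF assms(3) M(1) t r(1) _ _ \<alpha>])
      fix s y assume s: "0 \<le> s" "s \<le> t" and y: "norm (y - x s) \<le> r"
      have xs: "ode_solution (\<lambda>_. f) {s..t} x" "norm (x \<tau>) \<le> R - 1" if "\<tau> \<in> {s..t}" for \<tau>
        using s that by (auto intro: ode_solution_subset[OF assms(3)] xR)
      \<comment> \<open>The radius was fixed for the full length \<open>t\<close>; starting at a
        later time \<open>s\<close> only shortens the interval.\<close>
      have "exp (L * (t - s)) * norm (y - x s) \<le> exp (L * t) * r"
        using s y L r(1) by (intro mult_mono) auto
      then have le: "exp (L * (t - s)) * norm (y - x s) \<le> 1" using r(2) by simp
      show "\<exists>u. ode_solution (\<lambda>_. f) {s..t} u \<and> u s = y"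
        by (rule exists_near[OF xs(1) xs(2) s(2) le]) (use s in auto)
    next
      fix s t' u v
      assume "0 \<le> s" "s \<le> t'" "t' \<le> t" "ode_solution (\<lambda>_. f) {s..t'} u" "ode_solution (\<lambda>_. f) {s..t'} v"
        "norm (u s - x s) \<le> r" "norm (v s - x s) \<le> r"
      then show "norm (u t' - v t') \<le> M * norm (u s - v s)" using r(3) by simp
    qed
  qed
  moreover have "0 < M" using M(1) by simp
  ultimately show ?thesis by blast
qed

end
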